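(* For an unoriented link diagram $L$ with $n\ge1$ components, let $$X[T](L) = \left(\frac{z}{w}\right)^{n-1}\sum_{k=1}^n \delta^{k-1}\,\widehat{E}_k \sum_{\pi} T(\pi L),$$ where the second summation is over all partitions $\pi$ of the set of components of $L$ into $k$ (unordered, non-empty) subsets, $T(\pi L)$ denotes the product of the polynomials $T$ of the $k$ sublinks of $L$ defined by $\pi$, $\delta=\frac{a-a^{-1}}{w}+1$, $\widehat{E}=E\,\frac{z}{w}$, $\widehat{E}_1=1$ and $\widehat{E}_k=(\widehat{E}^{-1}-1)(\widehat{E}^{-1}-2)\cdots(\widehat{E}^{-1}-k+1)$. Consider the following two properties of a regular isotopy invariant $I$ of unoriented links: (1) $I(L_+)-I(L_-)=z\,\big(I(L_0)-I(L_\infty)\big)$ for every unoriented Conway quadruple whose specified crossing involves two different components of the link; (2) $I(\mathcal{K}^r)=E^{1-r}T(\mathcal{K}^r)$ for every union $\mathcal{K}^r$ of $r\geq1$ unlinked knots. Then: (i) if $D[T]$ is a regular isotopy invariant of unoriented links satisfying (1) and (2), then $D[T](L)=X[T](L)$ for every unoriented link diagram $L$; (ii) independently of that, $X[T]$ is a well-defined regular isotopy invariant of unoriented links and $X[T]$ satisfies (1) and (2). Therefore $X[T]$ is a closed formula for $D[T]$.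
   Context: $z,w,a,E$ are indeterminates; invariants take values in the ring of Laurent polynomials $\mathbb{Z}[z^{\pm1},w^{\pm1},a^{\pm1},E^{\pm1}]$. Regular isotopy is the equivalence relation on planar link diagrams generated by planar isotopy and Reidemeister moves II and III; a regular isotopy invariant is a function on diagrams constant on regular isotopy classes. For a crossing, swinging the overcrossing arc counterclockwise sweeps two of the four local regions; joining these two regions is the $A$-smoothing, joining the other two is the $B$-smoothing. A crossing (drawn in the plane as an X) is of positive type if its $A$-smoothing is horizontal (one arc on top and one arc at the bottom) and of negative type if its $A$-smoothing is vertical. An unoriented Conway quadruple $L_+,L_-,L_0,L_\infty$ consists of four unoriented diagrams identical except near one specified crossing, which is of positive type in $L_+$, switched in $L_-$, and replaced in $L_0$ and $L_\infty$ by, respectively, the $A$-smoothing (horizontal) and the $B$-smoothing (vertical) of the crossing of $L_+$. A union of $r$ unlinked knots $\mathcal{K}^r=\sqcup_{i=1}^r K_i$ is an $r$-component link diagram representing a split link whose $r$ split components are (possibly non-trivial) knots $K_1,\dots,K_r$. $T=T(w,a)$, the (known) regular isotopy version of the Dubrovnik polynomial, is the regular isotopy invariant of unoriented links determined by: $T(L_+)-T(L_-)=w\,(T(L_0)-T(L_\infty))$ for every unoriented Conway quadruple (any crossing); $T(\text{diagram with a positive curl})=a\,T(\text{diagram without the curl})$ and $T(\text{diagram with a negative curl})=a^{-1}T(\text{diagram without the curl})$ (a curl is a Reidemeister I kink, its sign being the sign of its crossing for either orientation of the strand); $T=1$ on the standard crossingless unknot diagram. It follows that $T(\mathcal{K}^r)=\delta^{r-1}\prod_{i=1}^r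 T(K_i)$. *)

theory Defs
  imports Main
    "HOL-Library.Poly_Mapping"
    "HOL-Library.Product_Plus"
    "HOL-Library.Disjoint_Sets"
begin

section \<open>Laurent polynomials\<close>

text \<open>
  The ring \<open>\<int>[z\<^sup>\<plusminus>\<^sup>1, w\<^sup>\<plusminus>\<^sup>1, a\<^sup>\<plusminus>\<^sup>1, E\<^sup>\<plusminus>\<^sup>1]\<close> is the integral group ring of the exponent group
  \<open>\<int>\<^sup>4\<close>, that is, finitely supported functions with the convolution product. Exponents are listed
  in the order \<open>z, w, a, E\<close>.
\<close>

type_synonym laurent = "(int \<times> int \<times> int \<times> int) \<Rightarrow>\<^sub>0 int"

definition monomial :: "int \<Rightarrow> int \<Rightarrow> int \<Rightarrow> int \<Rightarrow> laurent" where
  "monomial i j k l = Poly_Mapping.single (i, j, k, l) 1"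

abbreviation lz :: laurent where "lz \<equiv> monomial 1 0 0 0"
abbreviation lz_inv :: laurent where "lz_inv \<equiv> monomial (- 1) 0 0 0"
abbreviation lw :: laurent where "lw \<equiv> monomial 0 1 0 0"
abbreviation lw_inv :: laurent where "lw_inv \<equiv> monomial 0 (- 1) 0 0"
abbreviation la :: laurent where "la \<equiv> monomial 0 0 1 0"
abbreviation la_inv :: laurent where "la_inv \<equiv> monomial 0 0 (- 1) 0"
abbreviation lE :: laurent where "lE \<equiv> monomial 0 0 0 1"
abbreviation lE_inv :: laurent where "lE_inv \<equiv> monomial 0 0 0 (- 1)"

lemma monomial_mult:
  "monomial i j k l * monomial i' j' k' l' = monomial (i + i') (j + j') (k + k') (l + l')"
  by (simp add: monomial_def mult_single)

lemma monomial_0: "monomial 0 0 0 0 = 1"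
  unfolding monomial_def by (metis single_one zero_prod_def)


section \<open>Link diagrams\<close>

text \<open>
  An unoriented planar link diagram is put in general position with respect to the height function
  and cut into horizontal slices, each of which contains exactly one minimum, maximum or crossing;
  crossings are drawn as an X. The diagram is the list of these slices, from bottom to top. The
  number \<open>i\<close> in a slice \<open>(p, i)\<close> says that \<open>i\<close> strands pass to the left of the piece \<open>p\<close>; strand
  positions are counted from 0, from left to right.

  \<^item> \<open>Cup\<close>: a minimum, creating strands at positions \<open>i\<close> and \<open>i + 1\<close>.
  \<^item> \<open>Cap\<close>: a maximum, joining the strands at positions \<open>i\<close> and \<open>i + 1\<close>.
  \<^item> \<open>Pos\<close>: a crossing whose overcrossing arc runs from bottom right to top left. Swinging it
    counterclockwise sweeps the left and the right region, so that the \<open>A\<close>-smoothing is horizontal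
    and the crossing is of positive type.
  \<^item> \<open>Neg\<close>: a crossing whose overcrossing arc runs from bottom left to top right. Its
    \<open>A\<close>-smoothing is vertical and the crossing is of negative type.
\<close>

datatype piece = Cup | Cap | Pos | Neg

type_synonym slices = "(piece \<times> nat) list"

fun ins :: "piece \<Rightarrow> nat" where
  "ins Cup = 0" | "ins Cap = 2" | "ins Pos = 2" | "ins Neg = 2"

fun outs :: "piece \<Rightarrow> nat" where
  "outs Cup = 2" | "outs Cap = 0" | "outs Pos = 2" | "outs Neg = 2"

text \<open>\<open>tangle n L m\<close>: the slices \<open>L\<close> fit together, with \<open>n\<close> end points below and \<open>m\<close> above.\<close>

fun tangle :: "nat \<Rightarrow> slices \<Rightarrow> nat \<Rightarrow> bool" where
  "tangle n [] m \<longleftrightarrow> n = m"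
| "tangle n ((p, i) # L) m \<longleftrightarrow> i + ins p \<le> n \<and> tangle (n - ins p + outs p) L m"

text \<open>The empty diagram is not a link diagram: links have at least one component.\<close>

definition link_diagram :: "slices \<Rightarrow> bool" where
  "link_diagram L \<longleftrightarrow> tangle 0 L 0 \<and> L \<noteq> []"


section \<open>Isotopy\<close>

text \<open>
  Planar isotopy of sliced diagrams is generated by interchanging the heights of two pieces that
  lie side by side, cancelling a minimum against an adjacent maximum, and rotating a crossing by a
  right angle past a minimum or a maximum. The last move changes the type of the crossing, because
  it exchanges its horizontal and its vertical smoothing.
\<close>

inductive planar_move :: "slices \<Rightarrow> slices \<Rightarrow> bool" where
  interchange:
    "planar_move [(q, i + ins p + d), (p, i)] [(p, i), (q, i + outs p + d)]"
| zigzag_left: "planar_move [(Cup, i), (Cap, Suc i)] []"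
| zigzag_right: "planar_move [(Cup, Suc i), (Cap, i)] []"
| rotate_cup_Pos: "planar_move [(Cup, i), (Pos, Suc i)] [(Cup, Suc i), (Neg, i)]"
| rotate_cup_Neg: "planar_move [(Cup, i), (Neg, Suc i)] [(Cup, Suc i), (Pos, i)]"
| rotate_cap_Pos: "planar_move [(Pos, Suc i), (Cap, i)] [(Neg, i), (Cap, Suc i)]"
| rotate_cap_Neg: "planar_move [(Neg, Suc i), (Cap, i)] [(Pos, i), (Cap, Suc i)]"

text \<open>
  The remaining versions of the second and the third Reidemeister move follow from these ones
  with the help of the planar moves and of each other.
\<close>

inductive reidemeister2 :: "slices \<Rightarrow> slices \<Rightarrow> bool" where
  "reidemeister2 [(Pos, i), (Neg, i)] []"
| "reidemeister2 [(Neg, i), (Pos, i)] []"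

inductive reidemeister3 :: "slices \<Rightarrow> slices \<Rightarrow> bool" where
  "reidemeister3 [(Pos, i), (Pos, Suc i), (Pos, i)] [(Pos, Suc i), (Pos, i), (Pos, Suc i)]"

text \<open>
  Curls on a strand at position \<open>i\<close>, bulging to the right or to the left. In both cases the two
  passages of the oriented strand through the crossing go in the same vertical direction, so that
  the crossing is positive for \<open>Neg\<close> (over from bottom left to top right) and negative for \<open>Pos\<close>.
  Up to planar isotopy these are all the curls.
\<close>

inductive positive_curl :: "slices \<Rightarrow> bool" where
  "positive_curl [(Cup, Suc i), (Neg, i), (Cap, Suc i)]"
| "positive_curl [(Cup, i), (Neg, Suc i), (Cap, i)]"

inductive negative_curl :: "slices \<Rightarrow> bool" where
  "negative_curl [(Cup, Suc i), (Pos, i), (Cap, Suc i)]"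
| "negative_curl [(Cup, i), (Pos, Suc i), (Cap, i)]"

definition regular_move :: "slices \<Rightarrow> slices \<Rightarrow> bool" where
  "regular_move x y \<longleftrightarrow> planar_move x y \<or> reidemeister2 x y \<or> reidemeister3 x y"

definition ambient_move :: "slices \<Rightarrow> slices \<Rightarrow> bool" where
  "ambient_move x y \<longleftrightarrow>
     regular_move x y \<or> ((positive_curl x \<or> negative_curl x) \<and> y = [])"

text \<open>
  Both diagrams are required to be well formed: in \<open>u @ v\<close> a zigzag or a curl may only be
  inserted where there is a strand, and a pair of crossings only where there are two.
\<close>

definition apply_move ::
  "(slices \<Rightarrow> slices \<Rightarrow> bool) \<Rightarrow> slices \<Rightarrow> slices \<Rightarrow> bool" where
  "apply_move M L L' \<longleftrightarrow> link_diagram L \<and> link_diagram L' \<and>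
     (\<exists>u x y v. L = u @ x @ v \<and> L' = u @ y @ v \<and> M x y)"

definition regular_isotopic :: "slices \<Rightarrow> slices \<Rightarrow> bool" where
  "regular_isotopic = equivclp (apply_move regular_move)"

definition ambient_isotopic :: "slices \<Rightarrow> slices \<Rightarrow> bool" where
  "ambient_isotopic = equivclp (apply_move ambient_move)"

definition regular_isotopy_invariant :: "(slices \<Rightarrow> laurent) \<Rightarrow> bool" where
  "regular_isotopy_invariant I \<longleftrightarrow>
     (\<forall>L L'. link_diagram L \<and> link_diagram L' \<and> regular_isotopic L L' \<longrightarrow> I L = I L')"


section \<open>Components and sublinks\<close>

text \<open>
  A link diagram is represented by its intersection points with the horizontal lines that bound
  its slices: \<open>(t, p)\<close> is the point at position \<open>p\<close> on the line just below slice number \<open>t\<close>.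
  Components of the link are the classes of points connected through the slices.
\<close>

definition width :: "slices \<Rightarrow> nat \<Rightarrow> nat" where
  "width L t = foldl (\<lambda>n (p, i). n - ins p + outs p) 0 (take t L)"

definition points :: "slices \<Rightarrow> (nat \<times> nat) set" where
  "points L = {(t, k). t \<le> length L \<and> k < width L t}"

inductive adjacent :: "slices \<Rightarrow> nat \<times> nat \<Rightarrow> nat \<times> nat \<Rightarrow> bool" for L where
  pass_left:
    "t < length L \<Longrightarrow> L ! t = (p, i) \<Longrightarrow> k < i \<Longrightarrow> adjacent L (t, k) (Suc t, k)"
| pass_right:
    "t < length L \<Longrightarrow> L ! t = (p, i) \<Longrightarrow> i + ins p + d < width L t \<Longrightarrow>
       adjacent L (t, i + ins p + d) (Suc t, i + outs p + d)"
| cup: "t < length L \<Longrightarrow> L ! t = (Cup, i) \<Longrightarrow> adjacent L (Suc t, i) (Suc t, Suc i)"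
| cap: "t < length L \<Longrightarrow> L ! t = (Cap, i) \<Longrightarrow> adjacent L (t, i) (t, Suc i)"
| cross_rising:
    "t < length L \<Longrightarrow> L ! t = (p, i) \<Longrightarrow> p \<in> {Pos, Neg} \<Longrightarrow> adjacent L (t, i) (Suc t, Suc i)"
| cross_falling:
    "t < length L \<Longrightarrow> L ! t = (p, i) \<Longrightarrow> p \<in> {Pos, Neg} \<Longrightarrow> adjacent L (t, Suc i) (Suc t, i)"

definition same_component :: "slices \<Rightarrow> ((nat \<times> nat) \<times> (nat \<times> nat)) set" where
  "same_component L = {(x, y) \<in> points L \<times> points L. equivclp (adjacent L) x y}"

definition components :: "slices \<Rightarrow> (nat \<times> nat) set set" where
  "components L = points L // same_component L"

text \<open>
  The sublink formed by a set \<open>S\<close> of components: all other strands are erased, so that crossings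
  with only one remaining strand disappear and the remaining pieces move to the left.
\<close>

definition kept :: "(nat \<times> nat) set \<Rightarrow> nat \<Rightarrow> piece \<times> nat \<Rightarrow> bool" where
  "kept P t s = (case s of
      (Cup, i) \<Rightarrow> (Suc t, i) \<in> P
    | (Cap, i) \<Rightarrow> (t, i) \<in> P
    | (_, i) \<Rightarrow> (t, i) \<in> P \<and> (t, Suc i) \<in> P)"

definition sublink :: "slices \<Rightarrow> (nat \<times> nat) set set \<Rightarrow> slices" where
  "sublink L S =
     map (\<lambda>t. (fst (L ! t), card {k. k < snd (L ! t) \<and> (t, k) \<in> \<Union>S}))
       (filter (\<lambda>t. kept (\<Union>S) t (L ! t)) [0..<length L])"


section \<open>Conway quadruples and unlinked knots\<close>

text \<open>
  \<open>L\<^sub>+\<close>, \<open>L\<^sub>-\<close>, \<open>L\<^sub>0\<close>, \<open>L\<^sub>\<infinity>\<close>, the specified crossing being slice number \<open>t\<close>. The horizontal smoothing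
  is a maximum below a minimum. The vertical smoothing consists of two vertical strands and is
  therefore no slice at all.
\<close>

definition conway_quadruple ::
  "nat \<Rightarrow> slices \<Rightarrow> slices \<Rightarrow> slices \<Rightarrow> slices \<Rightarrow> bool" where
  "conway_quadruple t Lp Lm L0 Linf \<longleftrightarrow> link_diagram Lp \<and>
     (\<exists>u i v. length u = t \<and>
        Lp = u @ [(Pos, i)] @ v \<and>
        Lm = u @ [(Neg, i)] @ v \<and>
        L0 = u @ [(Cap, i), (Cup, i)] @ v \<and>
        Linf = u @ v)"

definition mixed_crossing :: "slices \<Rightarrow> nat \<Rightarrow> bool" where
  "mixed_crossing L t \<longleftrightarrow>
     (\<exists>p i. t < length L \<and> L ! t = (p, i) \<and> p \<in> {Pos, Neg} \<and>
        ((t, i), (t, Suc i)) \<notin> same_component L)"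

definition knot_diagram :: "slices \<Rightarrow> bool" where
  "knot_diagram K \<longleftrightarrow> link_diagram K \<and> card (components K) = 1"

text \<open>
  \<open>concat Ks\<close> places the diagrams \<open>Ks\<close> in disjoint horizontal strips. A union of unlinked knots is
  any diagram of the split link represented in this way.
\<close>

definition unlinked_knots :: "nat \<Rightarrow> slices \<Rightarrow> bool" where
  "unlinked_knots r L \<longleftrightarrow> link_diagram L \<and>
     (\<exists>Ks. length Ks = r \<and> (\<forall>K\<in>set Ks. knot_diagram K) \<and> ambient_isotopic L (concat Ks))"


section \<open>The polynomials\<close>

definition dubrovnik :: "(slices \<Rightarrow> laurent) \<Rightarrow> bool" where
  "dubrovnik T \<longleftrightarrow>
     regular_isotopy_invariant T \<and>
     (\<forall>t Lp Lm L0 Linf. conway_quadruple t Lp Lm L0 Linf \<longrightarrow>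
        T Lp - T Lm = lw * (T L0 - T Linf)) \<and>
     (\<forall>u x v. link_diagram (u @ x @ v) \<and> positive_curl x \<longrightarrow>
        T (u @ x @ v) = la * T (u @ v)) \<and>
     (\<forall>u x v. link_diagram (u @ x @ v) \<and> negative_curl x \<longrightarrow>
        T (u @ x @ v) = la_inv * T (u @ v)) \<and>
     T [(Cup, 0), (Cap, 0)] = 1"

definition mixed_skein :: "(slices \<Rightarrow> laurent) \<Rightarrow> bool" where
  "mixed_skein I \<longleftrightarrow>
     (\<forall>t Lp Lm L0 Linf. conway_quadruple t Lp Lm L0 Linf \<and> mixed_crossing Lp t \<longrightarrow>
        I Lp - I Lm = lz * (I L0 - I Linf))"

definition unlinked_values ::
  "(slices \<Rightarrow> laurent) \<Rightarrow> (slices \<Rightarrow> laurent) \<Rightarrow> bool" where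
  "unlinked_values T I \<longleftrightarrow>
     (\<forall>r L. r \<ge> 1 \<and> unlinked_knots r L \<longrightarrow> I L = lE_inv ^ (r - 1) * T L)"

definition delta :: laurent where
  "delta = (la - la_inv) * lw_inv + 1"

text \<open>The inverse of \<open>E z / w\<close>, the only form in which this quantity is used.\<close>

definition Ehat_inv :: laurent where
  "Ehat_inv = lE_inv * lz_inv * lw"

definition Ehat_coeff :: "nat \<Rightarrow> laurent" where
  "Ehat_coeff k = (\<Prod>j=1..<k. Ehat_inv - of_nat j)"

definition X_formula :: "(slices \<Rightarrow> laurent) \<Rightarrow> slices \<Rightarrow> laurent" where
  "X_formula T L = (let n = card (components L) in
     (lz * lw_inv) ^ (n - 1) *
     (\<Sum>k=1..n. delta ^ (k - 1) * Ehat_coeff k *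
        (\<Sum>\<pi> | partition_on (components L) \<pi> \<and> card \<pi> = k. \<Prod>S\<in>\<pi>. T (sublink L S))))"

end

theory Submission
  imports Defs
begin

text \<open>
  Uniqueness: relation (1) allows to switch the crossings between a component and the rest of the link,
  because both smoothings have fewer components. Once the component lies above the rest, a braid that
  sorts the strands pulls it off, and after finitely many repetitions the link is a union of unlinked
  knots, where (2) applies.

  Relation (1) for the closed formula: switching a crossing between components \<open>a\<close> and \<open>b\<close> changes only
  the summands in which \<open>a\<close> and \<open>b\<close> belong to the same block, and the partitions in question are
  those of the components of either smoothing. Components are handled through labellings of strands; the
  universal labelling is characterised by a property that can be transported along moves slice by slice,
  and a parity argument shows that the smoothings merge \<open>a\<close> and \<open>b\<close>.

  Relation (2) for the closed formula reduces to the expansion of powers into falling factorials and to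
  \<open>T(A \<squnion> B) = \<delta> T(A) T(B)\<close>. The latter holds because a functional that satisfies the linear skein
  relations and vanishes on the unknot is zero.
\<close>

section \<open>Regular isotopy of tangles\<close>

text \<open>Components are sets of points whose coordinates change with every move, so two diagrams
  rarely share them; a common set of labels takes their place, and it is labels that are
  partitioned. In each block the switch of a mixed crossing obeys a relation with \<open>w\<close>;
  as both smoothings have exactly one component less, the prefactor (z/w)^(n-1) turns
  \<open>w\<close> into \<open>z\<close>. On r unlinked knots all partitions give the same power of
  \<delta>: a block of size s contributes the exponent s-1 and the explicit factor k-1, together
  r-1. What remains is the sum of the coefficients, a power of the inverse of Ehat, and the
  prefactor makes it E^(1-r). That \<open>T\<close> is multiplicative on split unions is not among
  its axioms; it comes from a uniqueness argument without orientations or an unknotting procedure: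
  the diagram is read upwards, the part already read being kept as a system of arcs lying one under
  another, so that the induction is on the remaining slices and the number of strands.\<close>

fun ok :: "nat \<Rightarrow> slices \<Rightarrow> bool" where
  "ok n [] \<longleftrightarrow> True"
| "ok n ((p, i) # L) \<longleftrightarrow> i + ins p \<le> n \<and> ok (n - ins p + outs p) L"

fun wid :: "nat \<Rightarrow> slices \<Rightarrow> nat" where
  "wid n [] = n"
| "wid n ((p, i) # L) = wid (n - ins p + outs p) L"

lemma tangle_iff: "tangle n L m \<longleftrightarrow> ok n L \<and> wid n L = m"
  by (induction n L m rule: tangle.induct) auto

lemma ok_append [simp]: "ok n (L @ L') \<longleftrightarrow> ok n L \<and> ok (wid n L) L'"
  by (induction n L rule: ok.induct) auto

lemma wid_append [simp]: "wid n (L @ L') = wid (wid n L) L'"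
  by (induction n L rule: wid.induct) auto

lemma link_diagram_iff: "link_diagram L \<longleftrightarrow> ok 0 L \<and> wid 0 L = 0 \<and> L \<noteq> []"
  by (auto simp: link_diagram_def tangle_iff)

definition shift :: "nat \<Rightarrow> slices \<Rightarrow> slices" where
  "shift k L = map (\<lambda>(p, i). (p, i + k)) L"

lemma shift_simps [simp]:
  "shift k [] = []" "shift k ((p, i) # L) = (p, i + k) # shift k L" "shift k (L @ L') = shift k L @ shift k L'"
  "shift 0 L = L" "shift j (shift k L) = shift (k + j) L" "shift k L = [] \<longleftrightarrow> L = []" "length (shift k L) = length L"
  by (auto simp: shift_def)

lemma ok_shift: "ok n L \<Longrightarrow> ok (k + n + m) (shift k L) \<and> wid (k + n + m) (shift k L) = k + wid n L + m"
proof (induction n L rule: ok.induct)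
  case (2 n p i L)
  then have e: "k + n + m - ins p + outs p = k + (n - ins p + outs p) + m" by auto
  from 2 show ?case by (simp only: shift_simps prod.case ok.simps wid.simps e) auto
qed auto

lemma ok_mono: "ok n L \<Longrightarrow> n \<le> n' \<Longrightarrow> ok n' L"
  using ok_shift[of n L 0 "n' - n"] by simp

lemma wid_mono: "ok n L \<Longrightarrow> wid (n + m) L = wid n L + m"
  using ok_shift[of n L 0 m] by simp

lemma regular_move_shift: "regular_move x y \<Longrightarrow> regular_move (shift k x) (shift k y)"
proof -
  have *: "planar_move x y \<Longrightarrow> planar_move (shift k x) (shift k y)"
  proof (induction rule: planar_move.induct)
    case (interchange q i p d)
    show ?case using planar_move.interchange[of q "i + k" p d] by (simp add: algebra_simps)
  qed (auto intro: planar_move.intros)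
  assume "regular_move x y"
  with * show ?thesis
    unfolding regular_move_def
    by (auto elim!: reidemeister2.cases reidemeister3.cases
        intro: reidemeister2.intros reidemeister3.intros)
qed

lemma ambient_move_wid:
  assumes "ambient_move x y" "ok n x" "ok n y"
  shows "wid n x = wid n y"
  using assms unfolding regular_move_def ambient_move_def
  by (auto elim!: planar_move.cases reidemeister2.cases reidemeister3.cases
      positive_curl.cases negative_curl.cases)

lemma regular_move_wid:
  "regular_move x y \<Longrightarrow> ok n x \<Longrightarrow> ok n y \<Longrightarrow> wid n x = wid n y"
  by (rule ambient_move_wid) (auto simp: ambient_move_def)

definition rstep :: "nat \<Rightarrow> slices \<Rightarrow> slices \<Rightarrow> bool" where
  "rstep n L L' \<longleftrightarrow>
     (\<exists>u x y v. L = u @ x @ v \<and> L' = u @ y @ v \<and> regular_move x y \<and> ok n L \<and> ok n L')"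

definition req :: "nat \<Rightarrow> slices \<Rightarrow> slices \<Rightarrow> bool" where
  "req n = equivclp (rstep n)"

lemma req_refl [simp, intro]: "req n L L"
  by (simp add: req_def)

lemma req_sym: "req n L L' \<Longrightarrow> req n L' L"
  by (simp add: req_def equivclp_sym)

lemma req_trans [trans]: "req n L L' \<Longrightarrow> req n L' L'' \<Longrightarrow> req n L L''"
  unfolding req_def by (rule equivclp_trans)

lemma rstep_ok: "rstep n L L' \<Longrightarrow> ok n L \<and> ok n L' \<and> wid n L = wid n L'"
  unfolding rstep_def by (auto dest: regular_move_wid)

lemma req_ok:
  assumes "req n L L'" "ok n L"
  shows "ok n L' \<and> wid n L' = wid n L"
  using assms(1) unfolding req_def
  by (induction rule: equivclp_induct) (use assms(2) rstep_ok in force)+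

lemma req_induct [consumes 1, case_names base step]:
  assumes "req n L L'" "P L" "\<And>y z. P y \<Longrightarrow> rstep n y z \<or> rstep n z y \<Longrightarrow> P z"
  shows "P L'"
  using assms(1) unfolding req_def
  by (induction rule: equivclp_induct) (use assms in auto)

lemma rstep_req: "rstep n y z \<or> rstep n z y \<Longrightarrow> req n y z"
  by (auto simp: req_def intro: equivclp_sym r_into_equivclp)

lemma req_move:
  "regular_move x y \<Longrightarrow> ok n x \<Longrightarrow> ok n y \<Longrightarrow> req n x y"
  by (rule rstep_req) (metis append_Nil append_Nil2 rstep_def)

lemma rstep_ctx:
  assumes "rstep n x y" "ok k u" "wid k u = n" "ok (wid n x) v"
  shows "rstep k (u @ x @ v) (u @ y @ v)"
proof -
  obtain u' x' y' v' where *: "x = u' @ x' @ v'" "y = u' @ y' @ v'" "regular_move x' y'" "ok n x" "ok n y"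
    using assms(1) by (auto simp: rstep_def)
  show ?thesis unfolding rstep_def
    using * assms rstep_ok[OF assms(1)]
    by (intro exI[of _ "u @ u'"] exI[of _ x'] exI[of _ y'] exI[of _ "v' @ v"]) auto
qed

text \<open>The condition on \<open>v\<close> may presuppose that \<open>x\<close> is well formed:
  no step applies to an ill-formed \<open>x\<close>, so that \<open>y = x\<close> in this
  case.\<close>

lemma req_ctx:
  assumes "req n x y" "ok k u" "wid k u = n" "ok n x \<Longrightarrow> ok (wid n x) v"
  shows "req k (u @ x @ v) (u @ y @ v)"
proof (cases "ok n x")
  case True
  have "req k (u @ x @ v) (u @ y @ v) \<and> ok n y \<and> wid n y = wid n x"
    using assms(1)
  proof (induction rule: req_induct)
    case base
    then show ?case using True by simp
  next
    case (step y z)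
    then show ?case
      using rstep_ctx[of n y z k u v] rstep_ctx[of n z y k u v] rstep_ok[of n y z] rstep_ok[of n z y]
        assms(2-4) True rstep_req req_trans
      by (metis (no_types, lifting))
  qed
  then show ?thesis by simp
next
  case False
  have "y = x" using assms(1)
    by (induction rule: req_induct) (use False rstep_ok in blast)+
  then show ?thesis by simp
qed

lemma req_left: "req (wid k u) x y \<Longrightarrow> ok k u \<Longrightarrow> req k (u @ x) (u @ y)"
  using req_ctx[of "wid k u" x y k u "[]"] by simp

lemma req_right: "req k x y \<Longrightarrow> (ok k x \<Longrightarrow> ok (wid k x) v) \<Longrightarrow> req k (x @ v) (y @ v)"
  using req_ctx[of k x y k "[]" v] by simp

lemma rstep_shift:
  assumes "rstep n x y"
  shows "rstep (a + n + b) (shift a x) (shift a y)"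
  using assms ok_shift[of n _ a b] regular_move_shift[of _ _ a] unfolding rstep_def
  by (metis shift_simps(3))

lemma req_shift:
  assumes "req n x y"
  shows "req (a + n + b) (shift a x) (shift a y)"
  using assms
proof (induction rule: req_induct)
  case (step y z)
  then show ?case using rstep_shift[of n _ _ a b] req_trans rstep_req by meson
qed simp

lemma req_shift': "req n x y \<Longrightarrow> a + n \<le> m \<Longrightarrow> req m (shift a x) (shift a y)"
  using req_shift[of n x y a "m - a - n"] by simp

section \<open>Pieces and tangles side by side exchange their heights\<close>

lemma comm1:
  assumes "i + ins p \<le> j" "j + ins q \<le> n"
  shows "req n [(q, j), (p, i)] [(p, i), (q, j - ins p + outs p)]"
proof -
  have "planar_move [(q, i + ins p + (j - i - ins p)), (p, i)] [(p, i), (q, i + outs p + (j - i - ins p))]"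
    by (rule planar_move.interchange)
  then have "regular_move [(q, j), (p, i)] [(p, i), (q, j - ins p + outs p)]"
    using assms by (auto simp: regular_move_def algebra_simps)
  then show ?thesis by (rule req_move) (use assms in auto)
qed

lemma comm1_slices:
  assumes "ok k A" "k \<le> j" "j + ins q \<le> n"
  shows "req n ((q, j) # A) (A @ [(q, j - k + wid k A)])"
  using assms
proof (induction k A arbitrary: n j rule: ok.induct)
  case (2 k p i A)
  have a: "req n [(q, j), (p, i)] [(p, i), (q, j - ins p + outs p)]"
    by (rule comm1) (use 2 in auto)
  have 1: "req n ([(q, j), (p, i)] @ A) ([(p, i), (q, j - ins p + outs p)] @ A)"
  proof (rule req_right[OF a])
    have "k - ins p + outs p \<le> wid n [(q, j), (p, i)]" using "2.prems" by auto
    then show "ok (wid n [(q, j), (p, i)]) A" using "2.prems" by (auto intro: ok_mono)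
  qed
  have 2: "req n ([(p, i)] @ (q, j - ins p + outs p) # A) ([(p, i)] @ A @ [(q, j - k + wid (k - ins p + outs p) A)])"
  proof (rule req_left)
    have "req (wid n [(p, i)]) ((q, j - ins p + outs p) # A)
      (A @ [(q, (j - ins p + outs p) - (k - ins p + outs p) + wid (k - ins p + outs p) A)])"
      by (rule 2(1)) (use "2.prems" in auto)
    moreover have "(j - ins p + outs p) - (k - ins p + outs p) = j - k"
      using "2.prems" by auto
    ultimately show "req (wid n [(p, i)]) ((q, j - ins p + outs p) # A)
      (A @ [(q, j - k + wid (k - ins p + outs p) A)])" by simp
  qed (use "2.prems" in auto)
  from 1 2 show ?case by simp (rule req_trans)
qed auto

text \<open>The slices of the right tangle \<open>B\<close> are lifted above \<open>A\<close> one at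
  a time. The offset of \<open>B\<close> is the number of ends of \<open>A\<close> next to it:
  \<open>k\<close> below \<open>A\<close> and \<open>wid k A\<close> above.\<close>

lemma comm:
  assumes "ok k A" "ok m B" "k + m \<le> n"
  shows "req n (shift k B @ A) (A @ shift (wid k A) B)"
  using assms(2,3)
proof (induction m B arbitrary: n rule: ok.induct)
  case (2 m q j B)
  have 1: "req n ([(q, j + k)] @ (shift k B @ A)) ([(q, j + k)] @ A @ shift (wid k A) B)"
    by (rule req_left) (use 2 in auto)
  have 2: "req n (((q, j + k) # A) @ shift (wid k A) B) ((A @ [(q, j + k - k + wid k A)]) @ shift (wid k A) B)"
  proof (rule req_right[OF comm1_slices])
    have "n - ins q + outs q = k + (n - k - ins q + outs q)" using 2 by simp
    then have "wid (n - ins q + outs q) A = wid k A + (n - k - ins q + outs q)"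
      by (simp only: wid_mono[OF assms(1)])
    moreover have "ok (n - k - ins q + outs q) B" using 2 by (auto intro: ok_mono)
    ultimately show "ok (wid n ((q, j + k) # A)) (shift (wid k A) B)"
      using ok_shift[of "n - k - ins q + outs q" B "wid k A" 0] by simp
  qed (use assms 2 in auto)
  from 1 2 show ?case by simp (rule req_trans)
qed auto


section \<open>Strands passing under others\<close>

text \<open>The format for chains of rewritings: the left side \<open>L\<close> stays fixed, so its
  well-formedness is checked once and passes on to all later diagrams.\<close>

lemma req_mid:
  assumes "req n L (u @ x @ v)" "ok n L" "req (wid n u) x y"
  shows "req n L (u @ y @ v)"
proof -
  have "ok n (u @ x @ v)" using req_ok[OF assms(1,2)] by blast
  then have "req n (u @ x @ v) (u @ y @ v)" by (intro req_ctx[OF assms(3)]) auto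
  with assms(1) show ?thesis by (rule req_trans)
qed

lemma req_local:
  "i < n \<Longrightarrow> req n [(Cup, i), (Cap, Suc i)] []"
  "i < n \<Longrightarrow> req n [(Cup, Suc i), (Cap, i)] []"
  "i < n \<Longrightarrow> req n [(Cup, i), (Pos, Suc i)] [(Cup, Suc i), (Neg, i)]"
  "i < n \<Longrightarrow> req n [(Cup, i), (Neg, Suc i)] [(Cup, Suc i), (Pos, i)]"
  "i + 3 \<le> n \<Longrightarrow> req n [(Pos, Suc i), (Cap, i)] [(Neg, i), (Cap, Suc i)]"
  "i + 3 \<le> n \<Longrightarrow> req n [(Neg, Suc i), (Cap, i)] [(Pos, i), (Cap, Suc i)]"
  "i + 2 \<le> n \<Longrightarrow> req n [(Pos, i), (Neg, i)] []"
  "i + 2 \<le> n \<Longrightarrow> req n [(Neg, i), (Pos, i)] []"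
  "i + 3 \<le> n \<Longrightarrow>
     req n [(Pos, i), (Pos, Suc i), (Pos, i)] [(Pos, Suc i), (Pos, i), (Pos, Suc i)]"
  by (rule req_move; auto simp: regular_move_def
      intro: planar_move.intros reidemeister2.intros reidemeister3.intros)+

lemmas req_local_sym = req_local[THEN req_sym]

section \<open>One strand passing under a minimum, a maximum or a crossing\<close>

lemma under_Cup: "i < n \<Longrightarrow> req n [(Cup, Suc i), (Pos, i), (Pos, Suc i)] [(Cup, i)]"
  using req_mid[of n "[(Cup, Suc i), (Pos, i), (Pos, Suc i)]" "[]" "[(Cup, Suc i), (Pos, i)]"
      "[(Pos, Suc i)]" "[(Cup, i), (Neg, Suc i)]"]
    req_mid[of n "[(Cup, Suc i), (Pos, i), (Pos, Suc i)]" "[(Cup, i)]" "[(Neg, Suc i), (Pos, Suc i)]"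
      "[]" "[]"]
  by (simp add: req_local req_local_sym)

lemma under_Cap:
  assumes "i + 3 \<le> n"
  shows "req n [(Pos, i), (Pos, Suc i), (Cap, i)] [(Cap, Suc i)]"
proof -
  have "i \<le> n - 2" "Suc i \<le> n - 2" using assms by simp_all
  then show ?thesis
  using assms req_mid[of n "[(Pos, i), (Pos, Suc i), (Cap, i)]" "[(Pos, i)]" "[(Pos, Suc i), (Cap, i)]"
      "[]" "[(Neg, i), (Cap, Suc i)]"]
    req_mid[of n "[(Pos, i), (Pos, Suc i), (Cap, i)]" "[]" "[(Pos, i), (Neg, i)]"
      "[(Cap, Suc i)]" "[]"]
  by (simp add: req_local req_local_sym)
qed

text \<open>Conjugation: a cancelling pair \<open>Pos\<close>, \<open>Neg\<close> inserted at the
  end makes the given third Reidemeister move applicable, after which the negative crossing at the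
  bottom cancels. Versions of the move with a crossing of the other type arise in this way.\<close>

lemma under_Neg:
  assumes "i + 3 \<le> n"
  shows "req n [(Neg, Suc i), (Pos, i), (Pos, Suc i)] [(Pos, i), (Pos, Suc i), (Neg, i)]"
proof -
  have le: "i \<le> n - 2" "Suc i \<le> n - 2" using assms by simp_all
  let ?L = "[(Neg, Suc i), (Pos, i), (Pos, Suc i)]"
  have 1: "req n ?L [(Neg, Suc i), (Pos, i), (Pos, Suc i), (Pos, i), (Neg, i)]"
    using req_mid[of n ?L "[(Neg, Suc i), (Pos, i), (Pos, Suc i)]" "[]" "[]" "[(Pos, i), (Neg, i)]"] assms le
    by (simp add: req_local_sym)
  have 2: "req n ?L [(Neg, Suc i), (Pos, Suc i), (Pos, i), (Pos, Suc i), (Neg, i)]"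
    using req_mid[of n ?L "[(Neg, Suc i)]" "[(Pos, i), (Pos, Suc i), (Pos, i)]" "[(Neg, i)]"
        "[(Pos, Suc i), (Pos, i), (Pos, Suc i)]"] 1 assms le
    by (simp add: req_local)
  show ?thesis
    using req_mid[of n ?L "[]" "[(Neg, Suc i), (Pos, Suc i)]" "[(Pos, i), (Pos, Suc i), (Neg, i)]" "[]"] 2 assms le
    by (simp add: req_local)
qed

section \<open>The two strands of a piece passing under a third strand\<close>

lemma under2_Cup: "i < n \<Longrightarrow> req n [(Cup, i), (Pos, Suc i), (Pos, i)] [(Cup, Suc i)]"
  using req_mid[of n "[(Cup, i), (Pos, Suc i), (Pos, i)]" "[]" "[(Cup, i), (Pos, Suc i)]"
      "[(Pos, i)]" "[(Cup, Suc i), (Neg, i)]"]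
    req_mid[of n "[(Cup, i), (Pos, Suc i), (Pos, i)]" "[(Cup, Suc i)]" "[(Neg, i), (Pos, i)]"
      "[]" "[]"]
  by (simp add: req_local req_local_sym)

lemma under2_Cap:
  assumes "i + 3 \<le> n"
  shows "req n [(Pos, Suc i), (Pos, i), (Cap, Suc i)] [(Cap, i)]"
proof -
  have "i \<le> n - 2" "Suc i \<le> n - 2" using assms by simp_all
  then show ?thesis
  using assms req_mid[of n "[(Pos, Suc i), (Pos, i), (Cap, Suc i)]" "[(Pos, Suc i)]" "[(Pos, i), (Cap, Suc i)]"
      "[]" "[(Neg, Suc i), (Cap, i)]"]
    req_mid[of n "[(Pos, Suc i), (Pos, i), (Cap, Suc i)]" "[]" "[(Pos, Suc i), (Neg, Suc i)]"
      "[(Cap, i)]" "[]"]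
  by (simp add: req_local req_local_sym)
qed

lemma under2_Neg:
  assumes "i + 3 \<le> n"
  shows "req n [(Neg, i), (Pos, Suc i), (Pos, i)] [(Pos, Suc i), (Pos, i), (Neg, Suc i)]"
proof -
  have le: "i \<le> n - 2" "Suc i \<le> n - 2" using assms by simp_all
  let ?L = "[(Neg, i), (Pos, Suc i), (Pos, i)]"
  have 1: "req n ?L [(Neg, i), (Pos, Suc i), (Pos, i), (Pos, Suc i), (Neg, Suc i)]"
    using req_mid[of n ?L "[(Neg, i), (Pos, Suc i), (Pos, i)]" "[]" "[]" "[(Pos, Suc i), (Neg, Suc i)]"] assms le
    by (simp add: req_local_sym)
  have 2: "req n ?L [(Neg, i), (Pos, i), (Pos, Suc i), (Pos, i), (Neg, Suc i)]"
    using req_mid[of n ?L "[(Neg, i)]" "[(Pos, Suc i), (Pos, i), (Pos, Suc i)]" "[(Neg, Suc i)]"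
        "[(Pos, i), (Pos, Suc i), (Pos, i)]"] 1 assms le
    by (simp add: req_local_sym)
  show ?thesis
    using req_mid[of n ?L "[]" "[(Neg, i), (Pos, i)]" "[(Pos, Suc i), (Pos, i), (Neg, Suc i)]" "[]"] 2 assms le
    by (simp add: req_local)
qed

text \<open>The strand at position \<open>k\<close> passes to the right under the next \<open>r\<close> strands.\<close>

definition run :: "nat \<Rightarrow> nat \<Rightarrow> slices" where
  "run k r = map (\<lambda>t. (Pos, k + t)) [0..<r]"

lemma run_0 [simp]: "run k 0 = []"
  by (simp add: run_def)

lemma run_Suc: "run k (Suc r) = run k r @ [(Pos, k + r)]"
  by (simp add: run_def)

lemma run_add: "run k (r + s) = run k r @ run (k + r) s"
  by (induction s) (auto simp: run_Suc)

lemma run_Cons: "run k (Suc r) = (Pos, k) # run (Suc k) r"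
  using run_add[of k 1 r] by (simp add: run_Suc)

lemma shift_run [simp]: "shift a (run k r) = run (k + a) r"
  by (simp add: run_def shift_def)

lemma wid_run: "k + r < n \<Longrightarrow> wid n (run k r) = n"
  by (induction r) (auto simp: run_Suc)

lemma ok_run: "k + r < n \<Longrightarrow> ok n (run k r)"
  by (induction r) (auto simp: run_Suc wid_run)

text \<open>The run is cut into the parts left of, across and right of the piece. Only the middle
  part, of length \<open>outs p\<close> above the piece and \<open>ins p\<close> below it, needs a
  move that changes crossings; the outer parts are clear of the piece and commute with it.\<close>

lemma under_run:
  assumes "i + ins p \<le> r" "r < n"
  shows "req n ((p, Suc i) # run 0 (r - ins p + outs p)) (run 0 r @ [(p, i)])"
proof -
  define m where "m = r - i - ins p"
  define L where "L = (p, Suc i) # run 0 (r - ins p + outs p)"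
  have r: "r = i + ins p + m" using assms by (simp add: m_def)
  have okL: "ok n L" unfolding L_def using assms by (auto intro!: ok_run)
  have L: "L = (p, Suc i) # run 0 i @ run i (outs p) @ run (i + outs p) m"
  proof -
    have "r - ins p + outs p = i + outs p + m" by (simp add: r)
    then show ?thesis unfolding L_def by (simp only: run_add append.simps append_assoc add_0)
  qed
  have "req n L (run 0 i @ [(p, Suc i)] @ run i (outs p) @ run (i + outs p) m)"
    using req_mid[of n L "[]" "(p, Suc i) # run 0 i" "run i (outs p) @ run (i + outs p) m"
        "run 0 i @ [(p, Suc i)]"] comm1_slices[of "Suc i" "run 0 i" "Suc i" p n] okL L assms
    by (simp add: ok_run wid_run)
  moreover have "req n ((p, Suc i) # run i (outs p)) (run i (ins p) @ [(p, i)])"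
    using assms under_Cup[of i n] under_Cap[of i n, THEN req_sym] under_Neg[of i n] req_local_sym(9)[of i n]
    by (cases p) (simp_all add: numeral_2_eq_2 run_Suc)
  moreover have w: "wid n (run 0 i) = n" using assms by (simp add: wid_run)
  ultimately have 1: "req n L (run 0 i @ run i (ins p) @ [(p, i)] @ run (i + outs p) m)"
    using req_mid[of n L "run 0 i" "(p, Suc i) # run i (outs p)" "run (i + outs p) m"
        "run i (ins p) @ [(p, i)]"] okL by simp
  have w': "wid n (run i (ins p)) = n" using assms by (simp add: wid_run)
  have 2: "req n ([(p, i)] @ run (i + outs p) m) (run (i + ins p) m @ [(p, i)])"
  proof -
    have "i + ins p + Suc m \<le> n" using assms by (simp add: m_def)
    then have "req n (run (i + ins p) m @ [(p, i)]) ([(p, i)] @ run (i + outs p) m)"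
      using comm[of "i + ins p" "[(p, i)]" "Suc m" "run 0 m" n] by (simp add: ok_run)
    then show ?thesis by (rule req_sym)
  qed
  have "req n L (run 0 i @ run i (ins p) @ run (i + ins p) m @ [(p, i)])"
    using req_mid[of n L "run 0 i @ run i (ins p)" "[(p, i)] @ run (i + outs p) m" "[]"
        "run (i + ins p) m @ [(p, i)]"] okL 1 2 w w' by simp
  then show ?thesis by (simp add: L_def r run_add)
qed

text \<open>Two strands (or none) at the left end pass to the right under \<open>r\<close> strands.\<close>

definition run2 :: "nat \<Rightarrow> nat \<Rightarrow> slices" where
  "run2 k r = (if k = 0 then [] else run 1 r @ run 0 r)"

text \<open>Peels off the crossings with the last of the \<open>Suc r\<close> strands. The last
  crossing of \<open>run 1 (Suc r)\<close> lies at position \<open>Suc r\<close>, out of reach of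
  \<open>run 0 r\<close>, and therefore commutes with it.\<close>

lemma run2_Suc:
  assumes "r + 3 \<le> n"
  shows "req n (run2 k (Suc r)) (run2 k r @ (if k = 0 then [] else [(Pos, Suc r), (Pos, r)]))"
proof (cases "k = 0")
  case False
  have "req n ((Pos, Suc r) # run 0 r) (run 0 r @ [(Pos, Suc r)])"
    using comm1_slices[of "Suc r" "run 0 r" "Suc r" Pos n] assms by (simp add: ok_run wid_run)
  then show ?thesis
    using False assms req_ctx[of n "(Pos, Suc r) # run 0 r" "run 0 r @ [(Pos, Suc r)]" n "run 1 r" "[(Pos, r)]"]
    by (simp add: run2_def run_Suc wid_run ok_run)
qed (simp add: run2_def)

lemma ok_run2: "r + k \<le> n \<Longrightarrow> k = 0 \<or> k = 2 \<Longrightarrow> ok n (run2 k r) \<and> wid n (run2 k r) = n"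
  by (auto simp: run2_def ok_run wid_run)

lemma ins_outs: "ins p = 0 \<or> ins p = 2" "outs p = 0 \<or> outs p = 2"
  by (cases p; simp)+

text \<open>Induction on the strands passed: each step takes the piece under one further strand, by
  an \<open>under2\<close> lemma or the third Reidemeister move.\<close>

lemma under_run2:
  assumes "r + ins p \<le> n"
  shows "req n ((p, 0) # run2 (outs p) r) (run2 (ins p) r @ [(p, r)])"
  using assms
proof (induction r)
  case 0
  then show ?case by (simp add: run2_def)
next
  case (Suc r)
  let ?L = "(p, 0) # run2 (outs p) (Suc r)"
  let ?E = "\<lambda>k. if k = 0 then [] else [(Pos, Suc r), (Pos, r)]"
  have okL: "ok n ?L" using Suc.prems by (cases p) (auto simp: run2_def ok_run wid_run)
  have "req (n - ins p + outs p) (run2 (outs p) (Suc r)) (run2 (outs p) r @ ?E (outs p))"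
  proof (cases "outs p = 0")
    case True
    then show ?thesis by (simp add: run2_def)
  next
    case False
    then have "r + 3 \<le> n - ins p + outs p" using Suc.prems by (cases p) simp_all
    then show ?thesis by (rule run2_Suc)
  qed
  then have 1: "req n ?L ([(p, 0)] @ (run2 (outs p) r @ ?E (outs p)) @ [])"
    by - (rule req_mid[where x = "run2 (outs p) (Suc r)"], simp, rule okL, simp only: wid.simps)
  have "req n ((p, 0) # run2 (outs p) r) (run2 (ins p) r @ [(p, r)])" using Suc by simp
  then have 2: "req n ?L ([] @ (run2 (ins p) r @ [(p, r)]) @ ?E (outs p))"
    using 1 by - (rule req_mid[where x = "(p, 0) # run2 (outs p) r"], simp, rule okL, simp)
  have 3: "req n ((p, r) # ?E (outs p)) (?E (ins p) @ [(p, Suc r)])"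
    using Suc.prems under2_Cup[of r n] under2_Cap[of r n, THEN req_sym] under2_Neg[of r n] req_local(9)[of r n]
    by (cases p) simp_all
  have w: "wid n (run2 (ins p) r) = n" using ok_run2[of r "ins p" n] ins_outs(1)[of p] Suc.prems by simp
  have 4: "req n ?L (run2 (ins p) r @ (?E (ins p) @ [(p, Suc r)]) @ [])"
    using 2 3 w by - (rule req_mid[where x = "(p, r) # ?E (outs p)"], simp, rule okL, simp)
  have "req n (run2 (ins p) r @ ?E (ins p)) (run2 (ins p) (Suc r))"
  proof (cases "ins p = 0")
    case True
    then show ?thesis by (simp add: run2_def)
  next
    case False
    then have "r + 3 \<le> n" using Suc.prems by (cases p) simp_all
    then show ?thesis by (rule req_sym[OF run2_Suc])
  qed
  then have "req n ?L ([] @ run2 (ins p) (Suc r) @ [(p, Suc r)])"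
    using 4 by - (rule req_mid[where x = "run2 (ins p) r @ ?E (ins p)"], simp, rule okL, simp)
  then show ?case by simp
qed


section \<open>Labelled diagrams and separation of a top layer\<close>

text \<open>A form of \<open>req_mid\<close> in which the decompositions of both diagrams are
  separate equations, left to simplification.\<close>

lemma req_via:
  assumes "req n L A" "ok n L" "A = u @ x @ v" "req (wid n u) x y" "B = u @ y @ v"
  shows "req n L B"
  using req_mid[of n L u x v y] assms by simp

text \<open>The labels of the strands entering and leaving a piece. In \<open>chain c L cs e\<close> the list \<open>cs\<close> contains the
  label lists of the horizontal lines above the slices, so the first line \<open>c\<close> is not part of it.\<close>

fun loc :: "piece \<Rightarrow> 'c list \<Rightarrow> 'c list \<Rightarrow> bool" where
  "loc Cup M N \<longleftrightarrow> M = [] \<and> (\<exists>x. N = [x, x])"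
| "loc Cap M N \<longleftrightarrow> N = [] \<and> (\<exists>x. M = [x, x])"
| "loc Pos M N \<longleftrightarrow> (\<exists>x y. M = [x, y] \<and> N = [y, x])"
| "loc Neg M N \<longleftrightarrow> (\<exists>x y. M = [x, y] \<and> N = [y, x])"

lemma loc_length: "loc p M N \<Longrightarrow> length M = ins p \<and> length N = outs p"
  by (cases p) auto

definition lstep :: "'c list \<Rightarrow> piece \<times> nat \<Rightarrow> 'c list \<Rightarrow> bool" where
  "lstep c s d \<longleftrightarrow> (\<exists>a b M N. c = a @ M @ b \<and> d = a @ N @ b \<and> length a = snd s \<and> loc (fst s) M N)"

fun chain :: "'c list \<Rightarrow> slices \<Rightarrow> 'c list list \<Rightarrow> 'c list \<Rightarrow> bool" where
  "chain c [] cs e \<longleftrightarrow> cs = [] \<and> c = e"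
| "chain c (s # L) cs e \<longleftrightarrow> (\<exists>d ds. cs = d # ds \<and> lstep c s d \<and> chain d L ds e)"

lemma lstepE:
  assumes "lstep c (p, i) d"
  obtains a b M N where "c = a @ M @ b" "d = a @ N @ b" "length a = i" "loc p M N"
    "length M = ins p" "length N = outs p"
proof -
  from assms obtain a b M N where "c = a @ M @ b" "d = a @ N @ b" "length a = i" "loc p M N"
    by (auto simp: lstep_def)
  then show ?thesis using loc_length[of p M N] that by blast
qed

lemma chain_ConsE:
  assumes "chain c (s # L) cs e"
  obtains p i d ds a b M N where "s = (p, i)" "cs = d # ds" "lstep c s d" "chain d L ds e"
    "c = a @ M @ b" "d = a @ N @ b" "length a = i" "loc p M N"
proof -
  obtain p i where s: "s = (p, i)" by force
  from assms obtain d ds where d: "cs = d # ds" "lstep c s d" "chain d L ds e" by auto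
  from d(2) obtain a b M N where "c = a @ M @ b" "d = a @ N @ b" "length a = i" "loc p M N"
    unfolding s by (rule lstepE)
  with s d show ?thesis by (rule that)
qed

lemma chain_append:
  "chain c (L @ L') cs e \<longleftrightarrow>
     (\<exists>cs1 cs2 d. cs = cs1 @ cs2 \<and> chain c L cs1 d \<and> chain d L' cs2 e)"
proof (induction L arbitrary: c cs)
  case (Cons s L)
  show ?case
    by (simp add: Cons) (metis append_Cons)
qed auto

lemma chain_appendI: "chain c L cs d \<Longrightarrow> chain d L' cs' e \<Longrightarrow> chain c (L @ L') (cs @ cs') e"
  by (auto simp: chain_append)

lemma chain_length: "chain c L cs e \<Longrightarrow> length cs = length L"
  by (induction c L cs e rule: chain.induct) auto

lemma lstep_wid: "lstep c (p, i) d \<Longrightarrow> i + ins p \<le> length c \<and> length d = length c - ins p + outs p"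
  by (elim lstepE) auto

lemma chain_ok: "chain c L cs e \<Longrightarrow> ok (length c) L \<and> wid (length c) L = length e"
proof (induction L arbitrary: c cs)
  case (Cons s L)
  then show ?case by (cases s) (fastforce dest: lstep_wid)
qed auto

text \<open>Incoming and outgoing strands are both tested because a minimum has only outgoing and a
  maximum only incoming ones.\<close>

definition keep :: "('c \<Rightarrow> bool) \<Rightarrow> 'c list \<Rightarrow> piece \<times> nat \<Rightarrow> 'c list \<Rightarrow> bool" where
  "keep Q c s d \<longleftrightarrow> (\<forall>k < ins (fst s). Q (c ! (snd s + k))) \<and> (\<forall>k < outs (fst s). Q (d ! (snd s + k)))"

definition item :: "('c \<Rightarrow> bool) \<Rightarrow> 'c list \<Rightarrow> piece \<times> nat \<Rightarrow> 'c list \<Rightarrow> slices" where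
  "item Q c s d = (if keep Q c s d then [(fst s, length (filter Q (take (snd s) c)))] else [])"

text \<open>The counterpart of \<open>sublink\<close> for labelled diagrams. Being recursive in the
  slices, it is compatible with concatenation and hence with local moves;
  \<open>sublink_restr\<close> identifies the two.\<close>

fun restr :: "('c \<Rightarrow> bool) \<Rightarrow> 'c list \<Rightarrow> slices \<Rightarrow> 'c list list \<Rightarrow> slices" where
  "restr Q c (s # L) (d # cs) = item Q c s d @ restr Q d L cs"
| "restr Q c L cs = []"

lemma restr_append:
  "chain c L cs d \<Longrightarrow> restr Q c (L @ L') (cs @ cs') = restr Q c L cs @ restr Q d L' cs'"
  by (induction L arbitrary: c cs) auto

lemma keep_loc:
  assumes "loc p M N" "length a = i"
  shows "keep Q (a @ M @ b) (p, i) (a @ N @ b) \<longleftrightarrow> list_all Q M \<and> list_all Q N"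
  using assms by (cases p) (auto simp: keep_def nth_append less_2_cases_iff numeral_2_eq_2 All_less_Suc)

lemma item_loc:
  assumes "loc p M N"
  shows "item Q (a @ M @ b) (p, length a) (a @ N @ b) =
    (if list_all Q M \<and> list_all Q N then [(p, length (filter Q a))] else [])"
  using keep_loc[OF assms refl] by (simp add: item_def)

lemma item_keep: "loc p M N \<Longrightarrow> list_all Q M \<and> list_all Q N \<Longrightarrow>
    item Q (a @ M @ b) (p, length a) (a @ N @ b) = [(p, length (filter Q a))]"
  by (simp add: item_loc)

lemma item_skip: "loc p M N \<Longrightarrow> \<not> (list_all Q M \<and> list_all Q N) \<Longrightarrow>
    item Q (a @ M @ b) (p, length a) (a @ N @ b) = []"
  by (simp add: item_loc)

text \<open>A dropped piece involves no selected strand or is a crossing with at most one. In both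
  cases the selected labels pass through in the same order, so the neighbouring slices still fit
  together.\<close>

lemma not_keep_filter:
  "loc p M N \<Longrightarrow> \<not> (list_all Q M \<and> list_all Q N) \<Longrightarrow> filter Q M = filter Q N"
  by (cases p) auto

lemma filter_all: "list_all Q M \<Longrightarrow> filter Q M = M"
  by (simp add: list_all_iff)

text \<open>The set equation records that no selected label gets lost. It is the source of the
  non-emptiness of sublinks and of later bounds on the number of components.\<close>

lemma chain_restr:
  assumes "chain c L cs e"
  shows "\<exists>cs'. chain (filter Q c) (restr Q c L cs) cs' (filter Q e) \<and>
    set (filter Q c) \<union> (\<Union>x\<in>set cs'. set x) = {x \<in> set c \<union> (\<Union>x\<in>set cs. set x). Q x}"
  using assms
proof (induction L arbitrary: c cs)
  case (Cons s L)
  from Cons.prems(1) obtain p i d ds a b M N where s: "s = (p, i)"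
    and d: "cs = d # ds" "lstep c s d" "chain d L ds e"
    and ab: "c = a @ M @ b" "d = a @ N @ b" "length a = i" "loc p M N" by (rule chain_ConsE)
  from Cons.IH[OF d(3)] obtain cs' where cs': "chain (filter Q d) (restr Q d L ds) cs' (filter Q e)"
    "set (filter Q d) \<union> (\<Union>x\<in>set cs'. set x) = {x \<in> set d \<union> (\<Union>x\<in>set ds. set x). Q x}" by blast
  have it: "item Q c s d = (if list_all Q M \<and> list_all Q N then [(p, length (filter Q a))] else [])"
    using item_loc[OF ab(4), of Q a b] ab s by simp
  show ?case
  proof (cases "list_all Q M \<and> list_all Q N")
    case True
    then have "lstep (filter Q c) (p, length (filter Q a)) (filter Q d)"
      unfolding lstep_def using ab by (auto simp: filter_all)
    then have "chain (filter Q c) (restr Q c (s # L) cs) (filter Q d # cs') (filter Q e)"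
      using it[unfolded if_P[OF True]] cs'(1) d(1) by simp
    moreover have "set (filter Q c) \<union> (\<Union>x\<in>set (filter Q d # cs'). set x) =
        {x \<in> set c \<union> (\<Union>x\<in>set cs. set x). Q x}"
      using cs'(2) d(1) by auto
    ultimately show ?thesis by blast
  next
    case False
    then have f: "filter Q c = filter Q d"
      using ab not_keep_filter[OF ab(4) False] by simp
    then have "chain (filter Q c) (restr Q c (s # L) cs) cs' (filter Q e)"
      using it[unfolded if_not_P[OF False]] cs'(1) d(1) by simp
    moreover have "{x \<in> set c. Q x} = {x \<in> set d. Q x}" using arg_cong[OF f, of set] by simp
    then have "set (filter Q c) \<union> (\<Union>x\<in>set cs'. set x) =
        {x \<in> set c \<union> (\<Union>x\<in>set cs. set x). Q x}"
      using cs'(2) d(1) by auto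
    ultimately show ?thesis by blast
  qed
qed auto

lemma restr_ok:
  "chain c L cs e \<Longrightarrow> ok (length (filter Q c)) (restr Q c L cs) \<and>
     wid (length (filter Q c)) (restr Q c L cs) = length (filter Q e)"
  using chain_restr[of c L cs e Q] chain_ok by blast

text \<open>The strands satisfying \<open>Q\<close> move to the left over all others. Pulling a diagram through this braid
  separates a top layer from the rest.\<close>

fun sorting_braid :: "('c \<Rightarrow> bool) \<Rightarrow> 'c list \<Rightarrow> slices" where
  "sorting_braid Q [] = []"
| "sorting_braid Q (x # c) = shift 1 (sorting_braid Q c) @ (if Q x then [] else run 0 (length (filter Q c)))"

lemma sorting_braid_ok: "ok (length c) (sorting_braid Q c) \<and> wid (length c) (sorting_braid Q c) = length c"
proof (induction c)
  case (Cons x c)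
  then show ?case using ok_shift[of "length c" "sorting_braid Q c" 1 0]
    by (auto intro: ok_run simp: wid_run less_Suc_eq_le)
qed auto

text \<open>No selected strand passes under an unselected one: the lower strand enters at
  \<open>i\<close> in a \<open>Pos\<close> and at \<open>Suc i\<close> in a \<open>Neg\<close>
  crossing.\<close>

fun stacked :: "('c \<Rightarrow> bool) \<Rightarrow> 'c list \<Rightarrow> slices \<Rightarrow> 'c list list \<Rightarrow> bool" where
  "stacked Q c ((p, i) # L) (d # cs) \<longleftrightarrow>
     (p = Pos \<and> Q (c ! i) \<longrightarrow> Q (c ! Suc i)) \<and> (p = Neg \<and> Q (c ! Suc i) \<longrightarrow> Q (c ! i)) \<and>
     stacked Q d L cs"
| "stacked Q c L cs \<longleftrightarrow> True"

lemma sorting_braid_all: "list_all Q M \<Longrightarrow> sorting_braid Q (M @ b) = shift (length M) (sorting_braid Q b)"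
  by (induction M) auto

lemma sorting_braid_none: "loc p M N \<Longrightarrow> list_all (\<lambda>x. \<not> Q x) M \<Longrightarrow> list_all (\<lambda>x. \<not> Q x) N \<Longrightarrow>
  sorting_braid Q (M @ b) = shift (ins p) (sorting_braid Q b) @ run2 (ins p) (length (filter Q b)) \<and>
  sorting_braid Q (N @ b) = shift (outs p) (sorting_braid Q b) @ run2 (outs p) (length (filter Q b))"
  by (cases p) (auto simp: run2_def numeral_2_eq_2)

lemma sorting_braid_past:
  assumes "ok (ins p) [(p, 0)]"
  shows "req (ins p + length b) ((p, 0) # shift (outs p) (sorting_braid Q b)) (shift (ins p) (sorting_braid Q b) @ [(p, 0)])"
  using comm[of "ins p" "[(p, 0)]" "length b" "sorting_braid Q b" "ins p + length b", THEN req_sym] sorting_braid_ok[of b Q]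
  by simp

text \<open>Naturality of the sorting braid for one slice: below the braid the piece sits among all
  strands, above it only within its own layer. The induction adds strands to the left of the piece,
  so the geometry is confined to the case without such strands and to the run of one unselected
  strand.\<close>

lemma sorting_braid_step:
  assumes "loc p M N"
    and "p = Pos \<Longrightarrow> Q (M ! 0) \<Longrightarrow> Q (M ! 1)" "p = Neg \<Longrightarrow> Q (M ! 1) \<Longrightarrow> Q (M ! 0)"
  shows "req (length (a @ M @ b)) ((p, length a) # sorting_braid Q (a @ N @ b))
    (sorting_braid Q (a @ M @ b) @ item Q (a @ M @ b) (p, length a) (a @ N @ b) @
     shift (length (filter Q (a @ N @ b))) (item (\<lambda>x. \<not> Q x) (a @ M @ b) (p, length a) (a @ N @ b)))"
proof (induction a)
  case Nil
  note len = loc_length[OF assms(1)]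
  \<comment> \<open>The stacking hypotheses fix the type of a mixed crossing: its selected strand is
    the upper one.\<close>
  have "list_all Q M \<and> list_all Q N \<or> list_all (\<lambda>x. \<not> Q x) M \<and> list_all (\<lambda>x. \<not> Q x) N \<or>
      (\<exists>x y. M = [x, y] \<and> N = [y, x] \<and> Q x \<noteq> Q y \<and> p = (if Q x then Neg else Pos))"
    using assms by (cases p) auto
  then consider (all) "list_all Q M \<and> list_all Q N"
    | (none) "list_all (\<lambda>x. \<not> Q x) M \<and> list_all (\<lambda>x. \<not> Q x) N"
    | (mixed) x y where "M = [x, y]" "N = [y, x]" "Q x \<noteq> Q y" "p = (if Q x then Neg else Pos)"
    by blast
  then show ?case
  proof cases
    case all
    then have no: "\<not> (list_all (\<lambda>x. \<not> Q x) M \<and> list_all (\<lambda>x. \<not> Q x) N)"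
      using assms(1) by (cases p) auto
    show ?thesis
      unfolding item_skip[OF assms(1) no, of "[]" b] item_keep[OF assms(1) all, of "[]" b]
      using all len sorting_braid_past[of p b Q]
      by (simp add: sorting_braid_all)
  next
    case none
    then have no: "\<not> (list_all Q M \<and> list_all Q N)"
      using assms(1) by (cases p) auto
    let ?q = "length (filter Q b)" and ?n = "ins p + length b"
    let ?L = "(p, 0) # shift (outs p) (sorting_braid Q b) @ run2 (outs p) ?q"
    have okL: "ok ?n ?L"
      using ok_shift[of "length b" "sorting_braid Q b" "outs p" 0] sorting_braid_ok[of b Q] ins_outs[of p]
        ok_run2[of ?q "outs p" "outs p + length b"] by (auto simp: add.commute)
    have 1: "req ?n ?L (shift (ins p) (sorting_braid Q b) @ [(p, 0)] @ run2 (outs p) ?q)"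
      using req_mid[of ?n ?L "[]" "(p, 0) # shift (outs p) (sorting_braid Q b)" "run2 (outs p) ?q"
          "shift (ins p) (sorting_braid Q b) @ [(p, 0)]"] okL sorting_braid_past[of p b Q] by simp
    have w: "wid ?n (shift (ins p) (sorting_braid Q b)) = ?n"
      using ok_shift[of "length b" "sorting_braid Q b" "ins p" 0] sorting_braid_ok[of b Q] by simp
    have "req ?n ?L (shift (ins p) (sorting_braid Q b) @ run2 (ins p) ?q @ [(p, ?q)])"
      using req_mid[of ?n ?L "shift (ins p) (sorting_braid Q b)" "(p, 0) # run2 (outs p) ?q" "[]"
          "run2 (ins p) ?q @ [(p, ?q)]"] okL 1 under_run2[of ?q p ?n] w by simp
    moreover have "filter Q N = []" using none by (auto simp: list_all_iff filter_empty_conv)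
    ultimately show ?thesis
      unfolding item_skip[OF assms(1) no, of "[]" b] item_keep[OF assms(1) none, of "[]" b]
      using none sorting_braid_none[OF assms(1), of Q b] len by simp
  next
    case mixed
    let ?q = "length (filter Q b)" and ?n = "2 + length b"
    let ?B = "shift 2 (sorting_braid Q b)"
    have B: "ok ?n ?B" "wid ?n ?B = ?n"
      using ok_shift[of "length b" "sorting_braid Q b" 2 0] sorting_braid_ok[of b Q] by auto
    have past: "req ?n ((p, 0) # ?B) (?B @ [(p, 0)])"
      using sorting_braid_past[of p b Q] mixed by (auto split: if_splits)
    have none: "item Q ([] @ M @ b) (p, length []) ([] @ N @ b) = []"
      "item (\<lambda>x. \<not> Q x) ([] @ M @ b) (p, length []) ([] @ N @ b) = []"
      using mixed item_skip[OF assms(1), of Q "[]" b] item_skip[OF assms(1), of "\<lambda>x. \<not> Q x" "[]" b]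
      by auto
    show ?thesis
    proof (cases "Q x")
      case True
      \<comment> \<open>The run of \<open>y\<close> starts with a crossing under \<open>x\<close>,
        which cancels the piece once the piece has moved past \<open>?B\<close>.\<close>
      let ?L = "(Neg, 0) # ?B @ (Pos, 0) # run 1 ?q"
      have okL: "ok ?n ?L" using B by (auto intro!: ok_run simp: less_Suc_eq_le)
      have 1: "req ?n ?L (?B @ [(Neg, 0), (Pos, 0)] @ run 1 ?q)"
        using req_mid[of ?n ?L "[]" "(Neg, 0) # ?B" "(Pos, 0) # run 1 ?q" "?B @ [(Neg, 0)]"]
          okL past True mixed by simp
      have "req ?n ?L (?B @ run 1 ?q)"
        using req_mid[of ?n ?L "?B" "[(Neg, 0), (Pos, 0)]" "run 1 ?q" "[]"] okL 1 B
        by (simp add: req_local)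
      then show ?thesis
        unfolding none using mixed True by (simp add: run_Cons numeral_2_eq_2)
    next
      case False
      \<comment> \<open>Here the piece itself becomes the first crossing of the longer run of
        \<open>x\<close>.\<close>
      let ?L = "(Pos, 0) # ?B @ run 1 ?q"
      have okL: "ok ?n ?L" using B by (auto intro!: ok_run simp: less_Suc_eq_le)
      have "req ?n ?L (?B @ (Pos, 0) # run 1 ?q)"
        using req_mid[of ?n ?L "[]" "(Pos, 0) # ?B" "run 1 ?q" "?B @ [(Pos, 0)]"]
          okL past False mixed by simp
      then show ?thesis
        unfolding none using mixed False by (simp add: run_Cons numeral_2_eq_2)
    qed
  qed
next
  case (Cons x a)
  note len = loc_length[OF assms(1)]
  let ?n = "length (a @ M @ b)"
  let ?B = "shift 1 (sorting_braid Q (a @ M @ b))"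
  let ?q = "length (filter Q (a @ N @ b))"
  let ?P = "\<lambda>x. \<not> Q x"
  define I where "I = item Q (a @ M @ b) (p, length a) (a @ N @ b)"
  define J where "J = item ?P (a @ M @ b) (p, length a) (a @ N @ b)"
  have I: "item Q ((x # a) @ M @ b) (p, length (x # a)) ((x # a) @ N @ b) = (if Q x then shift 1 I else I)"
    unfolding I_def item_loc[OF assms(1)] by auto
  have J: "item ?P ((x # a) @ M @ b) (p, length (x # a)) ((x # a) @ N @ b) = (if Q x then J else shift 1 J)"
    unfolding J_def item_loc[OF assms(1)] by auto
  have I_keep: "list_all Q M \<and> list_all Q N \<Longrightarrow> I = [(p, length (filter Q a))]"
    and I_skip: "\<not> (list_all Q M \<and> list_all Q N) \<Longrightarrow> I = []"
    and J_keep: "list_all ?P M \<and> list_all ?P N \<Longrightarrow> J = [(p, length (filter ?P a))]"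
    and J_skip: "\<not> (list_all ?P M \<and> list_all ?P N) \<Longrightarrow> J = []"
    unfolding I_def J_def by (rule item_keep[OF assms(1)] item_skip[OF assms(1)], assumption)+
  have IH: "req (Suc ?n) ((p, Suc (length a)) # shift 1 (sorting_braid Q (a @ N @ b)))
      (?B @ shift 1 I @ shift (Suc ?q) J)"
    using req_shift[OF Cons.IH[folded I_def J_def], of 1 0] by simp
  show ?case
  proof (cases "Q x")
    case True
    then show ?thesis using IH unfolding I J by simp
  next
    case False
    let ?L = "(p, Suc (length a)) # shift 1 (sorting_braid Q (a @ N @ b)) @ run 0 ?q"
    have N: "length (a @ N @ b) = ?n - ins p + outs p" using len by simp
    have okL: "ok (Suc ?n) ?L"
    proof -
      have w: "Suc ?n - ins p + outs p = 1 + length (a @ N @ b)" using len by simp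
      have "?q < 1 + length (a @ N @ b)"
        using length_filter_le[of Q "a @ N @ b"] by linarith
      then have A: "ok (0 + (1 + length (a @ N @ b))) (run 0 ?q)" by (simp only: ok_run add_0)
      have B: "ok (1 + length (a @ N @ b)) (shift 1 (sorting_braid Q (a @ N @ b)))"
        "wid (1 + length (a @ N @ b)) (shift 1 (sorting_braid Q (a @ N @ b))) = 1 + length (a @ N @ b)"
        using sorting_braid_ok[of "a @ N @ b" Q] ok_shift[of "length (a @ N @ b)" "sorting_braid Q (a @ N @ b)" 1 0]
        by (simp_all only: add_0_right)
      show ?thesis
        unfolding ok.simps w ok_append B(2) using A B(1) len by simp
    qed
    have w: "wid (Suc ?n) ?B = Suc ?n"
      using ok_shift[of ?n "sorting_braid Q (a @ M @ b)" 1 0] sorting_braid_ok[of "a @ M @ b" Q] by simp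
    have 1: "req (Suc ?n) ?L (?B @ (shift 1 I @ shift (Suc ?q) J @ run 0 ?q))"
      by (rule req_via[OF req_refl okL, of "[]" "(p, Suc (length a)) # shift 1 (sorting_braid Q (a @ N @ b))" "run 0 ?q"
          "?B @ shift 1 I @ shift (Suc ?q) J"]) (use IH in simp_all)
    let ?q' = "length (filter Q (a @ M @ b))"
    \<comment> \<open>A piece of the top layer lies over the run of \<open>x\<close> and passes it
      by \<open>under_run\<close>; a piece of the bottom layer lies to the right of the run and
      commutes with it.\<close>
    have 2: "req (Suc ?n) (shift 1 I @ shift (Suc ?q) J @ run 0 ?q)
      (run 0 ?q' @ I @ shift (Suc ?q) J)" if "\<not> (list_all (\<lambda>x. \<not> Q x) M \<and> list_all (\<lambda>x. \<not> Q x) N)"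
    proof (cases "list_all Q M \<and> list_all Q N")
      case True
      then have q: "?q = ?q' - ins p + outs p" using len by (simp add: filter_all)
      have "?q' < Suc ?n" using length_filter_le[of Q "a @ M @ b"] by linarith
      moreover have "length (filter Q a) + ins p \<le> ?q'" using True len by (simp add: filter_all)
      ultimately have "req (Suc ?n) ((p, Suc (length (filter Q a))) # run 0 ?q)
          (run 0 ?q' @ [(p, length (filter Q a))])"
        unfolding q by (intro under_run)
      then show ?thesis
        unfolding J_skip[OF that] I_keep[OF True] by simp
    next
      case False
      show ?thesis unfolding J_skip[OF that] I_skip[OF False]
        using not_keep_filter[OF assms(1) False] by simp
    qed
    have 3: "req (Suc ?n) (shift 1 I @ shift (Suc ?q) J @ run 0 ?q)
      (run 0 ?q' @ I @ shift (Suc ?q) J)" if *: "list_all (\<lambda>x. \<not> Q x) M \<and> list_all (\<lambda>x. \<not> Q x) N"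
    proof -
      have no: "\<not> (list_all Q M \<and> list_all Q N)" using * assms(1) by (cases p) auto
      have q: "?q' = ?q" using not_keep_filter[OF assms(1) no] by simp
      have "filter Q M = []" using * by (auto simp: list_all_iff filter_empty_conv)
      then have "length (filter Q M) = 0" by simp
      then have "Suc ?q' + length (filter (\<lambda>x. \<not> Q x) a) + ins p \<le> Suc ?n"
        using len sum_length_filter_compl[of Q a] length_filter_le[of Q b]
        unfolding filter_append length_append by linarith
      then show ?thesis unfolding I_skip[OF no] J_keep[OF *] using q
          comm1_slices[of "Suc ?q'" "run 0 ?q'" "Suc (?q' + length (filter (\<lambda>x. \<not> Q x) a))" p "Suc ?n"]
        by (simp add: ok_run wid_run add.commute add.left_commute)
    qed
    have 4: "req (Suc ?n) (shift 1 I @ shift (Suc ?q) J @ run 0 ?q)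
      (run 0 ?q' @ I @ shift (Suc ?q) J)"
      using 2 3 by blast
    have "req (Suc ?n) ?L (?B @ (run 0 ?q' @ I @ shift (Suc ?q) J))"
      by (rule req_via[OF 1 okL, of ?B "shift 1 I @ shift (Suc ?q) J @ run 0 ?q" "[]"
          "run 0 ?q' @ I @ shift (Suc ?q) J"]) (use 4 w in simp_all)
    then show ?thesis using False unfolding I J by simp
  qed
qed

text \<open>The slices are pulled through the braid from the highest one down. For a closed diagram
  the braids at both ends are empty, and what remains is the disjoint union of the two layers in
  separate strips.\<close>

lemma separate:
  assumes "chain c L cs e" "stacked Q c L cs"
  shows "req (length c) (L @ sorting_braid Q e)
    (sorting_braid Q c @ restr Q c L cs @ shift (length (filter Q e)) (restr (\<lambda>x. \<not> Q x) c L cs))"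
  using assms
proof (induction L arbitrary: c cs)
  case (Cons s L)
  from Cons.prems(1) obtain p i d ds a b M N where s: "s = (p, i)"
    and d: "cs = d # ds" "lstep c s d" "chain d L ds e"
    and ab: "c = a @ M @ b" "d = a @ N @ b" "length a = i" "loc p M N" by (rule chain_ConsE)
  note len = loc_length[OF ab(4)]
  let ?P = "\<lambda>x. \<not> Q x"
  let ?T = "restr Q d L ds" and ?F = "restr ?P d L ds"
  let ?q = "\<lambda>c. length (filter Q c)" and ?n = "length c"
  let ?L = "s # L @ sorting_braid Q e"
  have okL: "ok ?n ?L" using chain_ok[OF Cons.prems(1)] sorting_braid_ok[of e Q] by (metis append_Cons ok_append)
  have wd: "wid ?n [s] = length d" using ab len by (simp add: s)
  have st: "stacked Q d L ds" "p = Pos \<Longrightarrow> Q (M ! 0) \<Longrightarrow> Q (M ! 1)" "p = Neg \<Longrightarrow> Q (M ! 1) \<Longrightarrow> Q (M ! 0)"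
    using Cons.prems(2) ab len by (auto simp: s d nth_append)
  have 1: "req ?n ?L (s # sorting_braid Q d @ ?T @ shift (?q e) ?F)"
    by (rule req_via[OF req_refl okL, of "[s]" "L @ sorting_braid Q e" "[]" "sorting_braid Q d @ ?T @ shift (?q e) ?F"])
      (use Cons.IH[OF d(3) st(1)] wd in simp_all)
  have "req ?n (s # sorting_braid Q d) (sorting_braid Q c @ item Q c s d @ shift (?q d) (item ?P c s d))"
    using sorting_braid_step[OF ab(4) st(2,3), of a b] ab s by simp
  note bs = this
  have 2: "req ?n ?L ((sorting_braid Q c @ item Q c s d) @ (shift (?q d) (item ?P c s d) @ ?T) @ shift (?q e) ?F)"
    by (rule req_via[OF 1 okL, of "[]" "s # sorting_braid Q d" "?T @ shift (?q e) ?F"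
        "sorting_braid Q c @ item Q c s d @ shift (?q d) (item ?P c s d)"]) (use bs in simp_all)
  \<comment> \<open>An unselected slice has to be lifted above all selected slices collected so far;
    lying to their right, it commutes with them.\<close>
  have 3: "req (wid ?n (sorting_braid Q c @ item Q c s d)) (shift (?q d) (item ?P c s d) @ ?T)
      (?T @ shift (?q e) (item ?P c s d))"
  proof (cases "list_all ?P M \<and> list_all ?P N")
    case True
    then have no: "\<not> (list_all Q M \<and> list_all Q N)" using ab(4) by (cases p) auto
    have e: "item Q c s d = []" "item ?P c s d = [(p, length (filter ?P a))]"
      using item_skip[OF ab(4) no, of a b] item_keep[OF ab(4) True, of a b] ab s by auto
    have q: "?q d = ?q a + ?q b" using True ab by (auto simp: list_all_iff filter_empty_conv)
    have T: "ok (?q d) ?T" "wid (?q d) ?T = ?q e" using restr_ok[OF d(3), of Q] by auto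
    show ?thesis
      unfolding e T(2)[symmetric]
      by (rule comm[OF T(1), of "length (filter ?P a) + ins p"])
         (use q sorting_braid_ok[of c Q] sum_length_filter_compl[of Q a] length_filter_le[of Q b] ab len in auto)
  next
    case False
    then have "item ?P c s d = []" using item_skip[OF ab(4) False, of a b] ab s by auto
    then show ?thesis by simp
  qed
  have "req ?n ?L ((sorting_braid Q c @ item Q c s d) @ (?T @ shift (?q e) (item ?P c s d)) @ shift (?q e) ?F)"
    using req_mid[OF 2 okL 3] .
  then show ?case by (simp add: d)
qed simp


section \<open>Labellings and components\<close>

lemma lstep_nth:
  assumes "lstep c (p, i) d"
  shows "i + ins p \<le> length c" "length d = length c - ins p + outs p"
    "k < i \<Longrightarrow> d ! k = c ! k"
    "i + ins p + k < length c \<Longrightarrow> d ! (i + outs p + k) = c ! (i + ins p + k)"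
    "p = Cup \<Longrightarrow> d ! i = d ! Suc i" "p = Cap \<Longrightarrow> c ! i = c ! Suc i"
    "p \<in> {Pos, Neg} \<Longrightarrow> d ! Suc i = c ! i \<and> d ! i = c ! Suc i"
proof -
  from assms obtain a b M N where ab: "c = a @ M @ b" "d = a @ N @ b" "length a = i" "loc p M N"
    "length M = ins p" "length N = outs p" by (rule lstepE)
  show "i + ins p \<le> length c" "length d = length c - ins p + outs p" using ab by auto
  show "k < i \<Longrightarrow> d ! k = c ! k" using ab by (simp add: nth_append)
  show "i + ins p + k < length c \<Longrightarrow> d ! (i + outs p + k) = c ! (i + ins p + k)"
    using ab by (simp add: nth_append)
  show "p = Cup \<Longrightarrow> d ! i = d ! Suc i" using ab by (auto simp: nth_append)
  show "p = Cap \<Longrightarrow> c ! i = c ! Suc i" using ab by (auto simp: nth_append)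
  show "p \<in> {Pos, Neg} \<Longrightarrow> d ! Suc i = c ! i \<and> d ! i = c ! Suc i"
    using ab by (auto simp: nth_append)
qed

lemma lstepI:
  assumes "i + ins p \<le> length c" "length d = length c - ins p + outs p"
    "\<And>k. k < i \<Longrightarrow> d ! k = c ! k"
    "\<And>k. i + ins p + k < length c \<Longrightarrow> d ! (i + outs p + k) = c ! (i + ins p + k)"
    "p = Cup \<Longrightarrow> d ! i = d ! Suc i" "p = Cap \<Longrightarrow> c ! i = c ! Suc i"
    "p \<in> {Pos, Neg} \<Longrightarrow> d ! Suc i = c ! i \<and> d ! i = c ! Suc i"
  shows "lstep c (p, i) d"
proof -
  define M N where "M = take (ins p) (drop i c)" and "N = take (outs p) (drop i d)"
  have "c = take i c @ M @ drop (i + ins p) c"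
    using append_take_drop_id[of i c] append_take_drop_id[of "ins p" "drop i c"]
    by (simp add: M_def add.commute)
  moreover have "d = take i d @ N @ drop (i + outs p) d"
    using append_take_drop_id[of i d] append_take_drop_id[of "outs p" "drop i d"]
    by (simp add: N_def add.commute)
  moreover have "take i d = take i c"
    using assms(1-3) by (intro nth_equalityI) auto
  moreover have "drop (i + outs p) d = drop (i + ins p) c"
    using assms(1,2,4) by (intro nth_equalityI) auto
  moreover have "loc p M N"
  proof -
    have 2: "take 2 (drop i x) = [x ! i, x ! Suc i]" if "Suc (Suc i) \<le> length x" for x :: "'a list"
      using that by (simp add: numeral_2_eq_2 take_Suc_conv_app_nth)
    show ?thesis
      using assms 2[of c] 2[of d] by (cases p) (auto simp: M_def N_def)
  qed
  ultimately show ?thesis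
    using assms(1) unfolding lstep_def by (metis fst_conv snd_conv length_take min.absorb2 le_add1 order_trans)
qed

lemma chain_nth:
  "chain c L cs e \<Longrightarrow> t < length L \<Longrightarrow> lstep ((c # cs) ! t) (L ! t) (cs ! t)"
proof (induction L arbitrary: c cs t)
  case (Cons s L)
  then show ?case by (cases t) auto
qed simp

lemma chain_take:
  "chain c L cs e \<Longrightarrow> t \<le> length L \<Longrightarrow> chain c (take t L) (take t cs) ((c # cs) ! t)"
proof (induction L arbitrary: c cs t)
  case (Cons s L)
  then show ?case by (cases t) auto
qed simp

lemma chain_end: "chain c L cs e \<Longrightarrow> e = (c # cs) ! length L"
  by (induction L arbitrary: c cs) auto

lemma chainI:
  "length cs = length L \<Longrightarrow> (\<And>t. t < length L \<Longrightarrow> lstep ((c # cs) ! t) (L ! t) (cs ! t)) \<Longrightarrow>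
     chain c L cs ((c # cs) ! length L)"
proof (induction L arbitrary: c cs)
  case (Cons s L)
  then obtain d ds where cs: "cs = d # ds" by (cases cs) auto
  have "lstep c s d" using Cons.prems(2)[of 0] cs by simp
  moreover have "chain d L ds ((d # ds) ! length L)"
    by (rule Cons.IH) (use Cons.prems(1) Cons.prems(2)[of "Suc _"] cs in auto)
  ultimately show ?case using cs by simp
qed simp

lemma width_wid: "width L t = wid 0 (take t L)"
proof -
  have "foldl (\<lambda>n (p, i). n - ins p + outs p) n L = wid n L" for n and L :: slices
    by (induction n L rule: wid.induct) auto
  then show ?thesis by (simp add: width_def)
qed

lemma chain_width:
  assumes "chain [] L cs []" "t \<le> length L"
  shows "width L t = length (([] # cs) ! t)"
  using chain_ok[OF chain_take[OF assms]] by (simp add: width_wid)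

text \<open>\<open>chain\<close> leaves out the lowest line, which is empty in a closed diagram;
  \<open>[] # cs\<close> restores it, so that the index agrees with the height of the point.\<close>

definition label_at :: "'c list list \<Rightarrow> nat \<times> nat \<Rightarrow> 'c" where
  "label_at cs x = ([] # cs) ! fst x ! snd x"

definition labels :: "'c list list \<Rightarrow> 'c set" where
  "labels cs = (\<Union>x\<in>set cs. set x)"

lemma labels_label_at:
  assumes "chain [] L cs []"
  shows "labels cs = label_at cs ` points L"
proof (intro equalityI subsetI)
  fix x assume "x \<in> labels cs"
  then obtain t k where tk: "t < length cs" "k < length (cs ! t)" "x = cs ! t ! k"
    unfolding labels_def by (auto simp: in_set_conv_nth)
  then have "(Suc t, k) \<in> points L" "x = label_at cs (Suc t, k)"
    using chain_width[OF assms, of "Suc t"] chain_length[OF assms] by (auto simp: points_def label_at_def)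
  then show "x \<in> label_at cs ` points L" by blast
next
  fix x assume "x \<in> label_at cs ` points L"
  then obtain t k where tk: "t \<le> length L" "k < width L t" "x = ([] # cs) ! t ! k"
    by (auto simp: points_def label_at_def)
  then have k: "k < length (([] # cs) ! t)" using chain_width[OF assms] by simp
  then obtain t' where "t = Suc t'" by (cases t) auto
  then show "x \<in> labels cs"
    using tk k chain_length[OF assms] unfolding labels_def by (auto intro!: bexI[of _ "cs ! t'"])
qed

lemma finite_labels: "finite (labels cs)"
  by (simp add: labels_def)

lemma adjacent_label_at:
  assumes "chain [] L cs []" "adjacent L x y"
  shows "x \<in> points L \<and> y \<in> points L \<and> label_at cs x = label_at cs y"
proof -
  have pts: "(t, k) \<in> points L \<longleftrightarrow> t \<le> length L \<and> k < length (([] # cs) ! t)" for t k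
    using chain_width[OF assms(1)] by (auto simp: points_def)
  have st: "lstep (([] # cs) ! t) (p, i) (([] # cs) ! Suc t)" if "t < length L" "L ! t = (p, i)" for t p i
    using chain_nth[OF assms(1) that(1)] that by simp
  note n = lstep_nth[OF st]
  from assms(2) show ?thesis
  proof cases
    case (pass_left t p i k)
    then show ?thesis using n[OF pass_left(3,4)] by (auto simp: pts label_at_def)
  next
    case (pass_right t p i d)
    then have "i + ins p + d < length (([] # cs) ! t)" using chain_width[OF assms(1), of t] by simp
    then show ?thesis using pass_right n[OF pass_right(3,4)] by (auto simp: pts label_at_def)
  next
    case (cup t i)
    then show ?thesis using n[OF cup(3,4)] by (auto simp: pts label_at_def)
  next
    case (cap t i)
    then show ?thesis using n[OF cap(3,4)] by (auto simp: pts label_at_def)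
  next
    case (cross_rising t p i)
    then show ?thesis using n[OF cross_rising(3,4)] by (auto simp: pts label_at_def)
  next
    case (cross_falling t p i)
    then show ?thesis using n[OF cross_falling(3,4)] by (auto simp: pts label_at_def)
  qed
qed

lemma same_component_label_at:
  assumes "chain [] L cs []" "(x, y) \<in> same_component L"
  shows "label_at cs x = label_at cs y"
proof -
  from assms(2) have "equivclp (adjacent L) x y" by (simp add: same_component_def)
  then show ?thesis
    by (induction rule: equivclp_induct) (use adjacent_label_at[OF assms(1)] in force)+
qed

lemma equiv_same_component: "equiv (points L) (same_component L)"
proof (rule equivI)
  show "refl_on (points L) (same_component L)"
    by (auto simp: refl_on_def same_component_def)
  show "sym (same_component L)" by (auto simp: sym_def same_component_def intro: equivclp_sym)
  show "trans (same_component L)" by (auto simp: trans_def same_component_def intro: equivclp_trans)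
qed (auto simp: same_component_def)

definition chain_of :: "slices \<Rightarrow> (nat \<times> nat \<Rightarrow> 'c) \<Rightarrow> 'c list list" where
  "chain_of L f = map (\<lambda>t. map (\<lambda>k. f (Suc t, k)) [0..<width L (Suc t)]) [0..<length L]"

lemma chain_of_state:
  "t \<le> length L \<Longrightarrow> ([] # chain_of L f) ! t = map (\<lambda>k. f (t, k)) [0..<width L t]"
  by (cases t) (auto simp: chain_of_def width_def)

lemma label_at_chain_of: "x \<in> points L \<Longrightarrow> label_at (chain_of L f) x = f x"
  unfolding label_at_def by (auto simp: points_def chain_of_state)

text \<open>The converse of \<open>adjacent_label_at\<close>: together they identify labellings with
  functions that are constant on components.\<close>

lemma chain_chain_of:
  assumes "ok 0 L" "wid 0 L = 0" and f: "\<And>x y. adjacent L x y \<Longrightarrow> f x = f y"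
  shows "chain [] L (chain_of L f) []"
proof -
  let ?s = "\<lambda>t. map (\<lambda>k. f (t, k)) [0..<width L t]"
  have "lstep (?s t) (L ! t) (?s (Suc t))" if t: "t < length L" for t
  proof -
    obtain p i where pi: "L ! t = (p, i)" by force
    have L: "take (Suc t) L = take t L @ [(p, i)]" using t pi by (simp add: take_Suc_conv_app_nth)
    have "ok 0 (take (Suc t) L @ drop (Suc t) L)" using assms(1) by simp
    then have "ok 0 (take (Suc t) L)" by (simp only: ok_append)
    then have w: "i + ins p \<le> width L t" "width L (Suc t) = width L t - ins p + outs p"
      unfolding L width_wid by auto
    note a = f[OF adjacent.pass_left[OF t pi]] f[OF adjacent.pass_right[OF t pi]]
      f[OF adjacent.cup[OF t]] f[OF adjacent.cap[OF t]]
      f[OF adjacent.cross_rising[OF t pi]] f[OF adjacent.cross_falling[OF t pi]]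
    show ?thesis unfolding pi
    proof (rule lstepI)
      show "p = Cup \<Longrightarrow> ?s (Suc t) ! i = ?s (Suc t) ! Suc i" using w a pi by (auto simp del: upt_Suc)
      show "p = Cap \<Longrightarrow> ?s t ! i = ?s t ! Suc i" using w a pi by (auto simp del: upt_Suc)
      show "p \<in> {Pos, Neg} \<Longrightarrow> ?s (Suc t) ! Suc i = ?s t ! i \<and> ?s (Suc t) ! i = ?s t ! Suc i"
        using w a pi by (auto simp del: upt_Suc)
    qed (use w a in \<open>auto simp del: upt_Suc\<close>)
  qed
  then have "lstep (([] # chain_of L f) ! t) (L ! t) (chain_of L f ! t)" if "t < length L" for t
    using that chain_of_state[of t L f] chain_of_state[of "Suc t" L f] by simp
  then have "chain [] L (chain_of L f) (([] # chain_of L f) ! length L)"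
    by (intro chainI) (simp_all add: chain_of_def)
  moreover have "([] # chain_of L f) ! length L = []"
    using assms(2) by (simp add: chain_of_state width_wid)
  ultimately show ?thesis by simp
qed

lemma chain_eqI:
  assumes "chain [] L cs []" "chain [] L ds []" "\<And>x. x \<in> points L \<Longrightarrow> label_at cs x = label_at ds x"
  shows "cs = ds"
proof (rule nth_equalityI)
  show len: "length cs = length ds" using assms(1,2) chain_length by metis
  fix t assume t: "t < length cs"
  then have t': "Suc t \<le> length L" using chain_length[OF assms(1)] by simp
  show "cs ! t = ds ! t"
  proof (rule nth_equalityI)
    show "length (cs ! t) = length (ds ! t)"
      using chain_width[OF assms(1) t'] chain_width[OF assms(2) t'] by simp
    fix k assume "k < length (cs ! t)"
    then have "(Suc t, k) \<in> points L" using chain_width[OF assms(1) t'] t' by (simp add: points_def)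
    from assms(3)[OF this] show "cs ! t ! k = ds ! t ! k" by (simp add: label_at_def)
  qed
qed

lemma lstep_map: "lstep c s d \<Longrightarrow> lstep (map g c) s (map g d)"
proof -
  assume "lstep c s d"
  then obtain a b M N where *: "c = a @ M @ b" "d = a @ N @ b" "length a = snd s" "loc (fst s) M N"
    unfolding lstep_def by blast
  moreover have "loc (fst s) (map g M) (map g N)" using *(4) by (cases "fst s") auto
  ultimately show ?thesis unfolding lstep_def
    by (intro exI[of _ "map g a"] exI[of _ "map g b"] exI[of _ "map g M"] exI[of _ "map g N"]) simp
qed

lemma chain_map: "chain c L cs e \<Longrightarrow> chain (map g c) L (map (map g) cs) (map g e)"
  by (induction L arbitrary: c cs) (auto intro: lstep_map)

lemma label_at_map:
  assumes "chain [] L cs []" "x \<in> points L"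
  shows "label_at (map (map g) cs) x = g (label_at cs x)"
proof -
  obtain t k where x: "x = (t, k)" by force
  then have "t \<le> length L" "k < length (([] # cs) ! t)"
    using assms chain_width[OF assms(1), of t] by (auto simp: points_def)
  then show ?thesis using chain_length[OF assms(1)] x by (cases t) (auto simp: label_at_def)
qed

lemma labels_map: "labels (map (map g) cs) = g ` labels cs"
  by (auto simp: labels_def)

text \<open>A labelling separates the components iff every two-valued labelling factors through it.
  This universal property, unlike the definition of components, is local in the slices.\<close>

definition faithful :: "slices \<Rightarrow> 'c list list \<Rightarrow> bool" where
  "faithful L cs \<longleftrightarrow> chain [] L cs [] \<and>
     (\<forall>ms::bool list list. chain [] L ms [] \<longrightarrow> (\<exists>g. ms = map (map g) cs))"

lemma faithful_label_at:
  assumes "faithful L cs" "x \<in> points L" "y \<in> points L"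
  shows "label_at cs x = label_at cs y \<longleftrightarrow> (x, y) \<in> same_component L"
proof
  have ch: "chain [] L cs []" using assms by (simp add: faithful_def)
  have ok: "ok 0 L" "wid 0 L = 0" using chain_ok[OF ch] by auto
  assume e: "label_at cs x = label_at cs y"
  \<comment> \<open>The indicator of the component of \<open>x\<close> is a two-valued labelling. As
    it factors through \<open>cs\<close>, a point with the label of \<open>x\<close> lies in that
    component.\<close>
  let ?f = "\<lambda>z. (x, z) \<in> same_component L"
  have "?f z = ?f z'" if "adjacent L z z'" for z z'
    using that adjacent_label_at[OF ch that] unfolding same_component_def
    by (auto intro: equivclp_into_equivclp)
  then have ch': "chain [] L (chain_of L ?f) []" by (rule chain_chain_of[OF ok])
  then obtain g where g: "chain_of L ?f = map (map g) cs" using assms(1) unfolding faithful_def by blast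
  have "?f x = g (label_at cs x)" "?f y = g (label_at cs y)"
    using label_at_map[OF ch, of _ g] label_at_chain_of[of _ L ?f] assms(2,3) g by metis+
  moreover have "?f x" using assms(2) by (simp add: same_component_def)
  ultimately show "(x, y) \<in> same_component L" using e by simp
next
  assume "(x, y) \<in> same_component L"
  then show "label_at cs x = label_at cs y" using assms(1) same_component_label_at unfolding faithful_def by metis
qed

lemma factor_chain:
  assumes "chain [] L cs []" "chain [] L ds []"
    and "\<And>x y. x \<in> points L \<Longrightarrow> y \<in> points L \<Longrightarrow> label_at cs x = label_at cs y \<Longrightarrow> label_at ds x = label_at ds y"
  shows "\<exists>g. ds = map (map g) cs"
proof -
  \<comment> \<open>\<open>g\<close> is read off at an arbitrary point with label \<open>l\<close>;
    by hypothesis the choice does not matter.\<close>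
  define g where "g l = label_at ds (SOME x. x \<in> points L \<and> label_at cs x = l)" for l
  have "label_at ds x = label_at (map (map g) cs) x" if "x \<in> points L" for x
  proof -
    have "(SOME y. y \<in> points L \<and> label_at cs y = label_at cs x) \<in> points L \<and>
        label_at cs (SOME y. y \<in> points L \<and> label_at cs y = label_at cs x) = label_at cs x"
      by (rule someI[of _ x]) (use that in simp)
    then have "label_at ds x = g (label_at cs x)" unfolding g_def by (intro assms(3)) (use that in auto)
    then show ?thesis using label_at_map[OF assms(1) that, of g] by simp
  qed
  moreover have "chain [] L (map (map g) cs) []" using chain_map[OF assms(1), of g] by simp
  ultimately have "ds = map (map g) cs" by (intro chain_eqI[OF assms(2)])
  then show ?thesis by blast
qed

text \<open>The witness labels each strand with its own component as a set of points.\<close>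

lemma faithful_exists:
  assumes "ok 0 L" "wid 0 L = 0"
  shows "\<exists>cs :: (nat \<times> nat) set list list. faithful L cs"
proof -
  let ?f = "\<lambda>x. same_component L `` {x}"
  note eq = equiv_same_component[of L]
  have inside: "x \<in> points L \<and> y \<in> points L" if "adjacent L x y" for x y
  proof -
    have "chain [] L (chain_of L (\<lambda>_. ())) []" by (rule chain_chain_of[OF assms]) simp
    then show ?thesis using adjacent_label_at that by blast
  qed
  have "?f x = ?f y" if "adjacent L x y" for x y
    using inside[OF that] that
    by (intro equiv_class_eq[OF eq]) (auto simp: same_component_def)
  then have ch: "chain [] L (chain_of L ?f) []" by (rule chain_chain_of[OF assms])
  moreover have "\<exists>g. ms = map (map g) (chain_of L ?f)" if ms: "chain [] L ms []" for ms :: "bool list list"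
  proof (rule factor_chain[OF ch ms])
    fix x y assume xy: "x \<in> points L" "y \<in> points L" "label_at (chain_of L ?f) x = label_at (chain_of L ?f) y"
    then have "(x, y) \<in> same_component L"
      using eq_equiv_class[OF _ eq] by (simp add: label_at_chain_of)
    then show "label_at ms x = label_at ms y" by (rule same_component_label_at[OF ms])
  qed
  ultimately show ?thesis unfolding faithful_def by blast
qed

text \<open>Extends the factorisation from two-valued labellings to an arbitrary label type. A
  definition cannot quantify over types, but two values already tell components apart.\<close>

lemma faithful_factor:
  assumes "faithful L cs" "chain [] L ds []"
  shows "\<exists>g. ds = map (map g) cs"
proof (rule factor_chain[OF _ assms(2)])
  show "chain [] L cs []" using assms(1) by (simp add: faithful_def)
  fix x y assume "x \<in> points L" "y \<in> points L" "label_at cs x = label_at cs y"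
  then have "(x, y) \<in> same_component L" using faithful_label_at[OF assms(1)] by blast
  then show "label_at ds x = label_at ds y" by (rule same_component_label_at[OF assms(2)])
qed

text \<open>Renaming makes the labels of two diagrams disjoint before the diagrams are put
  together.\<close>

lemma faithful_map:
  assumes "faithful L cs" "inj_on h (labels cs)"
  shows "faithful L (map (map h) cs)"
proof -
  have ch: "chain [] L cs []" using assms by (simp add: faithful_def)
  have ch': "chain [] L (map (map h) cs) []" using chain_map[OF ch, of h] by simp
  have "\<exists>g. ms = map (map g) (map (map h) cs)" if ms: "chain [] L ms []" for ms :: "bool list list"
  proof -
    obtain g where "ms = map (map g) cs" using assms(1) ms unfolding faithful_def by blast
    moreover have "inv_into (labels cs) h (h l) = l" if "x \<in> set cs" "l \<in> set x" for x l
      by (rule inv_into_f_f[OF assms(2)]) (use that in \<open>auto simp: labels_def\<close>)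
    ultimately have "ms = map (map (g \<circ> inv_into (labels cs) h)) (map (map h) cs)"
      by simp
    then show ?thesis by blast
  qed
  with ch' show ?thesis unfolding faithful_def by blast
qed

section \<open>Components and sublinks expressed by labels\<close>

definition comp_label :: "'c list list \<Rightarrow> (nat \<times> nat) set \<Rightarrow> 'c" where
  "comp_label cs C = label_at cs (SOME x. x \<in> C)"

lemma comp_label:
  assumes "chain [] L cs []" "x \<in> points L"
  shows "comp_label cs (same_component L `` {x}) = label_at cs x"
proof -
  have "x \<in> same_component L `` {x}" using assms(2) by (simp add: same_component_def)
  then have "(SOME y. y \<in> same_component L `` {x}) \<in> same_component L `` {x}" by (rule someI)
  then have "(x, SOME y. y \<in> same_component L `` {x}) \<in> same_component L" by simp
  from same_component_label_at[OF assms(1) this] show ?thesis by (simp add: comp_label_def)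
qed

lemma comp_label_bij:
  assumes "faithful L cs"
  shows "bij_betw (comp_label cs) (components L) (labels cs)"
proof -
  have ch: "chain [] L cs []" using assms by (simp add: faithful_def)
  show ?thesis unfolding bij_betw_def
  proof
    show "inj_on (comp_label cs) (components L)"
    proof (rule inj_onI)
      fix C D assume "C \<in> components L" "D \<in> components L" and e: "comp_label cs C = comp_label cs D"
      then obtain x y where xy: "x \<in> points L" "y \<in> points L"
        "C = same_component L `` {x}" "D = same_component L `` {y}"
        unfolding components_def by (auto elim!: quotientE)
      then have "(x, y) \<in> same_component L"
        using e comp_label[OF ch] faithful_label_at[OF assms] by auto
      then show "C = D" unfolding xy by (rule equiv_class_eq[OF equiv_same_component])
    qed
    show "comp_label cs ` components L = labels cs"
    proof -
      have "components L = (\<lambda>x. same_component L `` {x}) ` points L"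
        by (auto simp: components_def quotient_def)
      then show ?thesis using comp_label[OF ch] by (simp add: labels_label_at[OF ch] image_image)
    qed
  qed
qed

lemma card_components: "faithful L cs \<Longrightarrow> card (components L) = card (labels cs)"
  using comp_label_bij bij_betw_same_card by metis

lemma restr_item:
  "length cs = length L \<Longrightarrow>
   restr Q c L cs = concat (map (\<lambda>t. item Q ((c # cs) ! t) (L ! t) (cs ! t)) [0..<length L])"
proof (induction L arbitrary: c cs)
  case (Cons s L)
  then obtain d ds where cs: "cs = d # ds" by (cases cs) auto
  have "[0..<length (s # L)] = 0 # map Suc [0..<length L]"
    by (simp add: upt_conv_Cons map_Suc_upt del: upt_Suc)
  then show ?case using Cons cs by (simp add: comp_def del: upt_Suc)
qed simp

lemma concat_if: "concat (map (\<lambda>t. if P t then [f t] else []) xs) = map f (filter P xs)"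
  by (induction xs) auto

text \<open>A point lies on the sublink iff its label belongs to a component in \<open>S\<close>.
  Hence \<open>kept\<close> and the new positions can be computed from the two label lists next to
  each slice.\<close>

lemma sublink_restr:
  assumes f: "faithful L cs" and S: "S \<subseteq> components L"
  shows "sublink L S = restr (\<lambda>l. l \<in> comp_label cs ` S) [] L cs"
proof -
  let ?Q = "\<lambda>l. l \<in> comp_label cs ` S"
  have ch: "chain [] L cs []" using f by (simp add: faithful_def)
  note inj = comp_label_bij[OF f, THEN bij_betw_imp_inj_on]
  have mem: "x \<in> \<Union>S \<longleftrightarrow> ?Q (label_at cs x)" if x: "x \<in> points L" for x
  proof -
    let ?C = "same_component L `` {x}"
    have C: "?C \<in> components L" using x by (auto simp: components_def intro: quotientI)
    have "x \<in> \<Union>S \<longleftrightarrow> ?C \<in> S"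
    proof
      assume "x \<in> \<Union>S"
      then obtain D where D: "x \<in> D" "D \<in> S" by blast
      then have "D \<in> points L // same_component L" using S by (auto simp: components_def)
      then obtain y where y: "D = same_component L `` {y}" by (rule quotientE)
      with D have "D = ?C" using equiv_class_eq[OF equiv_same_component, of y x] by simp
      with D show "?C \<in> S" by simp
    next
      assume "?C \<in> S"
      moreover have "x \<in> ?C" using x by (simp add: same_component_def)
      ultimately show "x \<in> \<Union>S" by blast
    qed
    also have "\<dots> \<longleftrightarrow> ?Q (comp_label cs ?C)"
      using inj C S by (auto dest: inj_onD)
    finally show ?thesis using comp_label[OF ch x] by simp
  qed
  have it: "item ?Q (([] # cs) ! t) (L ! t) (cs ! t) =
    (if kept (\<Union>S) t (L ! t) then [(fst (L ! t), card {k. k < snd (L ! t) \<and> (t, k) \<in> \<Union>S})] else [])"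
    if t: "t < length L" for t
  proof -
    obtain p i where pi: "L ! t = (p, i)" by force
    let ?c = "([] # cs) ! t" and ?d = "([] # cs) ! Suc t"
    have st: "lstep ?c (p, i) ?d" using chain_nth[OF ch t] pi by simp
    note n = lstep_nth[OF st]
    have w: "length ?c = width L t" "length ?d = width L (Suc t)"
      using chain_width[OF ch] t by simp_all
    have m: "(t, k) \<in> \<Union>S \<longleftrightarrow> ?Q (?c ! k)" if "k < length ?c" for k
      using mem[of "(t, k)"] that t w by (simp add: points_def label_at_def)
    have m': "(Suc t, k) \<in> \<Union>S \<longleftrightarrow> ?Q (?d ! k)" if "k < length ?d" for k
      using mem[of "(Suc t, k)"] that t w by (simp add: points_def label_at_def)
    have "keep ?Q ?c (p, i) ?d \<longleftrightarrow> kept (\<Union>S) t (p, i)"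
      using n(1,2,5,6,7) m[of i] m[of "Suc i"] m'[of i] m'[of "Suc i"]
      by (cases p) (auto simp: keep_def kept_def numeral_2_eq_2 All_less_Suc simp del: nth_Cons_Suc)
    moreover have "(k < i \<and> (t, k) \<in> \<Union>S) \<longleftrightarrow> (k < length (take i ?c) \<and> ?Q (take i ?c ! k))" for k
      using n(1) m[of k] by (cases "k < i") simp_all
    then have "card {k. k < i \<and> (t, k) \<in> \<Union>S} = length (filter ?Q (take i ?c))"
      by (simp only: length_filter_conv_card)
    ultimately show ?thesis by (simp add: item_def pi)
  qed
  have "restr ?Q [] L cs = concat (map (\<lambda>t. if kept (\<Union>S) t (L ! t)
      then [(fst (L ! t), card {k. k < snd (L ! t) \<and> (t, k) \<in> \<Union>S})] else []) [0..<length L])"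
    unfolding restr_item[OF chain_length[OF ch]] using it by (intro arg_cong[of _ _ concat] map_cong) auto
  then show ?thesis by (simp add: sublink_def concat_if)
qed


section \<open>Sums over partitions\<close>

definition weight :: "nat \<Rightarrow> laurent" where
  "weight k = delta ^ (k - 1) * Ehat_coeff k"

text \<open>The closed formula without its power of z/w and with an arbitrary set function
  \<open>F\<close> for the polynomials of the sublinks; the summation over \<open>k\<close> is
  absorbed into the weight.\<close>

definition psum :: "'c set \<Rightarrow> ('c set \<Rightarrow> laurent) \<Rightarrow> laurent" where
  "psum A F = (\<Sum>\<pi> | partition_on A \<pi>. weight (card \<pi>) * prod F \<pi>)"

lemma psum_cong:
  assumes "\<And>S. S \<subseteq> A \<Longrightarrow> S \<noteq> {} \<Longrightarrow> F S = G S"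
  shows "psum A F = psum A G"
  unfolding psum_def
proof (rule sum.cong[OF refl])
  fix \<pi> assume "\<pi> \<in> {\<pi>. partition_on A \<pi>}"
  then have "prod F \<pi> = prod G \<pi>"
    by (intro prod.cong refl assms) (auto simp: partition_on_def)
  then show "weight (card \<pi>) * prod F \<pi> = weight (card \<pi>) * prod G \<pi>" by simp
qed

text \<open>Partitions of an image \<open>g ` A\<close> correspond to the partitions of \<open>A\<close> that do not split the fibres of \<open>g\<close>;
  merging two components is the case where \<open>g\<close> identifies two labels.\<close>

definition saturated :: "('c \<Rightarrow> 'd) \<Rightarrow> 'c set \<Rightarrow> 'c set set \<Rightarrow> bool" where
  "saturated g A \<pi> \<longleftrightarrow> (\<forall>S\<in>\<pi>. \<forall>x\<in>S. \<forall>y\<in>A. g x = g y \<longrightarrow> y \<in> S)"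

lemma psum_image:
  "psum (g ` A) F =
     (\<Sum>\<pi> | partition_on A \<pi> \<and> saturated g A \<pi>. weight (card \<pi>) * (\<Prod>S\<in>\<pi>. F (g ` S)))"
proof -
  let ?v = "\<lambda>C. g -` C \<inter> A"
  have img: "g ` ?v C = C" if "partition_on (g ` A) \<pi>" "C \<in> \<pi>" for C \<pi>
  proof -
    have "C \<subseteq> g ` A" using that by (auto simp: partition_on_def)
    then show ?thesis by auto
  qed
  have vim: "?v (g ` S) = S" if "partition_on A \<pi>" "saturated g A \<pi>" "S \<in> \<pi>" for S \<pi>
  proof -
    have "S \<subseteq> A" using that(1,3) by (auto simp: partition_on_def)
    moreover have "y \<in> S" if "x \<in> S" "y \<in> A" "g y = g x" for x y
      using that \<open>saturated g A \<pi>\<close> \<open>S \<in> \<pi>\<close> unfolding saturated_def by metis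
    ultimately show ?thesis by auto
  qed
  have inj: "inj_on ((`) g) \<pi>" if "partition_on A \<pi>" "saturated g A \<pi>" for \<pi>
    using vim[OF that] by (rule inj_on_inverseI)
  show ?thesis unfolding psum_def
  \<comment> \<open>Blocks correspond by preimages in \<open>A\<close> and images under
    \<open>g\<close>. Neither changes the number of blocks, so the weights agree.\<close>
  proof (rule sum.reindex_bij_witness[where i = "\<lambda>\<pi>. (`) g ` \<pi>" and j = "\<lambda>\<pi>. ?v ` \<pi>"])
    fix \<pi> assume "\<pi> \<in> {\<pi>. partition_on (g ` A) \<pi>}"
    then have p: "partition_on (g ` A) \<pi>" by simp
    then show "(`) g ` ?v ` \<pi> = \<pi>" using img[OF p] by (simp add: image_image)
    have "partition_on A (?v ` \<pi>)"
    proof (rule partition_onI)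
      have "\<Union>(?v ` \<pi>) = g -` (\<Union>\<pi>) \<inter> A" by auto
      then show "\<Union>(?v ` \<pi>) = A" using p by (auto simp: partition_on_def)
      show "{} \<notin> ?v ` \<pi>" using img[OF p] p unfolding partition_on_def by force
      fix S S' assume "S \<in> ?v ` \<pi>" "S' \<in> ?v ` \<pi>" "S \<noteq> S'"
      then obtain C C' where C: "S = ?v C" "S' = ?v C'" "C \<in> \<pi>" "C' \<in> \<pi>" "C \<noteq> C'" by blast
      then have "C \<inter> C' = {}" using p by (auto simp: partition_on_def disjoint_def)
      then show "disjnt S S'" by (auto simp: C disjnt_def)
    qed
    moreover have "saturated g A (?v ` \<pi>)" by (auto simp: saturated_def)
    ultimately show "?v ` \<pi> \<in> {\<pi>. partition_on A \<pi> \<and> saturated g A \<pi>}" by simp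
    have i: "inj_on ?v \<pi>" using img[OF p] by (rule inj_on_inverseI)
    show "weight (card (?v ` \<pi>)) * (\<Prod>S\<in>?v ` \<pi>. F (g ` S)) = weight (card \<pi>) * prod F \<pi>"
      using img[OF p] by (simp add: card_image[OF i] prod.reindex[OF i])
  next
    fix \<pi> assume "\<pi> \<in> {\<pi>. partition_on A \<pi> \<and> saturated g A \<pi>}"
    then have p: "partition_on A \<pi>" "saturated g A \<pi>" by auto
    show "?v ` (`) g ` \<pi> = \<pi>" using vim[OF p] by (simp add: image_image)
    have "partition_on (g ` A) ((`) g ` \<pi>)"
    proof (rule partition_onI)
      have "\<Union>((`) g ` \<pi>) = g ` \<Union>\<pi>" by auto
      then show "\<Union>((`) g ` \<pi>) = g ` A" using p by (simp add: partition_on_def)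
      show "{} \<notin> (`) g ` \<pi>" using p by (auto simp: partition_on_def)
      fix C C' assume "C \<in> (`) g ` \<pi>" "C' \<in> (`) g ` \<pi>" "C \<noteq> C'"
      then obtain S S' where S: "C = g ` S" "C' = g ` S'" "S \<in> \<pi>" "S' \<in> \<pi>" "S \<noteq> S'" by blast
      then have "S \<inter> S' = {}" "S' \<subseteq> A" using p by (auto simp: partition_on_def disjoint_def)
      moreover have "y \<in> S" if "x \<in> S" "y \<in> S'" "g x = g y" for x y
        using that S p(2) \<open>S' \<subseteq> A\<close> unfolding saturated_def by blast
      ultimately show "disjnt C C'" unfolding S disjnt_def by blast
    qed
    then show "(`) g ` \<pi> \<in> {\<pi>. partition_on (g ` A) \<pi>}" by simp
  qed
qed

lemma psum_bij:
  assumes "inj_on g A"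
  shows "psum (g ` A) F = psum A (\<lambda>S. F (g ` S))"
proof -
  have "{\<pi>. partition_on A \<pi> \<and> saturated g A \<pi>} = {\<pi>. partition_on A \<pi>}"
    using assms unfolding saturated_def partition_on_def inj_on_def by blast
  then show ?thesis unfolding psum_image unfolding psum_def by simp
qed

lemma prod_block:
  assumes "finite A" "partition_on A \<pi>" "y \<in> A"
  obtains S where "S \<in> \<pi>" "y \<in> S" "\<And>S'. S' \<in> \<pi> \<Longrightarrow> y \<in> S' \<Longrightarrow> S' = S"
    "\<And>F :: 'a set \<Rightarrow> laurent. prod F \<pi> = F S * prod F (\<pi> - {S})"
proof -
  obtain S where S: "S \<in> \<pi>" "y \<in> S" using assms(2,3) unfolding partition_on_def by blast
  have "S' = S" if "S' \<in> \<pi>" "y \<in> S'" for S'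
    using that S assms(2) unfolding partition_on_def disjoint_def by blast
  moreover have "prod F \<pi> = F S * prod F (\<pi> - {S})" for F :: "'a set \<Rightarrow> laurent"
    by (rule prod.remove[OF finite_elements[OF assms(1,2)] S(1)])
  ultimately show ?thesis using that S by blast
qed

text \<open>Exactly one block of each partition contains \<open>y\<close>, so the factor
  \<open>k\<close> comes out exactly once. This is the effect of a curl on the component labelled
  \<open>y\<close>.\<close>

lemma psum_scale:
  assumes "finite A" "y \<in> A" "\<And>S. S \<subseteq> A \<Longrightarrow> S \<noteq> {} \<Longrightarrow> F S = (if y \<in> S then k * G S else G S)"
  shows "psum A F = k * psum A G"
proof -
  have "prod F \<pi> = k * prod G \<pi>" if p: "partition_on A \<pi>" for \<pi>
  proof -
    from prod_block[OF assms(1) p assms(2)] obtain S where S: "S \<in> \<pi>" "y \<in> S"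
      "\<And>S'. S' \<in> \<pi> \<Longrightarrow> y \<in> S' \<Longrightarrow> S' = S"
      "\<And>F :: 'a set \<Rightarrow> laurent. prod F \<pi> = F S * prod F (\<pi> - {S})" by blast
    have sub: "S' \<subseteq> A \<and> S' \<noteq> {}" if "S' \<in> \<pi>" for S' using p that unfolding partition_on_def by blast
    have "prod F (\<pi> - {S}) = prod G (\<pi> - {S})"
    proof (rule prod.cong[OF refl])
      fix S' assume "S' \<in> \<pi> - {S}"
      then show "F S' = G S'" using S(3)[of S'] sub assms(3)[of S'] by auto
    qed
    moreover have "F S = k * G S" using assms(3)[of S] S(1,2) sub by auto
    ultimately show ?thesis unfolding S(4)[of F] S(4)[of G] by simp
  qed
  then show ?thesis unfolding psum_def sum_distrib_left by (intro sum.cong) (auto simp: ac_simps)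
qed

text \<open>A partition that is not saturated separates \<open>a\<close> from \<open>b\<close>, and
  its two products agree. In a saturated one only the block of \<open>a\<close> and \<open>b\<close>
  feels the switch, and merging keeps the number of blocks and with it the weight.\<close>

lemma psum_merge:
  assumes fin: "finite A" and ab: "a \<in> A" "b \<in> A" "a \<noteq> b" and g: "g = id(b := a)"
    and sep: "\<And>S. S \<subseteq> A \<Longrightarrow> S \<noteq> {} \<Longrightarrow> \<not> (a \<in> S \<and> b \<in> S) \<Longrightarrow> Fp S = Fm S"
    and out: "\<And>S. S \<subseteq> A \<Longrightarrow> S \<noteq> {} \<Longrightarrow> a \<notin> S \<Longrightarrow> b \<notin> S \<Longrightarrow> F0 (g ` S) = Fp S \<and> F1 (g ` S) = Fp S"
    and both: "\<And>S. S \<subseteq> A \<Longrightarrow> a \<in> S \<Longrightarrow> b \<in> S \<Longrightarrow> Fp S - Fm S = lw * (F0 (g ` S) - F1 (g ` S))"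
  shows "psum A Fp - psum A Fm = lw * (psum (g ` A) F0 - psum (g ` A) F1)"
proof -
  let ?P = "{\<pi>. partition_on A \<pi>}" and ?Q = "{\<pi>. partition_on A \<pi> \<and> saturated g A \<pi>}"
  let ?G = "\<lambda>F S. F (g ` S)"
  have finP: "finite ?P" by (rule finitely_many_partition_on[OF fin])
  have zero: "prod Fp \<pi> - prod Fm \<pi> = 0" if "\<pi> \<in> ?P - ?Q" for \<pi>
  proof -
    have "\<not> (a \<in> S \<and> b \<in> S)" if S: "S \<in> \<pi>" for S
    proof
      assume S': "a \<in> S \<and> b \<in> S"
      have "S1 = S" if "S1 \<in> \<pi>" "a \<in> S1 \<or> b \<in> S1" for S1
        using that S S' \<open>\<pi> \<in> ?P - ?Q\<close> unfolding partition_on_def disjoint_def by blast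
      then have "saturated g A \<pi>" using S' unfolding saturated_def g by (auto split: if_splits)
      then show False using \<open>\<pi> \<in> ?P - ?Q\<close> by blast
    qed
    moreover have "S \<subseteq> A \<and> S \<noteq> {}" if "S \<in> \<pi>" for S
      using that \<open>\<pi> \<in> ?P - ?Q\<close> unfolding partition_on_def by blast
    ultimately have "prod Fp \<pi> = prod Fm \<pi>" by (intro prod.cong refl sep) auto
    then show ?thesis by simp
  qed
  have main: "prod Fp \<pi> - prod Fm \<pi> = lw * (prod (?G F0) \<pi> - prod (?G F1) \<pi>)" if "\<pi> \<in> ?Q" for \<pi>
  proof -
    have p: "partition_on A \<pi>" "saturated g A \<pi>" using that by auto
    from prod_block[OF fin p(1) ab(1)] obtain S where S: "S \<in> \<pi>" "a \<in> S"
      "\<And>S'. S' \<in> \<pi> \<Longrightarrow> a \<in> S' \<Longrightarrow> S' = S"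
      "\<And>F :: 'a set \<Rightarrow> laurent. prod F \<pi> = F S * prod F (\<pi> - {S})" by blast
    have b: "b \<in> S" using p(2) S(1,2) ab unfolding saturated_def g by auto
    have sub: "S' \<subseteq> A \<and> S' \<noteq> {}" if "S' \<in> \<pi>" for S' using p that unfolding partition_on_def by blast
    have out': "a \<notin> S' \<and> b \<notin> S'" if "S' \<in> \<pi> - {S}" for S'
      using that S(1,2) b p(1) unfolding partition_on_def disjoint_def by blast
    have e: "prod Fm (\<pi> - {S}) = prod Fp (\<pi> - {S})" "prod (?G F0) (\<pi> - {S}) = prod Fp (\<pi> - {S})"
      "prod (?G F1) (\<pi> - {S}) = prod Fp (\<pi> - {S})"
      using out' sub sep out by (auto intro!: prod.cong)
    have "S \<subseteq> A" using sub S(1) by blast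
    from both[OF this S(2) b] show ?thesis
      unfolding S(4)[of Fp] S(4)[of Fm] S(4)[of "?G F0"] S(4)[of "?G F1"] e
      by (metis (no_types, lifting) left_diff_distrib mult.assoc)
  qed
  have "psum A Fp - psum A Fm = (\<Sum>\<pi>\<in>?P. weight (card \<pi>) * (prod Fp \<pi> - prod Fm \<pi>))"
    unfolding psum_def by (simp add: right_diff_distrib sum_subtractf)
  also have "\<dots> = (\<Sum>\<pi>\<in>?Q. weight (card \<pi>) * (prod Fp \<pi> - prod Fm \<pi>))"
    by (rule sum.mono_neutral_right[OF finP]) (use zero in auto)
  also have "\<dots> = (\<Sum>\<pi>\<in>?Q. lw * (weight (card \<pi>) * (prod (?G F0) \<pi> - prod (?G F1) \<pi>)))"
    by (rule sum.cong[OF refl]) (use main in \<open>simp add: ac_simps\<close>)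
  also have "\<dots> = lw * (psum (g ` A) F0 - psum (g ` A) F1)"
    unfolding psum_image by (simp add: sum_distrib_left[symmetric] right_diff_distrib sum_subtractf)
  finally show ?thesis .
qed

section \<open>Coefficients and the number of blocks\<close>

lemma Ehat_coeff_Suc: "k \<ge> 1 \<Longrightarrow> Ehat_coeff (Suc k) = Ehat_coeff k * (Ehat_inv - of_nat k)"
  by (simp add: Ehat_coeff_def)

text \<open>The equation for the sum of |S| - 1 is what will make the power of \<delta> independent
  of the partition.\<close>

lemma partition_card:
  assumes "finite A" "A \<noteq> {}" "partition_on A \<pi>"
  shows "1 \<le> card \<pi> \<and> card \<pi> \<le> card A \<and> (\<Sum>S\<in>\<pi>. card S - 1) = card A - card \<pi>"
proof -
  have f: "finite \<pi>" using assms finite_elements by blast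
  have ne: "\<pi> \<noteq> {}" using assms by (auto simp: partition_on_def)
  have pos: "card S \<ge> 1" if "S \<in> \<pi>" for S
  proof -
    have "S \<subseteq> A" "S \<noteq> {}" using that assms(3) by (auto simp: partition_on_def)
    then have "finite S" "S \<noteq> {}" using assms(1) finite_subset by auto
    then show ?thesis by (simp add: Suc_le_eq card_gt_0_iff)
  qed
  have "card A = (\<Sum>S\<in>\<pi>. card S)"
  proof -
    have "finite S" if "S \<in> \<pi>" for S
      using that assms(1,3) finite_subset[of S A] by (auto simp: partition_on_def)
    then show ?thesis using card_Union_disjoint[of \<pi>] assms(3) by (simp add: partition_on_def)
  qed
  also have "\<dots> = (\<Sum>S\<in>\<pi>. (card S - 1) + 1)" by (intro sum.cong refl) (use pos le_add_diff_inverse2 in metis)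
  also have "\<dots> = (\<Sum>S\<in>\<pi>. card S - 1) + card \<pi>" by (simp only: sum.distrib card_eq_sum)
  finally show ?thesis using f ne by (auto simp: Suc_le_eq card_gt_0_iff)
qed

text \<open>The Stirling expansion of a power into falling factorials, by removing one element at a time:
  it is either a block of its own or belongs to one of the other blocks.\<close>

lemma sum_Ehat_coeff:
  assumes "finite A" "A \<noteq> {}"
  shows "(\<Sum>\<pi> | partition_on A \<pi>. Ehat_coeff (card \<pi>)) = Ehat_inv ^ (card A - 1)"
  using assms
proof (induction rule: finite_ne_induct)
  case (singleton x)
  have "{\<pi>. partition_on {x} \<pi>} = {{{x}}}"
  proof (intro equalityI subsetI)
    fix \<pi> assume "\<pi> \<in> {\<pi>. partition_on {x} \<pi>}"
    then have p: "\<Union>\<pi> = {x}" "{} \<notin> \<pi>" by (auto simp: partition_on_def)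
    have "S = {x}" if "S \<in> \<pi>" for S
    proof -
      have "S \<subseteq> {x}" "S \<noteq> {}" using p that by auto
      then show ?thesis by (simp add: subset_singleton_iff)
    qed
    moreover have "\<pi> \<noteq> {}" using p by auto
    ultimately show "\<pi> \<in> {{{x}}}" by blast
  qed (auto simp: partition_on_def)
  then show ?case by (simp add: Ehat_coeff_def)
next
  case (insert a A)
  let ?P = "\<lambda>A. {\<pi>. partition_on A \<pi>}"
  \<comment> \<open>\<open>?f\<close> puts \<open>a\<close> into the block \<open>S\<close>; the
    remaining partitions have \<open>{a}\<close> as a block.\<close>
  let ?f = "\<lambda>(\<pi>, S). insert (insert a S) (\<pi> - {S})"
  have finP: "finite (?P A)" by (rule finitely_many_partition_on[OF insert(1)])
  have a: "a \<notin> S" if "\<pi> \<in> ?P A" "S \<in> \<pi>" for \<pi> S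
    using that insert(3) unfolding partition_on_def by blast
  have split: "?P (insert a A) = insert {a} ` ?P A \<union> ?f ` (SIGMA \<pi>:?P A. \<pi>)"
  proof (intro equalityI subsetI)
    fix \<rho> assume "\<rho> \<in> ?P (insert a A)"
    then have p: "partition_on (insert a A) \<rho>" by simp
    then obtain S where S: "S \<in> \<rho>" "a \<in> S" unfolding partition_on_def by blast
    have dj: "disjnt S (\<Union>(\<rho> - {S}))"
      using p S unfolding partition_on_def disjoint_def disjnt_def by blast
    have \<rho>: "\<rho> = insert S (\<rho> - {S})" using S by blast
    have p': "partition_on (insert a A - S) (\<rho> - {S})"
      using p partition_on_insert[OF dj] \<rho> by metis
    show "\<rho> \<in> insert {a} ` ?P A \<union> ?f ` (SIGMA \<pi>:?P A. \<pi>)"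
    proof (cases "S = {a}")
      case True
      then have "partition_on A (\<rho> - {S})" using p' insert(3) by simp
      then show ?thesis using \<rho> True by blast
    next
      case False
      let ?\<pi> = "insert (S - {a}) (\<rho> - {S})"
      have "S \<subseteq> insert a A" using p S unfolding partition_on_def by blast
      then have "S - {a} \<subseteq> A" "S - {a} \<noteq> {}" using S False by auto
      moreover have "disjnt (S - {a}) (\<Union>(\<rho> - {S}))" using dj by (auto simp: disjnt_def)
      moreover have "A - (S - {a}) = insert a A - S" using S insert(3) by blast
      ultimately have "partition_on A ?\<pi>" using p' partition_on_insert by metis
      moreover have "S - {a} \<notin> \<rho> - {S}" using dj False S unfolding disjnt_def by blast
      then have "\<rho> = ?f (?\<pi>, S - {a})" using S by (auto simp: insert_absorb)
      ultimately show ?thesis by blast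
    qed
  next
    fix \<rho> assume "\<rho> \<in> insert {a} ` ?P A \<union> ?f ` (SIGMA \<pi>:?P A. \<pi>)"
    then show "\<rho> \<in> ?P (insert a A)"
    proof
      assume "\<rho> \<in> insert {a} ` ?P A"
      then obtain \<pi> where \<pi>: "partition_on A \<pi>" "\<rho> = insert {a} \<pi>" by blast
      then have "disjnt {a} (\<Union>\<pi>)" using insert(3) by (auto simp: partition_on_def disjnt_def)
      then show ?thesis using \<pi> partition_on_insert[of "{a}" \<pi> "insert a A"] insert(3) by simp
    next
      assume "\<rho> \<in> ?f ` (SIGMA \<pi>:?P A. \<pi>)"
      then obtain \<pi> S where \<pi>: "partition_on A \<pi>" "S \<in> \<pi>" "\<rho> = insert (insert a S) (\<pi> - {S})" by auto
      have dj: "disjnt S (\<Union>(\<pi> - {S}))"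
        using \<pi> unfolding partition_on_def disjoint_def disjnt_def by blast
      have ins: "\<pi> = insert S (\<pi> - {S})" using \<pi>(2) by blast
      have p: "partition_on (A - S) (\<pi> - {S})" "S \<subseteq> A"
        using \<pi>(1) partition_on_insert[OF dj] ins by metis+
      have "disjnt (insert a S) (\<Union>(\<pi> - {S}))"
        using dj a[of \<pi>] \<pi>(1) by (auto simp: disjnt_def)
      moreover have "insert a A - insert a S = A - S" using insert(3) by blast
      ultimately show ?thesis
        using \<pi>(3) p partition_on_insert[of "insert a S" "\<pi> - {S}" "insert a A"] by auto
    qed
  qed
  have disj: "insert {a} ` ?P A \<inter> ?f ` (SIGMA \<pi>:?P A. \<pi>) = {}"
  proof -
    have "{a} \<notin> ?f (\<pi>, S)" if "\<pi> \<in> ?P A" "S \<in> \<pi>" for \<pi> S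
      using that a[OF that] a[OF that(1)] by (auto simp: partition_on_def subset_singleton_iff)
    then have no: "{a} \<notin> \<rho>" if "\<rho> \<in> ?f ` (SIGMA \<pi>:?P A. \<pi>)" for \<rho>
      using that by (elim imageE SigmaE) simp
    have yes: "{a} \<in> \<rho>" if "\<rho> \<in> insert {a} ` ?P A" for \<rho> using that by auto
    show ?thesis
    proof (rule equals0I)
      fix \<rho> assume "\<rho> \<in> insert {a} ` ?P A \<inter> ?f ` (SIGMA \<pi>:?P A. \<pi>)"
      note * = this
      show False using no[OF IntD2[OF *]] yes[OF IntD1[OF *]] by (rule notE)
    qed
  qed
  have inj1: "inj_on (insert {a}) (?P A)"
  proof (rule inj_on_inverseI)
    fix \<pi> assume "\<pi> \<in> ?P A"
    then show "insert {a} \<pi> - {{a}} = \<pi>" using a[of \<pi> "{a}"] by auto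
  qed
  have inj2: "inj_on ?f (SIGMA \<pi>:?P A. \<pi>)"
  proof (rule inj_on_inverseI)
    fix x assume "x \<in> (SIGMA \<pi>:?P A. \<pi>)"
    then obtain \<pi> S where x: "x = (\<pi>, S)" "\<pi> \<in> ?P A" "S \<in> \<pi>" by auto
    have "(THE R. R \<in> ?f x \<and> a \<in> R) = insert a S"
      by (rule the_equality) (use x a[OF x(2)] in auto)
    moreover have "insert a S - {a} = S" using a[OF x(2,3)] by blast
    moreover have "?f x - {insert a S} = \<pi> - {S}" using x a[OF x(2)] by auto
    ultimately show "(\<lambda>\<rho>. let R = (THE R. R \<in> \<rho> \<and> a \<in> R) in (insert (R - {a}) (\<rho> - {R}), R - {a})) (?f x) = x"
      using x by (auto simp: Let_def)
  qed
  have card1: "card (insert {a} \<pi>) = Suc (card \<pi>)" if "\<pi> \<in> ?P A" for \<pi>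
  proof -
    have "{a} \<notin> \<pi>" using a[OF that, of "{a}"] by blast
    moreover have "finite \<pi>" using that finite_elements[OF insert(1)] by blast
    ultimately show ?thesis by simp
  qed
  have card2: "card (?f (\<pi>, S)) = card \<pi>" if "\<pi> \<in> ?P A" "S \<in> \<pi>" for \<pi> S
  proof -
    have "insert a S \<notin> \<pi> - {S}" using a[OF that(1)] by blast
    moreover have fin: "finite \<pi>" using that finite_elements[OF insert(1)] by blast
    ultimately have "card (insert (insert a S) (\<pi> - {S})) = card \<pi>"
      unfolding card.remove[OF fin that(2)] by simp
    then show ?thesis by simp
  qed
  have finS: "finite (SIGMA \<pi>:?P A. \<pi>)"
    using finP finite_elements[OF insert(1)] by (intro finite_SigmaI) auto
  have "(\<Sum>\<pi>\<in>?P (insert a A). Ehat_coeff (card \<pi>)) =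
      (\<Sum>\<pi>\<in>insert {a} ` ?P A. Ehat_coeff (card \<pi>)) + (\<Sum>\<pi>\<in>?f ` (SIGMA \<pi>:?P A. \<pi>). Ehat_coeff (card \<pi>))"
    unfolding split by (rule sum.union_disjoint[OF finite_imageI[OF finP] finite_imageI[OF finS] disj])
  also have "\<dots> = (\<Sum>\<pi>\<in>?P A. Ehat_coeff (card (insert {a} \<pi>))) + (\<Sum>x\<in>(SIGMA \<pi>:?P A. \<pi>). Ehat_coeff (card (?f x)))"
    by (simp only: sum.reindex[OF inj1] sum.reindex[OF inj2] comp_def)
  also have "(\<Sum>x\<in>(SIGMA \<pi>:?P A. \<pi>). Ehat_coeff (card (?f x))) =
      (\<Sum>\<pi>\<in>?P A. \<Sum>S\<in>\<pi>. Ehat_coeff (card (?f (\<pi>, S))))"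
    using finP finite_elements[OF insert(1)] by (subst sum.Sigma) (auto simp: case_prod_beta')
  also have "\<dots> = (\<Sum>\<pi>\<in>?P A. of_nat (card \<pi>) * Ehat_coeff (card \<pi>))"
  proof (rule sum.cong[OF refl])
    fix \<pi> assume "\<pi> \<in> ?P A"
    then have "(\<Sum>S\<in>\<pi>. Ehat_coeff (card (?f (\<pi>, S)))) = (\<Sum>S\<in>\<pi>. Ehat_coeff (card \<pi>))"
      by (intro sum.cong refl) (simp only: card2)
    then show "(\<Sum>S\<in>\<pi>. Ehat_coeff (card (?f (\<pi>, S)))) = of_nat (card \<pi>) * Ehat_coeff (card \<pi>)" by simp
  qed
  also have "(\<Sum>\<pi>\<in>?P A. Ehat_coeff (card (insert {a} \<pi>))) =
      (\<Sum>\<pi>\<in>?P A. Ehat_coeff (card \<pi>) * (Ehat_inv - of_nat (card \<pi>)))"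
    using partition_card[OF insert(1,2)] by (intro sum.cong refl) (simp add: card1 Ehat_coeff_Suc)
  \<comment> \<open>If c is the coefficient for k blocks and x stands for \<open>Ehat_inv\<close>,
    then c (x - k) from the new singleton and k c from the k old blocks add up to c x, whatever k
    is.\<close>
  also have "\<dots> + (\<Sum>\<pi>\<in>?P A. of_nat (card \<pi>) * Ehat_coeff (card \<pi>)) =
      (\<Sum>\<pi>\<in>?P A. Ehat_coeff (card \<pi>)) * Ehat_inv"
    unfolding sum.distrib[symmetric] sum_distrib_right by (intro sum.cong refl) (simp add: algebra_simps)
  also have "\<dots> = Ehat_inv ^ (card (insert a A) - 1)"
  proof -
    have "card A = Suc (card A - 1)" using insert(1,2) by (simp add: card_gt_0_iff)
    then have "Ehat_inv ^ card A = Ehat_inv ^ (card A - 1) * Ehat_inv"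
      by (metis power_Suc2)
    then show ?thesis using insert by simp
  qed
  finally show ?case .
qed

text \<open>All partitions contribute the same power of \<delta> and the same product of
  \<open>K\<close>. Both come out of the sum, and \<open>sum_Ehat_coeff\<close> evaluates the
  rest.\<close>

lemma psum_split:
  assumes "finite A" "A \<noteq> {}"
    and F: "\<And>S. S \<subseteq> A \<Longrightarrow> S \<noteq> {} \<Longrightarrow> F S = delta ^ (card S - 1) * prod K S"
  shows "psum A F = Ehat_inv ^ (card A - 1) * delta ^ (card A - 1) * prod K A"
proof -
  have "weight (card \<pi>) * prod F \<pi> = Ehat_coeff (card \<pi>) * (delta ^ (card A - 1) * prod K A)"
    if p: "partition_on A \<pi>" for \<pi>
  proof -
    have "prod F \<pi> = (\<Prod>S\<in>\<pi>. delta ^ (card S - 1) * prod K S)"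
      by (intro prod.cong refl F) (use p in \<open>auto simp: partition_on_def\<close>)
    also have "\<dots> = delta ^ (\<Sum>S\<in>\<pi>. card S - 1) * (\<Prod>S\<in>\<pi>. prod K S)"
      by (simp add: prod.distrib power_sum)
    also have "(\<Prod>S\<in>\<pi>. prod K S) = prod K A"
    proof -
      have "prod K (\<Union>\<pi>) = (prod \<circ> prod) K \<pi>"
      proof (rule prod.Union_disjoint)
        show "\<forall>S\<in>\<pi>. finite S"
          using p assms(1) finite_subset[of _ A] by (auto simp: partition_on_def)
        show "\<forall>S\<in>\<pi>. \<forall>S'\<in>\<pi>. S \<noteq> S' \<longrightarrow> S \<inter> S' = {}"
          using p by (auto simp: partition_on_def disjoint_def)
      qed
      then show ?thesis using p by (simp add: partition_on_def)
    qed
    finally have e: "prod F \<pi> = delta ^ (card A - card \<pi>) * prod K A"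
      using partition_card[OF assms(1,2) p] by simp
    have "card A - 1 = (card \<pi> - 1) + (card A - card \<pi>)" using partition_card[OF assms(1,2) p] by simp
    then have "delta ^ (card A - 1) = delta ^ (card \<pi> - 1) * delta ^ (card A - card \<pi>)"
      by (simp only: power_add)
    then show ?thesis unfolding e weight_def by (simp only: ac_simps)
  qed
  then have "psum A F = (\<Sum>\<pi> | partition_on A \<pi>. Ehat_coeff (card \<pi>) * (delta ^ (card A - 1) * prod K A))"
    unfolding psum_def by (intro sum.cong) auto
  also have "\<dots> = Ehat_inv ^ (card A - 1) * (delta ^ (card A - 1) * prod K A)"
    by (simp only: sum_distrib_right[symmetric] sum_Ehat_coeff[OF assms(1,2)])
  finally show ?thesis by (simp only: ac_simps)
qed

section \<open>The closed formula in terms of labels\<close>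

lemma X_formula_psum:
  assumes "finite (components L)" "components L \<noteq> {}"
  shows "X_formula T L =
    (lz * lw_inv) ^ (card (components L) - 1) * psum (components L) (\<lambda>S. T (sublink L S))"
proof -
  let ?C = "components L" and ?P = "{\<pi>. partition_on (components L) \<pi>}"
  let ?g = "\<lambda>\<pi>. \<Prod>S\<in>\<pi>. T (sublink L S)"
  have "(\<Sum>k = 1..card ?C. delta ^ (k - 1) * Ehat_coeff k * (\<Sum>\<pi> | partition_on ?C \<pi> \<and> card \<pi> = k. ?g \<pi>))
    = (\<Sum>k = 1..card ?C. \<Sum>\<pi> | \<pi> \<in> ?P \<and> card \<pi> = k. weight (card \<pi>) * ?g \<pi>)"
    by (intro sum.cong refl) (auto simp: sum_distrib_left weight_def intro!: sum.cong)
  also have "\<dots> = (\<Sum>\<pi>\<in>?P. weight (card \<pi>) * ?g \<pi>)"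
    by (rule sum.group) (use finitely_many_partition_on[OF assms(1)] partition_card[OF assms] in auto)
  finally show ?thesis unfolding X_formula_def Let_def psum_def by simp
qed

text \<open>Any separating labelling may be used, of whatever label type. For diagrams that carry
  the same labels, the formulas thereby become sums over the same partitions.\<close>

lemma X_formula_eq:
  assumes f: "faithful L cs" and ne: "labels cs \<noteq> {}"
  shows "X_formula T L =
    (lz * lw_inv) ^ (card (labels cs) - 1) * psum (labels cs) (\<lambda>B. T (restr (\<lambda>l. l \<in> B) [] L cs))"
proof -
  note b = comp_label_bij[OF f]
  have fin: "finite (components L)" using bij_betw_finite[OF b] finite_labels by simp
  have ne': "components L \<noteq> {}" using b ne by (auto simp: bij_betw_def)
  have img: "comp_label cs ` components L = labels cs" and inj: "inj_on (comp_label cs) (components L)"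
    using b by (auto simp: bij_betw_def)
  have "psum (components L) (\<lambda>S. T (sublink L S)) =
      psum (components L) (\<lambda>S. T (restr (\<lambda>l. l \<in> comp_label cs ` S) [] L cs))"
    by (rule psum_cong) (simp add: sublink_restr[OF f])
  also have "\<dots> = psum (labels cs) (\<lambda>B. T (restr (\<lambda>l. l \<in> B) [] L cs))"
    unfolding img[symmetric] psum_bij[OF inj] ..
  finally show ?thesis unfolding X_formula_psum[OF fin ne'] card_components[OF f] by simp
qed


section \<open>Labellings under moves\<close>

lemma lstep_at:
  assumes "length a = i" "length M = ins p"
  shows "lstep (a @ M @ b) (p, i) d \<longleftrightarrow> (\<exists>N. d = a @ N @ b \<and> loc p M N)"
proof
  assume "lstep (a @ M @ b) (p, i) d"
  then obtain a' b' M' N where *: "a @ M @ b = a' @ M' @ b'" "d = a' @ N @ b'" "length a' = i"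
    "loc p M' N" "length M' = ins p" by (rule lstepE)
  then have "a = a' \<and> M = M' \<and> b = b'" using assms by (metis append_eq_append_conv)
  then show "\<exists>N. d = a @ N @ b \<and> loc p M N" using * by blast
qed (use assms in \<open>auto simp: lstep_def\<close>)

lemma lstep_simps:
  assumes "length a = i"
  shows "lstep (a @ b) (Cup, i) d \<longleftrightarrow> (\<exists>x. d = a @ x # x # b)"
    "lstep (a @ x # b) (Cup, Suc i) d \<longleftrightarrow> (\<exists>y. d = a @ x # y # y # b)"
    "lstep (a @ x # y # b) (Cap, i) d \<longleftrightarrow> x = y \<and> d = a @ b"
    "lstep (a @ x # y # z # b) (Cap, Suc i) d \<longleftrightarrow> y = z \<and> d = a @ x # b"
    "p = Pos \<or> p = Neg \<Longrightarrow> lstep (a @ x # y # b) (p, i) d \<longleftrightarrow> d = a @ y # x # b"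
    "p = Pos \<or> p = Neg \<Longrightarrow> lstep (a @ x # y # z # b) (p, Suc i) d \<longleftrightarrow> d = a @ x # z # y # b"
proof -
  show "lstep (a @ b) (Cup, i) d \<longleftrightarrow> (\<exists>x. d = a @ x # x # b)"
    using lstep_at[OF assms, of "[]" Cup b d] by auto
  show "lstep (a @ x # b) (Cup, Suc i) d \<longleftrightarrow> (\<exists>y. d = a @ x # y # y # b)"
    using lstep_at[of "a @ [x]" "Suc i" "[]" Cup b d] assms by auto
  show "lstep (a @ x # y # b) (Cap, i) d \<longleftrightarrow> x = y \<and> d = a @ b"
    using lstep_at[OF assms, of "[x, y]" Cap b d] by auto
  show "lstep (a @ x # y # z # b) (Cap, Suc i) d \<longleftrightarrow> y = z \<and> d = a @ x # b"
    using lstep_at[of "a @ [x]" "Suc i" "[y, z]" Cap b d] assms by auto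
  show "lstep (a @ x # y # b) (p, i) d \<longleftrightarrow> d = a @ y # x # b" if "p = Pos \<or> p = Neg"
    using lstep_at[OF assms, of "[x, y]" p b d] that by auto
  show "lstep (a @ x # y # z # b) (p, Suc i) d \<longleftrightarrow> d = a @ x # z # y # b" if "p = Pos \<or> p = Neg"
    using lstep_at[of "a @ [x]" "Suc i" "[y, z]" p b d] that assms by auto
qed

lemma chain_simps:
  assumes "length a = i"
  shows "chain (a @ b) ((Cup, i) # L) cs e \<longleftrightarrow>
      (\<exists>x ds. cs = (a @ x # x # b) # ds \<and> chain (a @ x # x # b) L ds e)"
    "chain (a @ x # b) ((Cup, Suc i) # L) cs e \<longleftrightarrow>
      (\<exists>y ds. cs = (a @ x # y # y # b) # ds \<and> chain (a @ x # y # y # b) L ds e)"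
    "chain (a @ x # y # b) ((Cap, i) # L) cs e \<longleftrightarrow>
      (\<exists>ds. cs = (a @ b) # ds \<and> x = y \<and> chain (a @ b) L ds e)"
    "chain (a @ x # y # z # b) ((Cap, Suc i) # L) cs e \<longleftrightarrow>
      (\<exists>ds. cs = (a @ x # b) # ds \<and> y = z \<and> chain (a @ x # b) L ds e)"
    "p = Pos \<or> p = Neg \<Longrightarrow> chain (a @ x # y # b) ((p, i) # L) cs e \<longleftrightarrow>
      (\<exists>ds. cs = (a @ y # x # b) # ds \<and> chain (a @ y # x # b) L ds e)"
    "p = Pos \<or> p = Neg \<Longrightarrow> chain (a @ x # y # z # b) ((p, Suc i) # L) cs e \<longleftrightarrow>
      (\<exists>ds. cs = (a @ x # z # y # b) # ds \<and> chain (a @ x # z # y # b) L ds e)"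
  by (simp_all only: chain.simps lstep_simps[OF assms]) blast+

lemma split_at:
  assumes "i + k \<le> length c"
  obtains a m b where "c = a @ m @ b" "length a = i" "length m = k"
proof (rule that)
  have "drop i c = take k (drop i c) @ drop k (drop i c)" by (simp only: append_take_drop_id)
  then show "c = take i c @ take k (drop i c) @ drop k (drop i c)"
    by (metis append_take_drop_id)
qed (use assms in auto)

lemma length_123:
  "length m = Suc 0 \<longleftrightarrow> (\<exists>x. m = [x])" "length m = 2 \<longleftrightarrow> (\<exists>x y. m = [x, y])"
  "length m = 3 \<longleftrightarrow> (\<exists>x y z. m = [x, y, z])"
  by (auto simp: length_Suc_conv numeral_2_eq_2 numeral_3_eq_3)

lemma split1:
  assumes "i < length c" "\<And>a l b. length a = i \<Longrightarrow> c = a @ l # b \<Longrightarrow> P (a @ l # b)"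
  shows "P c"
proof -
  have "i + 1 \<le> length c" using assms(1) by simp
  then obtain a m b where "c = a @ m @ b" "length a = i" "length m = 1" by (rule split_at)
  moreover from this obtain l where "m = [l]" by (auto simp: length_123)
  ultimately show ?thesis using assms(2)[of a l b] by simp
qed

lemma split2:
  assumes "i + 2 \<le> length c" "\<And>a l k b. length a = i \<Longrightarrow> c = a @ l # k # b \<Longrightarrow> P (a @ l # k # b)"
  shows "P c"
proof -
  obtain a m b where "c = a @ m @ b" "length a = i" "length m = 2" using assms(1) by (rule split_at)
  moreover from this obtain l k where "m = [l, k]" by (auto simp: length_123)
  ultimately show ?thesis using assms(2)[of a l k b] by simp
qed

lemma split3:
  assumes "i + 3 \<le> length c" "\<And>a l k h b. length a = i \<Longrightarrow> c = a @ l # k # h # b \<Longrightarrow> P (a @ l # k # h # b)"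
  shows "P c"
proof -
  obtain a m b where "c = a @ m @ b" "length a = i" "length m = 3" using assms(1) by (rule split_at)
  moreover from this obtain l k h where "m = [l, k, h]" by (auto simp: length_123)
  ultimately show ?thesis using assms(2)[of a l k h b] by simp
qed

text \<open>Neither side of a move contains a closed strand, so all labels inside are visible at the ends.\<close>

definition tame :: "'c list \<Rightarrow> slices \<Rightarrow> slices \<Rightarrow> bool" where
  "tame c x y \<longleftrightarrow> (\<forall>d xs. chain c x xs d \<longrightarrow> (\<exists>ys. chain c y ys d) \<and>
     labels xs \<subseteq> set c \<union> set d \<and> (\<forall>xs'. chain c x xs' d \<longrightarrow> xs' = xs))"

lemma tame_interchange:
  assumes "j \<ge> i + ins p" "j' = j - ins p + outs p"
  shows "tame c [(q, j), (p, i)] [(p, i), (q, j')] \<and> tame c [(p, i), (q, j')] [(q, j), (p, i)]"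
proof (cases "j + ins q \<le> length c")
  case False
  have "\<not> chain c [(q, j), (p, i)] xs d" for xs d
    using False chain_ok[of c "[(q, j), (p, i)]" xs d] by auto
  moreover have "\<not> chain c [(p, i), (q, j')] xs d" for xs d
    using False assms chain_ok[of c "[(p, i), (q, j')]" xs d] by auto
  ultimately show ?thesis unfolding tame_def by blast
next
  case True
  then obtain a M r where 1: "c = a @ M @ r" "length a = i" "length M = ins p"
    using assms split_at[of i "ins p" c] by auto
  then obtain m M' b where 2: "r = m @ M' @ b" "length m = j - i - ins p" "length M' = ins q"
    using split_at[of "j - i - ins p" "ins q" r] True assms
    by (metis (no_types, lifting) add_diff_cancel_left' add_le_imp_le_diff diff_diff_left le_add_diff_inverse
        length_append nat_add_left_cancel_le add.assoc)
  have s1: "lstep (a @ M @ x) (p, i) e \<longleftrightarrow> (\<exists>N. e = a @ N @ x \<and> loc p M N)" for x e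
    by (rule lstep_at[OF 1(2,3)])
  have s2: "lstep (a @ M @ m @ M' @ b) (q, j) e \<longleftrightarrow> (\<exists>N. e = a @ M @ m @ N @ b \<and> loc q M' N)" for e
    using lstep_at[of "a @ M @ m" j M' q b e] 1 2 assms by simp
  have s3: "lstep (a @ N @ m @ M' @ b) (q, j') e \<longleftrightarrow> (\<exists>N'. e = a @ N @ m @ N' @ b \<and> loc q M' N')"
    if "loc p M N" for N e
    using lstep_at[of "a @ N @ m" j' M' q b e] 1 2 assms loc_length[OF that] by simp
  have c: "c = a @ M @ m @ M' @ b" using 1 2 by simp
  have A: "chain c [(q, j), (p, i)] xs d \<longleftrightarrow> (\<exists>N N'. xs = [a @ M @ m @ N' @ b, a @ N @ m @ N' @ b] \<and>
      d = a @ N @ m @ N' @ b \<and> loc p M N \<and> loc q M' N')" for xs d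
    unfolding c by (auto simp: s1 s2)
  have B: "chain c [(p, i), (q, j')] xs d \<longleftrightarrow> (\<exists>N N'. xs = [a @ N @ m @ M' @ b, a @ N @ m @ N' @ b] \<and>
      d = a @ N @ m @ N' @ b \<and> loc p M N \<and> loc q M' N')" for xs d
    unfolding c by (auto simp: s1 s3)
  have u: "N = N2 \<and> N' = N2'" if "loc p M N" "loc q M' N'" "loc p M N2" "loc q M' N2'"
    "a @ N @ m @ N' @ b = a @ N2 @ m @ N2' @ b" for N N' N2 N2'
    using that loc_length[OF that(1)] loc_length[OF that(3)] by simp
  show ?thesis unfolding tame_def A B
    by (auto simp: labels_def c dest: u)
qed

lemma curl_forms:
  assumes "positive_curl x \<or> negative_curl x"
  obtains i p where "p \<in> {Pos, Neg}" "positive_curl x \<longleftrightarrow> p = Neg" "negative_curl x \<longleftrightarrow> p = Pos"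
    "x = [(Cup, Suc i), (p, i), (Cap, Suc i)] \<or> x = [(Cup, i), (p, Suc i), (Cap, i)]"
  using assms by (auto simp: positive_curl.simps negative_curl.simps)

text \<open>Apart from the interchange, the moves are grouped by the number of strands that enter
  them, which is the number of labels that \<open>split1\<close>, \<open>split2\<close> or
  \<open>split3\<close> exposes.\<close>

lemma regular_move_cases:
  assumes "regular_move x y"
  obtains (interchange) q i p d where
      "x = [(q, i + ins p + d), (p, i)]" "y = [(p, i), (q, i + outs p + d)]"
  | (one) i where "x = [(Cup, i), (Cap, Suc i)] \<and> y = [] \<or> x = [(Cup, Suc i), (Cap, i)] \<and> y = [] \<or>
      x = [(Cup, i), (Pos, Suc i)] \<and> y = [(Cup, Suc i), (Neg, i)] \<or>
      x = [(Cup, i), (Neg, Suc i)] \<and> y = [(Cup, Suc i), (Pos, i)]"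
  | (two) i where "x = [(Pos, i), (Neg, i)] \<and> y = [] \<or> x = [(Neg, i), (Pos, i)] \<and> y = []"
  | (three) i where "x = [(Pos, Suc i), (Cap, i)] \<and> y = [(Neg, i), (Cap, Suc i)] \<or>
      x = [(Neg, Suc i), (Cap, i)] \<and> y = [(Pos, i), (Cap, Suc i)] \<or>
      x = [(Pos, i), (Pos, Suc i), (Pos, i)] \<and> y = [(Pos, Suc i), (Pos, i), (Pos, Suc i)]"
  using assms unfolding regular_move_def
proof (elim disjE)
  assume "planar_move x y"
  then show ?thesis
  proof cases
    case (interchange q i p d)
    then show ?thesis by (rule that(1))
  next
    case (zigzag_left i)
    then show ?thesis using that(2)[of i] by simp
  next
    case (zigzag_right i)
    then show ?thesis using that(2)[of i] by simp
  next
    case (rotate_cup_Pos i)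
    then show ?thesis using that(2)[of i] by simp
  next
    case (rotate_cup_Neg i)
    then show ?thesis using that(2)[of i] by simp
  next
    case (rotate_cap_Pos i)
    then show ?thesis using that(4)[of i] by simp
  next
    case (rotate_cap_Neg i)
    then show ?thesis using that(4)[of i] by simp
  qed
next
  assume "reidemeister2 x y"
  then show ?thesis using that(3) by cases simp_all
next
  assume "reidemeister3 x y"
  then show ?thesis using that(4) by cases simp
qed

lemma tame_move:
  assumes "ambient_move x y" "ok (length c) x" "ok (length c) y"
  shows "tame c x y \<and> tame c y x"
proof -
  note defs = tame_def chain_simps labels_def
  from assms(1) consider "regular_move x y" | "positive_curl x \<or> negative_curl x" "y = []"
    unfolding ambient_move_def by blast
  then show ?thesis
  proof cases
    case 1
    then show ?thesis
    proof (cases rule: regular_move_cases)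
      case (interchange q i p d)
      then show ?thesis using tame_interchange[of i p "i + ins p + d" "i + outs p + d" c q] by simp
    next
      case (one i)
      show ?thesis
        by (rule split1[of i c]) (use assms(2,3) one in \<open>auto simp del: chain.simps(2) simp: defs\<close>)
    next
      case (two i)
      show ?thesis
        by (rule split2[of i c]) (use assms(2,3) two in \<open>auto simp del: chain.simps(2) simp: defs\<close>)
    next
      case (three i)
      show ?thesis
        by (rule split3[of i c]) (use assms(2,3) three in \<open>auto simp del: chain.simps(2) simp: defs\<close>)
    qed
  next
    case 2
    from 2(1) obtain i p where "p \<in> {Pos, Neg}"
      "x = [(Cup, Suc i), (p, i), (Cap, Suc i)] \<or> x = [(Cup, i), (p, Suc i), (Cap, i)]"
      by (rule curl_forms)
    note x = this
    show ?thesis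
      by (rule split1[of i c]) (use assms(2) x 2(2) in \<open>auto simp del: chain.simps(2) simp: defs\<close>)
  qed
qed

lemma item_simps:
  assumes "length a = i"
  shows "item Q (a @ b) (Cup, i) (a @ x # x # b) = (if Q x then [(Cup, length (filter Q a))] else [])"
    "item Q (a @ y # b) (Cup, Suc i) (a @ y # x # x # b) =
       (if Q x then [(Cup, length (filter Q (a @ [y])))] else [])"
    "item Q (a @ x # x # b) (Cap, i) (a @ b) = (if Q x then [(Cap, length (filter Q a))] else [])"
    "item Q (a @ y # x # x # b) (Cap, Suc i) (a @ y # b) =
       (if Q x then [(Cap, length (filter Q (a @ [y])))] else [])"
    "p = Pos \<or> p = Neg \<Longrightarrow> item Q (a @ x # y # b) (p, i) (a @ y # x # b) =
       (if Q x \<and> Q y then [(p, length (filter Q a))] else [])"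
    "p = Pos \<or> p = Neg \<Longrightarrow> item Q (a @ z # x # y # b) (p, Suc i) (a @ z # y # x # b) =
       (if Q x \<and> Q y then [(p, length (filter Q (a @ [z])))] else [])"
  using item_loc[of Cup "[]" "[x, x]" Q a b] item_loc[of Cup "[]" "[x, x]" Q "a @ [y]" b]
    item_loc[of Cap "[x, x]" "[]" Q a b] item_loc[of Cap "[x, x]" "[]" Q "a @ [y]" b]
    item_loc[of p "[x, y]" "[y, x]" Q a b] item_loc[of p "[x, y]" "[y, x]" Q "a @ [z]" b] assms
  by auto

lemma restr_interchange:
  assumes "j \<ge> i + ins p" "j' = j - ins p + outs p"
    "chain c [(q, j), (p, i)] xs d" "chain c [(p, i), (q, j')] ys d"
  shows "restr Q c [(q, j), (p, i)] xs = restr Q c [(p, i), (q, j')] ys \<or>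
    planar_move (restr Q c [(q, j), (p, i)] xs) (restr Q c [(p, i), (q, j')] ys)"
proof -
  from assms(3) obtain e where e: "xs = [e, d]" "lstep c (q, j) e" "lstep e (p, i) d" by auto
  from e(2) obtain a0 M' b N' where 1: "c = a0 @ M' @ b" "e = a0 @ N' @ b" "length a0 = j" "loc q M' N'"
    by (rule lstepE)
  then obtain a M m where 2: "a0 = a @ M @ m" "length a = i" "length M = ins p"
    using split_at[of i "ins p" a0] assms(1) by metis
  have d: "\<exists>N. d = a @ N @ m @ N' @ b \<and> loc p M N"
    using e(3) lstep_at[OF 2(2,3), of "m @ N' @ b" d] 1 2 by simp
  then obtain N where N: "d = a @ N @ m @ N' @ b" "loc p M N" by blast
  from assms(4) obtain e' where e': "ys = [e', d]" "lstep c (p, i) e'" "lstep e' (q, j') d" by auto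
  obtain N2 where N2: "e' = a @ N2 @ m @ M' @ b" "loc p M N2"
    using e'(2) lstep_at[OF 2(2,3), of "m @ M' @ b" e'] 1 2 by auto
  have lj: "length (a @ N2 @ m) = j'" using 1 2 assms(2) loc_length[OF N2(2)] by auto
  obtain N3 where N3: "d = a @ N2 @ m @ N3 @ b" "loc q M' N3"
    using e'(3) lstep_at[OF lj, of M' q b d] N2 loc_length[OF 1(4)] by auto
  have eq: "N2 = N" "N3 = N'"
    using N(1) N3(1) loc_length[OF N(2)] loc_length[OF N2(2)] loc_length[OF 1(4)] loc_length[OF N3(2)]
    by auto
  have i1: "item Q c (q, j) e = (if list_all Q M' \<and> list_all Q N' then [(q, length (filter Q (a @ M @ m)))] else [])"
    using item_loc[OF 1(4), of Q "a @ M @ m" b] 1 2 by simp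
  have i2: "item Q e (p, i) d = (if list_all Q M \<and> list_all Q N then [(p, length (filter Q a))] else [])"
    using item_loc[OF N(2), of Q a "m @ N' @ b"] 1 2 N by simp
  have i3: "item Q c (p, i) e' = (if list_all Q M \<and> list_all Q N then [(p, length (filter Q a))] else [])"
    using item_loc[OF N(2), of Q a "m @ M' @ b"] 1 2 N2 eq by simp
  have i4: "item Q e' (q, j') d = (if list_all Q M' \<and> list_all Q N' then [(q, length (filter Q (a @ N @ m)))] else [])"
    using item_loc[OF 1(4), of Q "a @ N @ m" b] N2 N lj eq by simp
  have len: "length M = ins p" "length N = outs p" using loc_length[OF N(2)] by auto
  show ?thesis
  proof (cases "list_all Q M \<and> list_all Q N")
    case True
    have "planar_move [(q, length (filter Q a) + ins p + length (filter Q m)), (p, length (filter Q a))]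
      [(p, length (filter Q a)), (q, length (filter Q a) + outs p + length (filter Q m))]"
      by (rule planar_move.interchange)
    then show ?thesis unfolding e(1) e'(1) restr.simps i1 i2 i3 i4 if_P[OF True]
      using True by (simp add: filter_all len add.assoc)
  next
    case False
    have "filter Q M = filter Q N" by (rule not_keep_filter[OF N(2) False])
    then show ?thesis unfolding e(1) e'(1) restr.simps i1 i2 i3 i4 if_not_P[OF False] by simp
  qed
qed

text \<open>Dropping some strands of a move leaves a move or two equal lists. For instance, two of
  the three strands of the third Reidemeister move have a single crossing, at the same position on
  both sides.\<close>

lemma restr_move:
  assumes "regular_move x y" "chain c x xs d" "chain c y ys d"
  shows "restr Q c x xs = restr Q c y ys \<or> regular_move (restr Q c x xs) (restr Q c y ys)"
proof -
  let ?R = "\<lambda>c. \<forall>xs ys d. chain c x xs d \<longrightarrow> chain c y ys d \<longrightarrow>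
    restr Q c x xs = restr Q c y ys \<or> regular_move (restr Q c x xs) (restr Q c y ys)"
  have okx: "ok (length c) x" "ok (length c) y" using assms chain_ok by blast+
  note defs = chain_simps item_simps
  have lift: "planar_move x y \<Longrightarrow> regular_move x y" "reidemeister2 x y \<Longrightarrow> regular_move x y"
    "reidemeister3 x y \<Longrightarrow> regular_move x y" for x y
    by (auto simp: regular_move_def)
  note intros = planar_move.intros(2-)[THEN lift(1)] reidemeister2.intros[THEN lift(2)]
    reidemeister3.intros[THEN lift(3)]
  have "?R c"
    using assms(1)
  proof (cases rule: regular_move_cases)
    case (interchange q i p k)
    have j: "i + ins p \<le> i + ins p + k" "i + outs p + k = i + ins p + k - ins p + outs p" by simp_all
    show ?thesis unfolding interchange regular_move_def using restr_interchange[OF j] by blast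
  next
    case (one i)
    show ?thesis
      by (rule split1[of i c]) (use okx one in \<open>auto simp del: chain.simps(2) simp: defs intros\<close>)
  next
    case (two i)
    show ?thesis
      by (rule split2[of i c]) (use okx two in \<open>auto simp del: chain.simps(2) simp: defs intros\<close>)
  next
    case (three i)
    show ?thesis
      by (rule split3[of i c]) (use okx three in \<open>auto simp del: chain.simps(2) simp: defs intros\<close>)
  qed
  then show ?thesis using assms(2,3) by blast
qed

text \<open>A curl crosses only itself: all its slices carry the label \<open>l\<close> of one
  strand, so they are kept or dropped together.\<close>

lemma restr_curl:
  assumes "positive_curl x \<or> negative_curl x" "chain c x xs d"
  shows "\<exists>l\<in>set c. \<forall>Q. if Q l then (positive_curl x \<longrightarrow> positive_curl (restr Q c x xs)) \<and>
      (negative_curl x \<longrightarrow> negative_curl (restr Q c x xs)) else restr Q c x xs = []"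
proof -
  let ?R = "\<lambda>c. \<forall>xs d. chain c x xs d \<longrightarrow>
    (\<exists>l\<in>set c. \<forall>Q. if Q l then (positive_curl x \<longrightarrow> positive_curl (restr Q c x xs)) \<and>
      (negative_curl x \<longrightarrow> negative_curl (restr Q c x xs)) else restr Q c x xs = [])"
  from assms(1) obtain i p where p: "p \<in> {Pos, Neg}" "positive_curl x \<longleftrightarrow> p = Neg"
    "negative_curl x \<longleftrightarrow> p = Pos"
    "x = [(Cup, Suc i), (p, i), (Cap, Suc i)] \<or> x = [(Cup, i), (p, Suc i), (Cap, i)]"
    by (rule curl_forms)
  have "?R c"
  proof (rule split1[of i c])
    show "i < length c" using chain_ok[OF assms(2)] p(1,4) by auto
    fix a l b assume a: "length a = i"
    show "?R (a @ l # b)"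
    proof (intro allI impI bexI[of _ l])
      fix xs d Q assume "chain (a @ l # b) x xs d"
      then show "if Q l then (positive_curl x \<longrightarrow> positive_curl (restr Q (a @ l # b) x xs)) \<and>
        (negative_curl x \<longrightarrow> negative_curl (restr Q (a @ l # b) x xs)) else restr Q (a @ l # b) x xs = []"
        unfolding p(2,3) using p(1,4) a
        by (auto simp del: chain.simps(2)
            simp: chain_simps item_simps positive_curl.intros negative_curl.intros)
    qed simp
  qed
  then show ?thesis using assms(2) by blast
qed


section \<open>Labellings that separate the components\<close>

lemma item_map:
  assumes "lstep c s d"
  shows "item Q (map g c) s (map g d) = item (Q \<circ> g) c s d"
proof -
  obtain p i where s: "s = (p, i)" by force
  from assms obtain a b M N where ab: "c = a @ M @ b" "d = a @ N @ b" "length a = i" "loc p M N"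
    unfolding s by (rule lstepE)
  have loc': "loc p (map g M) (map g N)" using ab(4) by (cases p) auto
  show ?thesis
    using item_loc[OF loc', of Q "map g a" "map g b"] item_loc[OF ab(4), of "Q \<circ> g" a b] ab s
    by (simp add: list.pred_map filter_map)
qed

lemma restr_map:
  "chain c L cs e \<Longrightarrow> restr Q (map g c) L (map (map g) cs) = restr (Q \<circ> g) c L cs"
  by (induction L arbitrary: c cs) (auto simp: item_map)

lemma chain_end_labels: "chain c L cs e \<Longrightarrow> set e \<subseteq> set c \<union> labels cs"
proof (induction L arbitrary: c cs)
  case (Cons s L)
  then obtain d ds where d: "cs = d # ds" "chain d L ds e" by auto
  then show ?case using Cons.IH[OF d(2)] by (auto simp: labels_def)
qed simp

lemma labels_append: "labels (cs @ ds) = labels cs \<union> labels ds" "labels (c # cs) = set c \<union> labels cs"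
  "labels [] = {}"
  by (auto simp: labels_def)

lemma restr_link:
  assumes "chain [] L cs []" "l \<in> labels cs" "Q l"
  shows "link_diagram (restr Q [] L cs)"
proof -
  obtain cs' where cs': "chain (filter Q []) (restr Q [] L cs) cs' (filter Q [])"
    "set (filter Q []) \<union> (\<Union>x\<in>set cs'. set x) = {x \<in> set [] \<union> (\<Union>x\<in>set cs. set x). Q x}"
    using chain_restr[OF assms(1), of Q] by blast
  have "l \<in> (\<Union>x\<in>set cs'. set x)" using cs'(2) assms(2,3) by (auto simp: labels_def)
  then have "cs' \<noteq> []" by auto
  then have "restr Q [] L cs \<noteq> []" using cs'(1) by auto
  then show ?thesis using chain_ok[OF cs'(1)] by (simp add: link_diagram_iff)
qed

lemma labels_nonempty:
  assumes "chain [] L cs []" "L \<noteq> []"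
  shows "labels cs \<noteq> {}"
proof -
  obtain p i L' where L: "L = (p, i) # L'" using assms(2) by (cases L) auto
  obtain d ds where d: "cs = d # ds" "lstep [] (p, i) d" using assms(1) L by auto
  have "d \<noteq> []" using lstep_nth(1,2)[OF d(2)] by (cases p) auto
  then show ?thesis by (cases d) (auto simp: d labels_def)
qed

text \<open>A two-valued labelling of the new diagram is carried back to the old one and factored
  there. The same factor works for the new diagram, because \<open>tame\<close> makes the labels
  inside \<open>y\<close> depend only on the lines at its two ends.\<close>

lemma faithful_move:
  assumes f: "faithful (u @ x @ v) cs" and m: "ambient_move x y \<or> ambient_move y x"
    and ok: "ok 0 (u @ y @ v)"
  obtains cu cx cy cv c d where "cs = cu @ cx @ cv" "chain [] u cu c" "chain c x cx d" "chain c y cy d"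
    "chain d v cv []" "faithful (u @ y @ v) (cu @ cy @ cv)" "labels (cu @ cy @ cv) = labels cs"
    "set c \<subseteq> labels cs"
proof -
  have ch: "chain [] (u @ x @ v) cs []" using f by (simp add: faithful_def)
  then obtain cu cx cv c d where c: "cs = cu @ cx @ cv" "chain [] u cu c" "chain c x cx d" "chain d v cv []"
    unfolding chain_append by blast
  have wc: "length c = wid 0 u" using chain_ok[OF c(2)] by simp
  have okx: "ok (length c) x" using chain_ok[OF c(3)] by simp
  have oky: "ok (length c) y" using ok wc by simp
  have tame': "tame e x y \<and> tame e y x" if "length e = length c" for e :: "'z list"
    using m tame_move[of x y e] tame_move[of y x e] okx oky that by auto
  have tm: "tame c x y" "tame c y x" using m tame_move[of x y c] tame_move[of y x c] okx oky by auto
  from tm(1) c(3) obtain cy where cy: "chain c y cy d" unfolding tame_def by blast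
  have lx: "labels cx \<subseteq> set c \<union> set d" using tm(1) c(3) unfolding tame_def by blast
  have ly: "labels cy \<subseteq> set c \<union> set d" using tm(2) cy unfolding tame_def by blast
  have ends: "set c \<subseteq> labels cu" "set d \<subseteq> set c \<union> labels cx" "set d \<subseteq> set c \<union> labels cy"
    using chain_end_labels[OF c(2)] chain_end_labels[OF c(3)] chain_end_labels[OF cy] by auto
  then have label_at: "labels (cu @ cy @ cv) = labels cs"
    using lx ly unfolding c labels_append by blast
  have "\<exists>g. ms = map (map g) (cu @ cy @ cv)" if ms: "chain [] (u @ y @ v) ms []" for ms :: "bool list list"
  proof -
    from ms obtain mu my mv mc md where mm: "ms = mu @ my @ mv" "chain [] u mu mc" "chain mc y my md"
      "chain md v mv []" unfolding chain_append by blast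
    have len: "length mc = length c" using chain_ok[OF mm(2)] wc by simp
    have tmm: "tame mc x y" "tame mc y x"
      using m tame_move[of x y mc] tame_move[of y x mc] okx oky len by auto
    from tmm(2) mm(3) obtain mx where mx: "chain mc x mx md" unfolding tame_def by blast
    have "chain [] (u @ x @ v) (mu @ mx @ mv) []"
      using mm mx unfolding chain_append by blast
    then obtain g where g: "mu @ mx @ mv = map (map g) cs" using f unfolding faithful_def by blast
    have "length mu = length cu" "length mx = length cx"
      using chain_length[OF mm(2)] chain_length[OF c(2)] chain_length[OF mx] chain_length[OF c(3)] by simp_all
    then have gu: "mu = map (map g) cu" "mx = map (map g) cx" "mv = map (map g) cv"
      using g unfolding c by simp_all
    have mc: "mc = map g c"
      using chain_end[OF mm(2)] chain_end[OF c(2)] gu(1) chain_length[OF c(2)]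
      by (cases "length u") simp_all
    have md: "md = map g d"
      using chain_end[OF mx] chain_end[OF c(3)] gu(2) mc chain_length[OF c(3)]
      by (cases "length x") simp_all
    have "chain mc y (map (map g) cy) md" unfolding mc md by (rule chain_map[OF cy])
    then have "my = map (map g) cy" using tmm(2) mm(3) unfolding tame_def by blast
    then show ?thesis using gu mm(1) by (intro exI[of _ g]) simp
  qed
  moreover have "chain [] (u @ y @ v) (cu @ cy @ cv) []" using c cy unfolding chain_append by blast
  ultimately have "faithful (u @ y @ v) (cu @ cy @ cv)" unfolding faithful_def by blast
  moreover have "set c \<subseteq> labels cs" using ends unfolding c labels_append by blast
  ultimately show ?thesis using that c cy label_at by blast
qed

text \<open>Crossings permute labels, and a minimum or maximum adds or removes two equal
  ones.\<close>

lemma parity: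
  "chain c L cs e \<Longrightarrow> even (length (filter Q c)) = even (length (filter Q e))"
proof (induction L arbitrary: c cs)
  case (Cons s L)
  from Cons.prems(1) obtain p i d ds a b M N where s: "s = (p, i)"
    and d: "cs = d # ds" "lstep c s d" "chain d L ds e"
    and ab: "c = a @ M @ b" "d = a @ N @ b" "length a = i" "loc p M N" by (rule chain_ConsE)
  have "even (length (filter Q M)) = even (length (filter Q N))"
    using ab(4) by (cases p) (auto split: if_splits)
  then show ?case using Cons.IH[OF d(3)] ab by simp
qed simp

text \<open>Two labellings of one diagram combine into a labelling by pairs, to which
  \<open>parity\<close> applies as well.\<close>

lemma chain_zip:
  "chain c L cs e \<Longrightarrow> chain m L ms f \<Longrightarrow> length c = length m \<Longrightarrow>
   chain (zip c m) L (map2 zip cs ms) (zip e f)"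
proof (induction L arbitrary: c cs m ms)
  case (Cons s L)
  obtain d ds where d: "cs = d # ds" "lstep c s d" "chain d L ds e" using Cons.prems by auto
  obtain n ns where n: "ms = n # ns" "lstep m s n" "chain n L ns f" using Cons.prems by auto
  obtain p i where s: "s = (p, i)" by force
  from d(2) obtain a b M N where ab: "c = a @ M @ b" "d = a @ N @ b" "length a = i" "loc p M N"
    unfolding s by (rule lstepE)
  from n(2) obtain a' b' M' N' where ab': "m = a' @ M' @ b'" "n = a' @ N' @ b'" "length a' = i" "loc p M' N'"
    unfolding s by (rule lstepE)
  note len = loc_length[OF ab(4)] loc_length[OF ab'(4)]
  have "loc p (zip M M') (zip N N')" using ab(4) ab'(4) by (cases p) auto
  moreover have "zip c m = zip a a' @ zip M M' @ zip b b'" "zip d n = zip a a' @ zip N N' @ zip b b'"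
    using ab ab' len by simp_all
  moreover have "length (zip a a') = i" using ab ab' by simp
  ultimately have "lstep (zip c m) s (zip d n)"
    unfolding lstep_def s by (metis fst_conv snd_conv)
  moreover have "length d = length n"
    using ab ab' len Cons.prems(3) by simp
  ultimately show ?case using Cons.IH[OF d(3) n(3)] d n by simp
qed simp

text \<open>Every component meets each horizontal line an even number of times. Hence the two smoothings
  of a mixed crossing cannot separate the four ends again.\<close>

lemma mixed_smoothing:
  assumes "chain [] u cu (a @ [x, y] @ b)" "chain (a @ [y, x] @ b) v cv []" "x \<noteq> y"
    and "chain [] u mu (am @ [p, q] @ bm)" "chain (am @ [p', q'] @ bm) v mv []" "length a = length am"
    and "p' = p \<and> q' = q \<or> p = q \<and> p' = q'"
  shows "p = q \<and> p' = p"
proof -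
  let ?z = "zip a am" and ?w = "zip b bm"
  have len: "length b = length bm" using chain_ok[OF assms(1)] chain_ok[OF assms(4)] assms(6) by simp
  have "chain (zip [] []) u (map2 zip cu mu) (zip (a @ [x, y] @ b) (am @ [p, q] @ bm))"
    by (rule chain_zip[OF assms(1,4)]) simp
  then have 1: "even (length (filter (\<lambda>l. l = (x, p)) (?z @ [(x, p), (y, q)] @ ?w)))"
    using parity[of _ u _ _ "\<lambda>l. l = (x, p)"] assms(6) by force
  have "chain (zip (a @ [y, x] @ b) (am @ [p', q'] @ bm)) v (map2 zip cv mv) (zip [] [])"
    by (rule chain_zip[OF assms(2,5)]) (use assms(6) len in simp)
  then have 2: "even (length (filter (\<lambda>l. l = (x, p)) (?z @ [(y, p'), (x, q')] @ ?w)))"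
    using parity[of _ v _ _ "\<lambda>l. l = (x, p)"] assms(6) by force
  \<comment> \<open>The outer strands contribute equally to both counts of the pair
    \<open>(x, p)\<close>. Below the crossing its two strands contribute exactly one, as
    \<open>x\<close> and \<open>y\<close> differ; hence the same holds above it, which means
    \<open>q' = p\<close>.\<close>
  show ?thesis using 1 2 assms(3,7) by (auto split: if_splits)
qed


section \<open>Functionals satisfying the linear skein relations\<close>

text \<open>A move with an empty side needs strands to act on, so no step starting at width 0
  creates or deletes a whole diagram. Non-emptiness therefore persists and every step is a move of
  link diagrams.\<close>

lemma req_regular:
  assumes "req 0 L L'" "link_diagram L"
  shows "link_diagram L' \<and> regular_isotopic L L'"
proof -
  have ne: "rstep 0 y z \<or> rstep 0 z y \<Longrightarrow> y \<noteq> [] \<Longrightarrow> z \<noteq> []" for y z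
    unfolding rstep_def regular_move_def
    by (auto elim!: planar_move.cases reidemeister2.cases reidemeister3.cases)
  have am: "rstep 0 y z \<Longrightarrow> link_diagram y \<Longrightarrow> link_diagram z \<Longrightarrow> apply_move regular_move y z" for y z
    unfolding apply_move_def rstep_def by blast
  show ?thesis using assms(1)
  proof (induction rule: req_induct)
    case base
    then show ?case using assms(2) by (simp add: regular_isotopic_def)
  next
    case (step y z)
    then have z: "link_diagram z"
      using rstep_ok[of 0 y z] rstep_ok[of 0 z y] ne[of y z] by (auto simp: link_diagram_iff)
    then have "apply_move regular_move y z \<or> apply_move regular_move z y"
      using step am by blast
    then have "regular_isotopic L z"
      using step unfolding regular_isotopic_def
      by (meson equivclp_into_equivclp)
    with z show ?case by blast
  qed
qed

text \<open>A crossing of the two strands of a minimum is a curl in disguise. A zigzag is inserted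
  above it, the minimum of the zigzag is lowered below the crossing, and rotating the crossing past
  the maximum changes its type.\<close>

lemma cup_curl:
  assumes "i \<le> n" "(p, p') \<in> {(Pos, Neg), (Neg, Pos)}"
  shows "req n [(Cup, i), (p, i)] [(Cup, i), (Cup, i), (p', Suc i), (Cap, i)]"
proof -
  let ?L = "[(Cup, i), (p, i)]"
  have ok: "ok n ?L" using assms by auto
  have 1: "req n ?L [(Cup, i), (p, i), (Cup, i + 2), (Cap, Suc i)]"
    by (rule req_via[OF req_refl ok, of "?L" "[]" "[]" "[(Cup, Suc (Suc i)), (Cap, Suc i)]"])
      (use assms req_local_sym(2)[of "Suc i" "n + 2"] in auto)
  have 2: "req n ?L [(Cup, i), (Cup, i + 2), (p, i), (Cap, Suc i)]"
    by (rule req_via[OF 1 ok, of "[(Cup, i)]" "[(p, i), (Cup, i + 2)]" "[(Cap, Suc i)]"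
        "[(Cup, i + 2), (p, i)]"])
      (use assms comm1[of i p "i + 2" Cup "n + 2", THEN req_sym] in auto)
  have 3: "req n ?L [(Cup, i), (Cup, i + 2), (p', Suc i), (Cap, i)]"
    by (rule req_via[OF 2 ok, of "[(Cup, i), (Cup, i + 2)]" "[(p, i), (Cap, Suc i)]" "[]"
        "[(p', Suc i), (Cap, i)]"])
      (use assms req_local_sym(5,6)[of i "Suc (Suc (Suc (Suc n)))"] in auto)
  show ?thesis
    by (rule req_via[OF 3 ok, of "[]" "[(Cup, i), (Cup, i + 2)]" "[(p', Suc i), (Cap, i)]"
        "[(Cup, i), (Cup, i)]"])
      (use assms comm1[of i Cup i Cup n, THEN req_sym] in auto)
qed

text \<open>\<open>cup_curl\<close> upside down, with the zigzag inserted below the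
  crossing.\<close>

lemma cap_curl:
  assumes "i + 2 \<le> n" "(p, p') \<in> {(Pos, Neg), (Neg, Pos)}"
  shows "req n [(p, i), (Cap, i)] [(Cup, i), (p', Suc i), (Cap, i), (Cap, i)]"
proof -
  let ?L = "[(p, i), (Cap, i)]"
  have ok: "ok n ?L" using assms by auto
  have 1: "req n ?L [(Cup, Suc i), (Cap, i + 2), (p, i), (Cap, i)]"
    by (rule req_via[OF req_refl ok, of "[]" "[]" ?L "[(Cup, Suc i), (Cap, Suc (Suc i))]"])
      (use assms req_local_sym(1)[of "Suc i" n] in auto)
  have 2: "req n ?L [(Cup, Suc i), (p, i), (Cap, i + 2), (Cap, i)]"
    by (rule req_via[OF 1 ok, of "[(Cup, Suc i)]" "[(Cap, i + 2), (p, i)]" "[(Cap, i)]"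
        "[(p, i), (Cap, i + 2)]"])
      (use assms comm1[of i p "i + 2" Cap "n + 2"] in auto)
  have 3: "req n ?L [(Cup, i), (p', Suc i), (Cap, i + 2), (Cap, i)]"
    by (rule req_via[OF 2 ok, of "[]" "[(Cup, Suc i), (p, i)]" "[(Cap, i + 2), (Cap, i)]"
        "[(Cup, i), (p', Suc i)]"])
      (use assms req_local_sym(3,4)[of i n] in auto)
  show ?thesis
    by (rule req_via[OF 3 ok, of "[(Cup, i), (p', Suc i)]" "[(Cap, i + 2), (Cap, i)]" "[]"
        "[(Cap, i), (Cap, i)]"])
      (use assms comm1[of i Cap "i + 2" Cap "n + 2"] in auto)
qed

section \<open>Arcs that lie under all other strands\<close>

lemma run_past_low:
  assumes "i + ins p \<le> k" "k + r < n"
  shows "req n (run k r @ [(p, i)]) ((p, i) # run (k - ins p + outs p) r)"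
  using comm[of k "[(p, i)]" "Suc r" "run 0 r" n] assms by (simp add: ok_run)

lemma run_past_high:
  assumes "k + r < i" "i + ins p \<le> n"
  shows "req n (run k r @ [(p, i)]) ((p, i) # run k r)"
  using comm1_slices[of "Suc (k + r)" "run k r" i p n, THEN req_sym] assms
  by (simp add: ok_run wid_run)

lemma run_past_under:
  assumes "k \<le> i" "i + ins p \<le> k + r" "k + r < n"
  shows "req n (run k r @ [(p, i)]) ((p, Suc i) # run k (r - ins p + outs p))"
  using req_shift'[OF under_run[of "i - k" p r "n - k"], of k n, THEN req_sym] assms by simp

text \<open>An arc with end points \<open>j\<close> and \<open>j + r + 1\<close> that lies under everything it meets.\<close>

definition under_arc :: "nat \<Rightarrow> nat \<Rightarrow> slices" where
  "under_arc j r = (Cup, j) # run (Suc j) r"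

lemma under_arc_ok: "j + r \<le> n \<Longrightarrow> ok n (under_arc j r) \<and> wid n (under_arc j r) = n + 2"
  by (simp add: under_arc_def ok_run wid_run)

text \<open>A piece that avoids both ends of the arc lies beside it or over its interior. Either way
  it can be lowered to a height where the arc does not exist yet and two strands fewer are
  present.\<close>

lemma under_arc_pass:
  assumes "ins p = 2" "j + r \<le> n" "i + 2 \<le> n + 2"
    and "i + 2 \<le> j \<or> j + r + 2 \<le> i \<or> j < i \<and> i < j + r"
  shows "\<exists>i' j' r'. req n (under_arc j r @ [(p, i)]) ((p, i') # under_arc j' r') \<and>
    i' + 2 \<le> n \<and> j' + r' \<le> n - 2 + outs p"
proof -
  let ?L = "under_arc j r @ [(p, i)]"
  have okL: "ok n ?L" using under_arc_ok[OF assms(2)] assms by simp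
  consider "i + 2 \<le> j" | "j + r + 2 \<le> i" | "j < i" "i < j + r" using assms by blast
  then show ?thesis
  proof cases
    case 1
    have a: "req n ?L ((Cup, j) # (p, i) # run (Suc j - 2 + outs p) r)"
      by (rule req_via[OF req_refl okL, of "[(Cup, j)]" "run (Suc j) r @ [(p, i)]" "[]"
            "(p, i) # run (Suc j - 2 + outs p) r"])
        (use 1 assms run_past_low[of i p "Suc j" r "n + 2"] in \<open>simp_all add: under_arc_def\<close>)
    have "req n ?L ((p, i) # (Cup, j - 2 + outs p) # run (Suc j - 2 + outs p) r)"
      by (rule req_via[OF a okL, of "[]" "[(Cup, j), (p, i)]" "run (Suc j - 2 + outs p) r"
            "[(p, i), (Cup, j - 2 + outs p)]"])
        (use 1 assms comm1[of i p j Cup n] in simp_all)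
    moreover have "Suc j - 2 + outs p = Suc (j - 2 + outs p)" using 1 by simp
    ultimately have "req n ?L ((p, i) # under_arc (j - 2 + outs p) r)"
      by (simp only: under_arc_def)
    then show ?thesis using 1 assms by (intro exI conjI) auto
  next
    case 2
    have a: "req n ?L ((Cup, j) # (p, i) # run (Suc j) r)"
      by (rule req_via[OF req_refl okL, of "[(Cup, j)]" "run (Suc j) r @ [(p, i)]" "[]"
            "(p, i) # run (Suc j) r"])
        (use 2 assms run_past_high[of "Suc j" r i p "n + 2"] in \<open>simp_all add: under_arc_def\<close>)
    have "req n ?L ((p, i - 2) # under_arc j r)"
      by (rule req_via[OF a okL, of "[]" "[(Cup, j), (p, i)]" "run (Suc j) r"
            "[(p, i - 2), (Cup, j)]"])
        (use 2 assms comm1[of j Cup "i - 2" p n, THEN req_sym] le_add_diff_inverse2[of 2 i]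
          in \<open>simp_all add: under_arc_def\<close>)
    then show ?thesis using 2 assms by (intro exI conjI) auto
  next
    case 3
    have a: "req n ?L ((Cup, j) # (p, Suc i) # run (Suc j) (r - 2 + outs p))"
      by (rule req_via[OF req_refl okL, of "[(Cup, j)]" "run (Suc j) r @ [(p, i)]" "[]"
            "(p, Suc i) # run (Suc j) (r - 2 + outs p)"])
        (use 3 assms run_past_under[of "Suc j" i p r "n + 2"] in \<open>simp_all add: under_arc_def\<close>)
    have "req n ?L ((p, i - 1) # under_arc j (r - 2 + outs p))"
      by (rule req_via[OF a okL, of "[]" "[(Cup, j), (p, Suc i)]" "run (Suc j) (r - 2 + outs p)"
            "[(p, i - 1), (Cup, j)]"])
        (use 3 assms comm1[of j Cup "i - 1" p n, THEN req_sym] in \<open>simp_all add: under_arc_def\<close>)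
    then show ?thesis using 3 assms by (intro exI conjI) auto
  qed
qed

text \<open>One of the two types of crossing merely prolongs or shortens the arc by one strand;
  which type \<open>q\<close> that is depends on the end and on the side. The crossing of the two
  ends of a bare minimum is left out, being a curl.\<close>

lemma under_arc_end:
  assumes "j + r \<le> n" "i + 2 \<le> n + 2" "Suc i = j \<or> i = j \<and> r > 0 \<or> i = j + r \<and> r > 0 \<or> i = j + r + 1"
  shows "\<exists>q j' r'. q \<in> {Pos, Neg} \<and> j' + r' \<le> n \<and> req n (under_arc j r @ [(q, i)]) (under_arc j' r')"
proof -
  have ok: "ok n (under_arc j r @ [(q, i)])" if "q \<in> {Pos, Neg}" for q
    using under_arc_ok[OF assms(1)] assms that by auto
  consider "Suc i = j" | "i = j" "r > 0" | "i = j + r" "r > 0" | "i = j + r + 1" using assms(3) by blast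
  then show ?thesis
  proof cases
    case 1
    let ?L = "under_arc j r @ [(Neg, i)]"
    have okL: "ok n ?L" by (rule ok) simp
    have a: "req n ?L ([(Cup, Suc i), (Neg, i)] @ run (Suc j) r)"
      by (rule req_via[OF req_refl okL, of "[(Cup, j)]" "run (Suc j) r @ [(Neg, i)]" "[]"
            "(Neg, i) # run (Suc j) r"])
        (use 1 assms run_past_low[of i Neg "Suc j" r "n + 2"] in \<open>auto simp: under_arc_def\<close>)
    have "req n ?L (under_arc i (Suc r))"
      by (rule req_via[OF a okL, of "[]" "[(Cup, Suc i), (Neg, i)]" "run (Suc j) r"
            "[(Cup, i), (Pos, Suc i)]"])
        (use 1 assms req_local_sym(3)[of i n] in \<open>auto simp: under_arc_def run_Cons\<close>)
    then show ?thesis using 1 assms by (intro exI[of _ Neg] exI conjI) auto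
  next
    case 2
    let ?L = "under_arc j r @ [(Pos, i)]"
    obtain r' where r': "r = Suc r'" using 2 by (cases r) auto
    have okL: "ok n ?L" by (rule ok) simp
    have a: "req n ?L ([(Cup, j), (Pos, Suc j)] @ (Pos, j) # run (j + 2) r')"
      by (rule req_via[OF req_refl okL, of "[(Cup, j), (Pos, Suc j)]" "run (j + 2) r' @ [(Pos, i)]" "[]"
            "(Pos, i) # run (j + 2) r'"])
        (use 2 r' assms run_past_low[of i Pos "j + 2" r' "n + 2"] in \<open>auto simp: under_arc_def run_Cons\<close>)
    have "req n ?L (under_arc (Suc j) r')"
      by (rule req_via[OF a okL, of "[]" "[(Cup, j), (Pos, Suc j), (Pos, j)]" "run (j + 2) r'"
            "[(Cup, Suc j)]"])
        (use 2 r' assms under2_Cup[of j n] in \<open>auto simp: under_arc_def\<close>)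
    then show ?thesis using 2 r' assms by (intro exI[of _ Pos] exI conjI) auto
  next
    case 3
    let ?L = "under_arc j r @ [(Neg, i)]"
    obtain r' where r': "r = Suc r'" using 3 by (cases r) auto
    have okL: "ok n ?L" by (rule ok) simp
    have w: "wid n (under_arc j r') = n + 2" using under_arc_ok[of j r' n] assms r' by simp
    have "req n ?L (under_arc j r')"
      by (rule req_via[OF req_refl okL, of "under_arc j r'" "[(Pos, i), (Neg, i)]" "[]" "[]"])
        (use 3 r' assms w in \<open>auto simp: under_arc_def run_Suc req_local\<close>)
    then show ?thesis using r' assms by (intro exI[of _ Neg] exI conjI) auto
  next
    case 4
    have "under_arc j r @ [(Pos, i)] = under_arc j (Suc r)" using 4 by (simp add: under_arc_def run_Suc)
    then show ?thesis using 4 assms by (intro exI[of _ Pos] exI[of _ j] exI[of _ "Suc r"]) auto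
  qed
qed

definition braid :: "nat \<Rightarrow> slices \<Rightarrow> bool" where
  "braid n b \<longleftrightarrow> (\<forall>(p, i) \<in> set b. p \<in> {Pos, Neg} \<and> i + 2 \<le> n)"

lemma braid_run: "k + r < n \<Longrightarrow> braid n (run k r)"
  by (auto simp: braid_def run_def)

text \<open>The maximum joins the right end to the next strand, so the arc straightens to a strand
  running to the left under \<open>r\<close> others. Each step of the induction trades the first
  \<open>Pos\<close> for a \<open>Neg\<close> at the end.\<close>

lemma under_arc_cap_right:
  assumes "j + r < n"
  shows "\<exists>b. braid n b \<and> req n (under_arc j r @ [(Cap, j + r + 1)]) b"
  using assms
proof (induction r arbitrary: j)
  case 0
  then show ?case by (intro exI[of _ "[]"]) (auto simp: braid_def under_arc_def req_local)
next
  case (Suc r)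
  let ?L = "under_arc j (Suc r) @ [(Cap, j + Suc r + 1)]"
  have okL: "ok n ?L" using under_arc_ok[of j "Suc r" n] Suc.prems by simp
  from Suc.IH[of "Suc j"] Suc.prems obtain b where
    b: "braid n b" "req n (under_arc (Suc j) r @ [(Cap, Suc j + r + 1)]) b" by auto
  have 1: "req n ?L ([(Cup, Suc j), (Neg, j)] @ run (j + 2) r @ [(Cap, j + r + 2)])"
    by (rule req_via[OF req_refl okL, of "[]" "[(Cup, j), (Pos, Suc j)]" "run (j + 2) r @ [(Cap, j + r + 2)]"])
      (use Suc.prems in \<open>auto simp: under_arc_def run_Cons req_local\<close>)
  have 2: "req (n + 2) ((Neg, j) # run (j + 2) r) (run (j + 2) r @ [(Neg, j)])"
    using run_past_low[of j Neg "j + 2" r "n + 2", THEN req_sym] Suc.prems by simp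
  have 3: "req n ?L ([(Cup, Suc j)] @ run (j + 2) r @ [(Neg, j), (Cap, j + r + 2)])"
    by (rule req_via[OF 1 okL, of "[(Cup, Suc j)]" "(Neg, j) # run (j + 2) r" "[(Cap, j + r + 2)]"
      "run (j + 2) r @ [(Neg, j)]"]) (use 2 Suc.prems in auto)
  have 4: "req n ?L ([(Cup, Suc j)] @ run (j + 2) r @ [(Cap, j + r + 2), (Neg, j)])"
    by (rule req_via[OF 3 okL, of "[(Cup, Suc j)] @ run (j + 2) r" "[(Neg, j), (Cap, j + r + 2)]" "[]"])
      (use comm1[of j Neg "j + r + 2" Cap "n + 2", THEN req_sym] Suc.prems in \<open>auto simp: wid_run\<close>)
  have "req n ?L (b @ [(Neg, j)])"
    by (rule req_via[OF 4 okL, of "[]" "under_arc (Suc j) r @ [(Cap, j + r + 2)]" "[(Neg, j)]" b])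
      (use b in \<open>simp_all add: under_arc_def\<close>)
  moreover have "braid n (b @ [(Neg, j)])" using b(1) Suc.prems by (auto simp: braid_def)
  ultimately show ?case by blast
qed

lemma under_arc_cap_left:
  assumes "Suc j + r \<le> n"
  shows "\<exists>b. braid n b \<and> req n (under_arc (Suc j) r @ [(Cap, j)]) b"
proof -
  let ?L = "under_arc (Suc j) r @ [(Cap, j)]"
  have okL: "ok n ?L" using under_arc_ok[of "Suc j" r n] assms by simp
  have 1: "req n ?L ([(Cup, Suc j), (Cap, j)] @ run j r)"
    by (rule req_via[OF req_refl okL, of "[(Cup, Suc j)]" "run (j + 2) r @ [(Cap, j)]" "[]" "(Cap, j) # run j r"])
      (use run_past_low[of j Cap "j + 2" r "n + 2"] assms in \<open>auto simp: under_arc_def\<close>)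
  have "req n ?L (run j r)"
    by (rule req_via[OF 1 okL, of "[]" "[(Cup, Suc j), (Cap, j)]" "run j r" "[]"])
      (use assms in \<open>auto simp: req_local\<close>)
  then show ?thesis using assms by (intro exI[of _ "run j r"]) (auto intro: braid_run)
qed

text \<open>The maximum joins the left end to the first strand passed; with the crossing of the two
  this is a curl, and the rest of the run follows it.\<close>

lemma under_arc_cap_first:
  assumes "j + Suc r \<le> n"
  shows "req n (under_arc j (Suc r) @ [(Cap, j)]) ([(Cup, j), (Pos, Suc j), (Cap, j)] @ run j r)"
proof -
  let ?L = "under_arc j (Suc r) @ [(Cap, j)]"
  have okL: "ok n ?L" using under_arc_ok[of j "Suc r" n] assms by simp
  show ?thesis
    by (rule req_via[OF req_refl okL, of "[(Cup, j), (Pos, Suc j)]" "run (j + 2) r @ [(Cap, j)]" "[]" "(Cap, j) # run j r"])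
      (use run_past_low[of j Cap "j + 2" r "n + 2"] assms in \<open>auto simp: under_arc_def run_Cons\<close>)
qed

text \<open>Only the homogeneous conditions are assumed, without a value on the unknot, so that
  linear combinations qualify as well as \<open>T\<close> itself.\<close>

locale skein_functional =
  fixes H :: "slices \<Rightarrow> laurent"
  assumes invariant: "regular_isotopy_invariant H"
    and skein: "conway_quadruple t Lp Lm L0 Linf \<Longrightarrow> H Lp - H Lm = lw * (H L0 - H Linf)"
    and positive: "link_diagram (u @ x @ v) \<Longrightarrow> positive_curl x \<Longrightarrow> H (u @ x @ v) = la * H (u @ v)"
    and negative: "link_diagram (u @ x @ v) \<Longrightarrow> negative_curl x \<Longrightarrow> H (u @ x @ v) = la_inv * H (u @ v)"
begin

lemma H_req: "req 0 L L' \<Longrightarrow> link_diagram L \<Longrightarrow> H L = H L'"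
  using req_regular[of L L'] invariant unfolding regular_isotopy_invariant_def by blast

lemma H_mid:
  assumes "req (wid 0 u) x y" "link_diagram (u @ x @ v)"
  shows "H (u @ x @ v) = H (u @ y @ v) \<and> link_diagram (u @ y @ v)"
proof -
  have "req 0 (u @ x @ v) (u @ y @ v)"
    by (rule req_ctx[OF assms(1)]) (use assms(2) in \<open>auto simp: link_diagram_iff\<close>)
  then show ?thesis using H_req req_regular assms(2) by blast
qed

lemma H_skein:
  assumes "link_diagram (u @ (Pos, i) # v)"
  shows "H (u @ (Pos, i) # v) - H (u @ (Neg, i) # v) =
    lw * (H (u @ (Cap, i) # (Cup, i) # v) - H (u @ v))"
  by (rule skein[of "length u"]) (use assms in \<open>auto simp: conway_quadruple_def\<close>)

lemma H_switch:
  assumes "link_diagram (u @ (p, i) # v)" "p \<in> {Pos, Neg}" "q \<in> {Pos, Neg}"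
    "H (u @ (q, i) # v) = 0" "H (u @ (Cap, i) # (Cup, i) # v) = 0" "H (u @ v) = 0"
  shows "H (u @ (p, i) # v) = 0"
proof -
  have "link_diagram (u @ (Pos, i) # v)" using assms(1,2) by (auto simp: link_diagram_iff)
  from H_skein[OF this] show ?thesis using assms by auto
qed

lemma H_curl_zero:
  assumes "link_diagram (u @ x @ v)" "positive_curl x \<or> negative_curl x" "H (u @ v) = 0"
  shows "H (u @ x @ v) = 0"
  using assms positive negative by auto

lemma curls:
  "p \<in> {Pos, Neg} \<Longrightarrow> positive_curl [(Cup, i), (p, Suc i), (Cap, i)] \<or>
     negative_curl [(Cup, i), (p, Suc i), (Cap, i)]"
  by (auto intro: positive_curl.intros negative_curl.intros)

lemma H_cup_curl:
  assumes "link_diagram (u @ (Cup, i) # (p, i) # v)" "p \<in> {Pos, Neg}" "H (u @ (Cup, i) # v) = 0"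
  shows "H (u @ (Cup, i) # (p, i) # v) = 0"
proof -
  define p' where "p' = (if p = Pos then Neg else Pos)"
  have "i \<le> wid 0 u" using assms(1) by (auto simp: link_diagram_iff)
  then have "req (wid 0 u) [(Cup, i), (p, i)] [(Cup, i), (Cup, i), (p', Suc i), (Cap, i)]"
    by (rule cup_curl) (use assms(2) in \<open>auto simp: p'_def\<close>)
  from H_mid[OF this, of v] assms(1)
  have "H (u @ (Cup, i) # (p, i) # v) = H (u @ [(Cup, i), (Cup, i), (p', Suc i), (Cap, i)] @ v)"
    "link_diagram (u @ [(Cup, i), (Cup, i), (p', Suc i), (Cap, i)] @ v)" by auto
  moreover from this have "H ((u @ [(Cup, i)]) @ [(Cup, i), (p', Suc i), (Cap, i)] @ v) = 0"
    by (intro H_curl_zero curls) (use assms in \<open>auto simp: p'_def\<close>)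
  ultimately show ?thesis by simp
qed

lemma H_cap_curl:
  assumes "link_diagram (u @ (p, i) # (Cap, i) # v)" "p \<in> {Pos, Neg}" "H (u @ (Cap, i) # v) = 0"
  shows "H (u @ (p, i) # (Cap, i) # v) = 0"
proof -
  define p' where "p' = (if p = Pos then Neg else Pos)"
  have "i + 2 \<le> wid 0 u" using assms(1,2) by (auto simp: link_diagram_iff)
  then have "req (wid 0 u) [(p, i), (Cap, i)] [(Cup, i), (p', Suc i), (Cap, i), (Cap, i)]"
    by (rule cap_curl) (use assms(2) in \<open>auto simp: p'_def\<close>)
  from H_mid[OF this, of v] assms(1)
  have "H (u @ (p, i) # (Cap, i) # v) = H (u @ [(Cup, i), (p', Suc i), (Cap, i), (Cap, i)] @ v)"
    "link_diagram (u @ [(Cup, i), (p', Suc i), (Cap, i), (Cap, i)] @ v)" by auto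
  moreover from this have "H (u @ [(Cup, i), (p', Suc i), (Cap, i)] @ (Cap, i) # v) = 0"
    by (intro H_curl_zero curls) (use assms in \<open>auto simp: p'_def\<close>)
  ultimately show ?thesis by simp
qed

lemma variable_inverses: "la * la_inv = 1" "lw * lw_inv = 1" "lz * lz_inv = 1" "lE * lE_inv = 1"
  by (simp_all add: monomial_mult monomial_0)

text \<open>The origin of \<delta>: \<open>h\<close> belongs to a strand and \<open>hc\<close> to
  the strand with an additional circle. The assumption is the skein relation at a curl, and dividing
  it by \<open>w\<close> isolates \<open>hc\<close>.\<close>

lemma circle_from_curl:
  fixes h hc :: laurent
  assumes "la_inv * h - la * h = lw * (h - hc)"
  shows "hc = delta * h"
proof -
  have "lw_inv * (la_inv * h - la * h) = (lw * lw_inv) * (h - hc)"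
    unfolding assms by (simp only: ac_simps)
  then have "lw_inv * (la_inv * h - la * h) = h - hc" by (simp add: variable_inverses)
  then have "hc = h - lw_inv * (la_inv * h - la * h)" by simp
  then show ?thesis by (simp add: delta_def algebra_simps)
qed

text \<open>The circle is the vertical smoothing of a curl on the neighbouring strand; the
  horizontal smoothing, by \<open>straight\<close>, is the strand alone.\<close>

lemma H_circle_next_to_strand:
  assumes ld: "link_diagram (u @ (Cup, i) # (Cap, i) # v)"
    and curls: "positive_curl [(Cup, i), (Neg, j), (Cap, i)]" "negative_curl [(Cup, i), (Pos, j), (Cap, i)]"
    and j: "j \<le> wid 0 u"
    and straight: "req (wid 0 u) [(Cup, i), (Cap, j), (Cup, j), (Cap, i)] []"
  shows "H (u @ (Cup, i) # (Cap, i) # v) = delta * H (u @ v)"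
proof -
  let ?c = "\<lambda>p. [(Cup, i), (p, j), (Cap, i)]"
  have ok: "ok 0 u" "i \<le> wid 0 u" "ok (wid 0 u) v" "wid (wid 0 u) v = 0"
    using ld by (auto simp: link_diagram_iff)
  then have c: "link_diagram (u @ ?c p @ v)" if "p \<in> {Pos, Neg}" for p
    using that j by (auto simp: link_diagram_iff)
  have "link_diagram (u @ [(Cup, i), (Cap, j), (Cup, j), (Cap, i)] @ v)"
    using ok j by (simp add: link_diagram_iff)
  then have "H (u @ [(Cup, i), (Cap, j), (Cup, j), (Cap, i)] @ v) = H (u @ v)"
    using H_mid[OF straight, of v] by simp
  moreover have "H (u @ ?c Pos @ v) = la_inv * H (u @ v)" by (rule negative[OF c curls(2)]) simp
  moreover have "H (u @ ?c Neg @ v) = la * H (u @ v)" by (rule positive[OF c curls(1)]) simp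
  moreover have "H (u @ ?c Pos @ v) - H (u @ ?c Neg @ v) =
      lw * (H (u @ [(Cup, i), (Cap, j), (Cup, j), (Cap, i)] @ v) - H (u @ [(Cup, i), (Cap, i)] @ v))"
    using H_skein[of "u @ [(Cup, i)]" j "(Cap, i) # v"] c[of Pos] by simp
  ultimately have "la_inv * H (u @ v) - la * H (u @ v) = lw * (H (u @ v) - H (u @ [(Cup, i), (Cap, i)] @ v))"
    by simp
  from circle_from_curl[OF this] show ?thesis by simp
qed

lemma H_circle_positive_width:
  assumes ld: "link_diagram (u @ (Cup, i) # (Cap, i) # v)" and n: "wid 0 u > 0"
  shows "H (u @ (Cup, i) # (Cap, i) # v) = delta * H (u @ v)"
proof -
  have straight: "req m [(Cup, i), (Cap, j), (Cup, j), (Cap, i)] []"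
    if "j = Suc i \<and> i < m \<or> i = Suc j \<and> j < m" for i j m
  proof -
    let ?L = "[(Cup, i), (Cap, j), (Cup, j), (Cap, i)]"
    have ok: "ok m ?L" using that by auto
    have 1: "req m ?L [(Cup, j), (Cap, i)]"
      by (rule req_via[OF req_refl ok, of "[]" "[(Cup, i), (Cap, j)]" "[(Cup, j), (Cap, i)]" "[]"])
        (use that in \<open>auto simp: req_local\<close>)
    show ?thesis
      by (rule req_via[OF 1 ok, of "[]" "[(Cup, j), (Cap, i)]" "[]" "[]"])
        (use that in \<open>auto simp: req_local\<close>)
  qed
  show ?thesis
  proof (cases "i < wid 0 u")
    case True
    then show ?thesis
      by (intro H_circle_next_to_strand[OF ld _ _ _ straight, of "Suc i"])
        (auto intro: positive_curl.intros negative_curl.intros)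
  next
    case False
    then obtain k where "i = Suc k" "k < wid 0 u"
      using ld n by (cases i) (auto simp: link_diagram_iff)
    then show ?thesis
      by (intro H_circle_next_to_strand[OF ld _ _ _ straight, of k])
        (auto intro: positive_curl.intros negative_curl.intros)
  qed
qed

text \<open>At width 0 the circle is first moved below the preceding maximum or above the following
  minimum, where there is a strand to twist.\<close>

lemma H_circle:
  assumes ld: "link_diagram (u @ (Cup, i) # (Cap, i) # v)" and ne: "u @ v \<noteq> []"
  shows "H (u @ (Cup, i) # (Cap, i) # v) = delta * H (u @ v)"
proof (cases "wid 0 u = 0")
  case False
  then show ?thesis using H_circle_positive_width[OF ld] by simp
next
  case True
  then have i: "i = 0" using ld by (auto simp: link_diagram_iff)
  show ?thesis
  proof (cases u rule: rev_cases)
    case Nil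
    then obtain p j v' where v: "v = (p, j) # v'" using ne by (cases v) auto
    have "p = Cup" "j = 0" using ld Nil i v by (cases p; auto simp: link_diagram_iff)+
    note v = v[unfolded this]
    let ?L = "[(Cup, 0), (Cap, 0), (Cup, 0)]"
    have ok: "ok 0 ?L" by simp
    have 1: "req 0 ?L [(Cup, 0), (Cup, 0), (Cap, 2)]"
      by (rule req_via[OF req_refl ok, of "[(Cup, 0)]" "[(Cap, 0), (Cup, 0)]" "[]"])
        (use comm1[of 0 Cup 0 Cap 2] in \<open>auto simp: numeral_2_eq_2\<close>)
    have "req 0 ?L [(Cup, 0), (Cup, 2), (Cap, 2)]"
      by (rule req_via[OF 1 ok, of "[]" "[(Cup, 0), (Cup, 0)]" "[(Cap, 2)]"])
        (use comm1[of 0 Cup 0 Cup 0] in \<open>auto simp: numeral_2_eq_2\<close>)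
    with H_mid[of "[]" ?L "[(Cup, 0), (Cup, 2), (Cap, 2)]" v'] ld
    have *: "H (?L @ v') = H ([(Cup, 0)] @ (Cup, 2) # (Cap, 2) # v')"
      "link_diagram ([(Cup, 0)] @ (Cup, 2) # (Cap, 2) # v')"
      by (auto simp: v Nil i)
    show ?thesis using * H_circle_positive_width[OF *(2)] by (simp add: v Nil i)
  next
    case (snoc u' s)
    obtain p j where s: "s = (p, j)" by force
    have p: "p = Cap" "wid 0 u' = 2" "j = 0"
      using True ld by (cases p; auto simp: snoc s link_diagram_iff)+
    let ?L = "[(Cap, 0), (Cup, 0), (Cap, 0)]"
    have ok: "ok 2 ?L" by simp
    have 1: "req 2 ?L [(Cup, 0), (Cap, 2), (Cap, 0)]"
      by (rule req_via[OF req_refl ok, of "[]" "[(Cap, 0), (Cup, 0)]" "[(Cap, 0)]"])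
        (use comm1[of 0 Cup 0 Cap 2] in \<open>auto simp: numeral_2_eq_2\<close>)
    have "req 2 ?L [(Cup, 0), (Cap, 0), (Cap, 0)]"
      by (rule req_via[OF 1 ok, of "[(Cup, 0)]" "[(Cap, 2), (Cap, 0)]" "[]"])
        (use comm1[of 0 Cap 2 Cap 4] in auto)
    with H_mid[of u' ?L "[(Cup, 0), (Cap, 0), (Cap, 0)]" v] ld
    have *: "H (u' @ ?L @ v) = H (u' @ (Cup, 0) # (Cap, 0) # (Cap, 0) # v)"
      "link_diagram (u' @ (Cup, 0) # (Cap, 0) # (Cap, 0) # v)"
      by (auto simp: snoc s p i)
    show ?thesis using * H_circle_positive_width[OF *(2)] p by (simp add: snoc s i)
  qed
qed

section \<open>Removing the slices above a system of arcs\<close>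

inductive arcs :: "nat \<Rightarrow> slices \<Rightarrow> bool" where
  arcs_Nil: "arcs 0 []"
| arcs_step: "arcs n w \<Longrightarrow> j + r \<le> n \<Longrightarrow> arcs (n + 2) (w @ under_arc j r)"

lemma arcs_ok: "arcs n w \<Longrightarrow> ok 0 w \<and> wid 0 w = n"
  by (induction rule: arcs.induct) (auto dest: under_arc_ok)

text \<open>Everything below \<open>v\<close> is built from arcs, each lying under the previous ones. The next slice of \<open>v\<close> can
  be pushed below the last arc or absorbed by it, up to switching one crossing; thus the slices of \<open>v\<close>
  are removed one at a time.\<close>

definition zero :: "nat \<Rightarrow> slices \<Rightarrow> bool" where
  "zero n v \<longleftrightarrow> ok n v \<and> wid n v = 0 \<and> (\<forall>w. arcs n w \<longrightarrow> w @ v \<noteq> [] \<longrightarrow> H (w @ v) = 0)"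

lemma zeroD: "zero n v \<Longrightarrow> arcs n w \<Longrightarrow> w @ v \<noteq> [] \<Longrightarrow> H (w @ v) = 0 \<and> link_diagram (w @ v)"
  by (auto simp: zero_def link_diagram_iff dest: arcs_ok)

lemma zero_under_arc:
  assumes "zero (n + 2) v" "j + r \<le> n"
  shows "zero n (under_arc j r @ v)"
  unfolding zero_def
proof (intro conjI allI impI)
  fix w assume "arcs n w"
  from zeroD[OF assms(1) arcs_step[OF this assms(2)]] show "H (w @ under_arc j r @ v) = 0"
    by (simp add: under_arc_def)
qed (use assms under_arc_ok[OF assms(2)] in \<open>auto simp: zero_def\<close>)

lemma zero_Cup: "zero (n + 2) v \<Longrightarrow> i \<le> n \<Longrightarrow> zero n ((Cup, i) # v)"
  using zero_under_arc[of n v i 0] by (simp add: under_arc_def)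

lemma zero_braid:
  assumes "\<And>v i p. i + 2 \<le> n \<Longrightarrow> p \<in> {Pos, Neg} \<Longrightarrow> zero n v \<Longrightarrow> zero n ((p, i) # v)"
    and "braid n b" "zero n v"
  shows "zero n (b @ v)"
  using assms(2) by (induction b) (use assms(1,3) in \<open>auto simp: braid_def\<close>)

lemma zero_req:
  assumes "arcs m w" "req m x y" "ok m x" "ok (wid m x) v" "wid (wid m x) v = 0" "x \<noteq> []"
    "w @ y @ v \<noteq> [] \<Longrightarrow> H (w @ y @ v) = 0"
  shows "H (w @ x @ v) = 0"
proof -
  have "link_diagram (w @ x @ v)" using arcs_ok[OF assms(1)] assms by (auto simp: link_diagram_iff)
  moreover have "req (wid 0 w) x y" using arcs_ok[OF assms(1)] assms by simp
  ultimately show ?thesis using H_mid[of w x y v] assms(7) by (auto simp: link_diagram_iff)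
qed

context
  assumes H_unknot: "H [(Cup, 0), (Cap, 0)] = 0"
begin

text \<open>Crossings and maxima share one induction on the width. A piece clear of the ends of the
  last arc slips below it, to width n-2. A maximum at an end leads to a braid of that smaller width,
  possibly by way of a curl, or to a circle. A crossing at an end is switched to the type that the
  arc absorbs; its horizontal smoothing begins with a maximum at the same width, so at each width
  maxima are settled before crossings.\<close>

lemma zero_slice:
  "(\<forall>v i p. i + 2 \<le> n \<longrightarrow> p \<in> {Pos, Neg} \<longrightarrow> zero n v \<longrightarrow> zero n ((p, i) # v)) \<and>
   (\<forall>v i. i + 2 \<le> n \<longrightarrow> zero (n - 2) v \<longrightarrow> zero n ((Cap, i) # v))"
proof (induction n rule: less_induct)
  case (less n)
  have cross: "zero m ((p, i) # v)" if "m < n" "i + 2 \<le> m" "p \<in> {Pos, Neg}" "zero m v" for m p i v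
    using less that by blast
  have cap: "zero m ((Cap, i) # v)" if "m < n" "i + 2 \<le> m" "zero (m - 2) v" for m i v
    using less that by blast
  have braided: "zero m (b @ v)" if "m < n" "braid m b" "zero m v" for m b v
    by (rule zero_braid[OF _ that(2,3)]) (use cross that(1) in blast)
  have pass: "H (w @ under_arc j r @ (p, i) # v) = 0"
    if "arcs m w" "j + r \<le> m" "m + 2 = n" "i + 2 \<le> n" "p \<in> {Pos, Neg, Cap}" "zero (n - 2 + outs p) v"
      and "i + 2 \<le> j \<or> j + r + 2 \<le> i \<or> j < i \<and> i < j + r" for w j r m p i v
  proof -
    have p: "ins p = 2" using that(5) by auto
    have "i + 2 \<le> m + 2" using that by simp
    from under_arc_pass[OF p that(2) this that(7)] obtain i' j' r' where
      i': "req m (under_arc j r @ [(p, i)]) ((p, i') # under_arc j' r')" "i' + 2 \<le> m" "j' + r' \<le> m - 2 + outs p"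
      by blast
    have "m - 2 + outs p + 2 = n - 2 + outs p" using i'(2) that(3) by linarith
    then have "zero (m - 2 + outs p + 2) v" using that(6) by (simp only:)
    from zero_under_arc[OF this i'(3)] have "zero (m - 2 + outs p) (under_arc j' r' @ v)" .
    then have z: "zero m ((p, i') # under_arc j' r' @ v)"
      using that(5) cross[of m i' p "under_arc j' r' @ v"] cap[of m i' "under_arc j' r' @ v"] i'(2) that(3) by auto
    have "H (w @ (under_arc j r @ [(p, i)]) @ v) = 0"
    proof (rule zero_req[OF that(1) i'(1)])
      show "H (w @ ((p, i') # under_arc j' r') @ v) = 0" using zeroD[OF z that(1)] by simp
    qed (use under_arc_ok[OF that(2)] that in \<open>auto simp: zero_def\<close>)
    then show ?thesis by simp
  qed
  have K: "zero n ((Cap, i) # v)" if i: "i + 2 \<le> n" and v: "zero (n - 2) v" for i v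
    unfolding zero_def
  proof (intro conjI allI impI)
    fix w assume "arcs n w"
    then obtain m w' j r where w: "w = w' @ under_arc j r" "arcs m w'" "j + r \<le> m" "n = m + 2"
      using i by (auto elim: arcs.cases)
    have vm: "zero m v" using v w by simp
    have ld: "link_diagram (w' @ under_arc j r @ (Cap, i) # v)"
      using arcs_ok[OF w(2)] under_arc_ok[OF w(3)] vm i w by (auto simp: link_diagram_iff zero_def)
    have red: "H (w' @ under_arc j r' @ (Cap, i) # v) = 0"
      if "req m (under_arc j r' @ [(Cap, i)]) b" "braid m b" "j + r' \<le> m" for j r' b
    proof -
      have z: "zero m (b @ v)" using braided[of m b v] that vm w by simp
      have "H (w' @ (under_arc j r' @ [(Cap, i)]) @ v) = 0"
      proof (rule zero_req[OF w(2) that(1)])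
        show "w' @ b @ v \<noteq> [] \<Longrightarrow> H (w' @ b @ v) = 0" using zeroD[OF z w(2)] by simp
      qed (use under_arc_ok[OF that(3)] vm w i in \<open>auto simp: zero_def\<close>)
      then show ?thesis by simp
    qed
    consider "i + 2 \<le> j \<or> j + r + 2 \<le> i \<or> j < i \<and> i < j + r" | "i = j" "r = 0" | "Suc i = j"
      | "i = j" "r > 0" | "i = j + r" "r > 0" | "i = j + r + 1" by linarith
    then show "H (w @ (Cap, i) # v) = 0"
    proof cases
      case 1
      then show ?thesis using pass[OF w(2,3) _ i, of Cap v] w vm by simp
    next
      case 2
      \<comment> \<open>The maximum closes the arc to a circle. Only if nothing else is left does
        the value on the unknot enter.\<close>
      have "H (w' @ (Cup, i) # (Cap, i) # v) = 0"
      proof (cases "w' @ v = []")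
        case True
        then show ?thesis using H_unknot w(3) arcs_ok[OF w(2)] 2 by simp
      next
        case False
        then have "H (w' @ v) = 0" using zeroD[OF vm w(2)] by simp
        then show ?thesis using H_circle[of w' i v] False ld 2 by (simp add: under_arc_def)
      qed
      then show ?thesis by (simp add: w 2 under_arc_def)
    next
      case 3
      then show ?thesis using under_arc_cap_left[of i r m] red[of j r] w by (auto simp: w)
    next
      case 4
      then obtain r' where r': "r = Suc r'" by (cases r) auto
      have le: "j + Suc r' \<le> m" using w r' by simp
      have z: "zero m (run j r' @ v)"
        using braided[of m "run j r'" v] braid_run[of j r' m] le vm w by simp
      have "H (w' @ (under_arc j r @ [(Cap, i)]) @ v) = 0"
      proof (rule zero_req[OF w(2)])
        show "req m (under_arc j r @ [(Cap, i)]) ([(Cup, j), (Pos, Suc j), (Cap, j)] @ run j r')"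
          using under_arc_cap_first[OF le] by (simp add: 4 r')
        have "H (w' @ [(Cup, j), (Pos, Suc j), (Cap, j)] @ run j r' @ v) = 0"
          if "w' @ run j r' @ v \<noteq> []"
        proof (rule H_curl_zero)
          show "link_diagram (w' @ [(Cup, j), (Pos, Suc j), (Cap, j)] @ run j r' @ v)"
            using z arcs_ok[OF w(2)] le by (simp add: zero_def link_diagram_iff)
        qed (use zeroD[OF z w(2) that] curls in auto)
        moreover have "w' @ run j r' @ v \<noteq> []" using arcs_ok[OF w(2)] le by auto
        ultimately show "H (w' @ ([(Cup, j), (Pos, Suc j), (Cap, j)] @ run j r') @ v) = 0" by simp
      qed (use under_arc_ok[OF w(3)] vm w i in \<open>auto simp: zero_def\<close>)
      then show ?thesis by (simp add: w)
    next
      case 5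
      then obtain r' where r': "r = Suc r'" by (cases r) auto
      \<comment> \<open>The last crossing of the arc sits directly below the maximum and is a curl;
        without it, the maximum joins the right end to its right neighbour.\<close>
      have "H (w' @ under_arc j r' @ (Cap, i) # v) = 0"
        using under_arc_cap_right[of j r' m] red[of j r'] w r' 5 by auto
      then have "H ((w' @ under_arc j r') @ (Pos, i) # (Cap, i) # v) = 0"
        by (intro H_cap_curl) (use ld in \<open>auto simp: under_arc_def r' run_Suc 5\<close>)
      then show ?thesis by (simp add: w under_arc_def r' run_Suc 5)
    next
      case 6
      then show ?thesis using under_arc_cap_right[of j r m] red[of j r] w i by (auto simp: w)
    qed
  qed (use i v in \<open>auto simp: zero_def\<close>)
  have C: "zero n ((p, i) # v)" if i: "i + 2 \<le> n" and p: "p \<in> {Pos, Neg}" and v: "zero n v" for i p v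
    unfolding zero_def
  proof (intro conjI allI impI)
    fix w assume aw: "arcs n w"
    then obtain m w' j r where w: "w = w' @ under_arc j r" "arcs m w'" "j + r \<le> m" "n = m + 2"
      using i by (auto elim: arcs.cases)
    have ok: "ok n ((q, i) # v) \<and> wid n ((q, i) # v) = 0" if "q \<in> {Pos, Neg}" for q
      using that v i le_add_diff_inverse2[of 2 n] by (auto simp: zero_def)
    have ld: "link_diagram (w @ (p, i) # v)"
      using arcs_ok[OF aw] ok[OF p] by (simp add: link_diagram_iff del: ok.simps wid.simps)
    have Hv: "H (w @ v) = 0" using zeroD[OF v aw] by (auto simp: w under_arc_def)
    consider "i + 2 \<le> j \<or> j + r + 2 \<le> i \<or> j < i \<and> i < j + r" | "i = j" "r = 0"
      | "Suc i = j \<or> i = j \<and> r > 0 \<or> i = j + r \<and> r > 0 \<or> i = j + r + 1" by linarith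
    then show "H (w @ (p, i) # v) = 0"
    proof cases
      case 1
      have "zero (n - 2 + outs p) v" using v p le_add_diff_inverse2[of 2 n] i by auto
      with 1 show ?thesis using pass[OF w(2,3) _ i, of p v] w p by auto
    next
      case 2
      then show ?thesis
        using H_cup_curl[of w' i p v] ld p Hv by (simp add: w under_arc_def)
    next
      case 3
      have "i + 2 \<le> m + 2" using i w by simp
      from under_arc_end[OF w(3) this 3] obtain q j' r' where
        q: "q \<in> {Pos, Neg}" "j' + r' \<le> m" "req m (under_arc j r @ [(q, i)]) (under_arc j' r')" by blast
      have "H (w' @ (under_arc j r @ [(q, i)]) @ v) = 0"
      proof (rule zero_req[OF w(2) q(3)])
        have "arcs n (w' @ under_arc j' r')" using arcs_step[OF w(2) q(2)] w by simp
        from zeroD[OF v this] show "H (w' @ under_arc j' r' @ v) = 0" by (simp add: under_arc_def)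
      qed (use under_arc_ok[OF w(3)] ok[OF q(1)] i q(1) w(4) in auto)
      then have "H (w @ (q, i) # v) = 0" by (simp add: w)
      moreover have "zero n ((Cap, i) # (Cup, i) # v)"
        by (rule K[OF i], rule zero_Cup) (use v i le_add_diff_inverse2[of 2 n] in simp_all)
      from zeroD[OF this aw] have "H (w @ (Cap, i) # (Cup, i) # v) = 0" by simp
      ultimately show ?thesis using H_switch[OF ld p q(1)] Hv by blast
    qed
  qed (use i p v le_add_diff_inverse2[of 2 n] in \<open>auto simp: zero_def\<close>)
  from C K show ?case by blast
qed

lemma zero_all: "ok n v \<Longrightarrow> wid n v = 0 \<Longrightarrow> zero n v"
proof (induction n v rule: ok.induct)
  case (1 n)
  \<comment> \<open>Above the last slice the width is 0 and there are no arcs; the empty diagram is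
    exempt from \<open>zero\<close>.\<close>
  have "\<not> (arcs 0 w \<and> w \<noteq> [])" for w by (auto elim: arcs.cases simp: under_arc_def)
  then show ?case using 1 by (auto simp: zero_def)
next
  case (2 n p i v)
  then have v: "zero (n - ins p + outs p) v" "i + ins p \<le> n" by auto
  show ?case
  proof (cases p)
    case Cup
    then show ?thesis using zero_Cup[of n v i] v by simp
  next
    case Cap
    then show ?thesis using zero_slice[of n] v by simp
  qed (use zero_slice[of n] v le_add_diff_inverse2[of 2 n] in simp_all)
qed

theorem vanishes: "link_diagram L \<Longrightarrow> H L = 0"
  using zero_all[of 0 L] zeroD[of 0 L "[]"] arcs_Nil by (auto simp: link_diagram_iff)

end

end


section \<open>Invariance and skein relation of the closed formula\<close>

lemma faithful_link: "link_diagram L \<Longrightarrow> \<exists>cs :: (nat \<times> nat) set list list. faithful L cs"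
  by (rule faithful_exists) (auto simp: link_diagram_iff)

lemma chain_Neg_iff: "chain c (u @ (Neg, i) # v) ms e \<longleftrightarrow> chain c (u @ (Pos, i) # v) ms e"
  by (simp add: chain_append lstep_def)

section \<open>A mixed crossing, its labels and its smoothings\<close>

locale mixed_labelling =
  fixes u v :: slices and i :: nat and cs cu cv :: "'c list list" and a b :: "'c list" and x y :: 'c
  assumes faithful: "faithful (u @ (Pos, i) # v) cs"
    and cs: "cs = cu @ (a @ [y, x] @ b) # cv"
    and chain_u: "chain [] u cu (a @ [x, y] @ b)"
    and chain_v: "chain (a @ [y, x] @ b) v cv []"
    and a: "length a = i" and xy: "x \<noteq> y"
begin

definition g :: "'c \<Rightarrow> 'c" where "g = id(y := x)"

lemma g_simps [simp]: "g x = x" "g y = x"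
  by (simp_all add: g_def)

lemma xy_labels: "x \<in> labels cs" "y \<in> labels cs"
  by (auto simp: cs labels_def)

text \<open>Once \<open>x\<close> and \<open>y\<close> are identified, the lines below and above the
  crossing carry equal labels, so removing the slice just removes one of them.\<close>

definition cs_inf :: "'c list list" where "cs_inf = map (map g) (cu @ cv)"

definition cs_0 :: "'c list list" where
  "cs_0 = map (map g) cu @ [map g (a @ b), map g (a @ [x, y] @ b)] @ map (map g) cv"

lemma chain_gu: "chain [] u (map (map g) cu) (map g (a @ [x, y] @ b))"
  using chain_map[OF chain_u, of g] by simp

lemma chain_gv: "chain (map g (a @ [x, y] @ b)) v (map (map g) cv) []"
  using chain_map[OF chain_v, of g] by simp

lemma chain_inf: "chain [] (u @ v) cs_inf []"
  unfolding cs_inf_def map_append by (rule chain_appendI[OF chain_gu chain_gv])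

lemma chain_0: "chain [] (u @ (Cap, i) # (Cup, i) # v) cs_0 []"
proof -
  have "chain (map g (a @ [x, y] @ b)) [(Cap, i), (Cup, i)] [map g (a @ b), map g (a @ [x, y] @ b)]
    (map g (a @ [x, y] @ b))"
    using a lstep_simps[of "map g a" i] by simp
  from chain_appendI[OF chain_gu chain_appendI[OF this chain_gv]] show ?thesis
    by (simp add: cs_0_def)
qed

lemma labels_u: "set (a @ [x, y] @ b) \<subseteq> labels cu"
  using chain_end_labels[OF chain_u] by simp

lemma labels_inf: "labels cs_inf = g ` labels cs"
proof -
  have "labels (cu @ cv) = labels cs" using labels_u by (auto simp: cs labels_append)
  then show ?thesis unfolding cs_inf_def labels_map by simp
qed

lemma labels_0: "labels cs_0 = g ` labels cs"
proof -
  have "cs_0 = map (map g) (cu @ [a @ b, a @ [x, y] @ b] @ cv)" by (simp add: cs_0_def)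
  moreover have "labels (cu @ [a @ b, a @ [x, y] @ b] @ cv) = labels cs"
    using labels_u by (auto simp: cs labels_append)
  ultimately show ?thesis by (simp only: labels_map)
qed

lemma card_image: "card (g ` labels cs) = card (labels cs) - 1"
proof -
  have "g ` labels cs = labels cs - {y}"
    using xy_labels xy by (auto simp: g_def image_iff)
  then show ?thesis using xy_labels finite_labels by simp
qed

lemma card_ge: "card (labels cs) \<ge> 2"
proof -
  have "card {x, y} \<le> card (labels cs)" using xy_labels finite_labels by (intro card_mono) auto
  then show ?thesis using xy by simp
qed

text \<open>A labelling of a smoothing whose two strands agree is also a labelling of the crossing,
  where it factors through \<open>cs\<close>. The factor has equal values on \<open>x\<close> and
  \<open>y\<close> and therefore passes through \<open>g\<close>.\<close>

lemma factor:
  assumes m: "chain [] u mu (am @ [p, p] @ bm)" "chain (am @ [p, p] @ bm) v mv []" "length am = i"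
  shows "\<exists>h. mu = map (map h) (map (map g) cu) \<and> mv = map (map h) (map (map g) cv) \<and>
    am @ bm = map h (map g (a @ b)) \<and> am @ [p, p] @ bm = map h (map g (a @ [x, y] @ b))"
proof -
  have "chain (am @ [p, p] @ bm) ((Pos, i) # v) ((am @ [p, p] @ bm) # mv) []"
    using m(2) lstep_simps(5)[OF m(3), of Pos p p bm] by simp
  then have "chain [] (u @ (Pos, i) # v) (mu @ (am @ [p, p] @ bm) # mv) []"
    by (rule chain_appendI[OF m(1)])
  then obtain h where h: "mu @ (am @ [p, p] @ bm) # mv = map (map h) cs"
    using faithful_factor[OF faithful] by blast
  have "length mu = length cu" using chain_length[OF m(1)] chain_length[OF chain_u] by simp
  then have h': "mu = map (map h) cu" "am @ [p, p] @ bm = map h (a @ [y, x] @ b)" "mv = map (map h) cv"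
    using h unfolding cs by simp_all
  have ab: "am = map h a" "h x = p" "h y = p" "bm = map h b" using h'(2) a m(3) by auto
  then have hg: "h (g l) = h l" for l by (simp add: g_def)
  show ?thesis using h' ab by (intro exI[of _ h]) (simp add: hg)
qed

text \<open>By \<open>mixed_smoothing\<close> no labelling can tell the two vertical strands apart,
  which is the condition needed for \<open>factor\<close>.\<close>

lemma faithful_inf: "faithful (u @ v) cs_inf"
proof -
  have "\<exists>h. ms = map (map h) cs_inf" if ms: "chain [] (u @ v) ms []" for ms :: "bool list list"
  proof -
    obtain mu mv m where m: "ms = mu @ mv" "chain [] u mu m" "chain m v mv []"
      using ms unfolding chain_append by blast
    have "length m = length (a @ [x, y] @ b)" using chain_ok[OF m(2)] chain_ok[OF chain_u] by simp
    then have "i + 2 \<le> length m" using a by simp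
    then obtain am pq bm where 1: "m = am @ pq @ bm" "length am = i" "length pq = 2" by (rule split_at)
    then obtain p q where pq: "pq = [p, q]" by (auto simp: length_123)
    have "p = q \<and> p = p"
      by (rule mixed_smoothing[OF chain_u chain_v xy m(2,3)[unfolded 1 pq]]) (use 1 a in auto)
    then show ?thesis
      using factor[of mu am p bm mv] m 1 pq by (auto simp: cs_inf_def)
  qed
  then show ?thesis unfolding faithful_def using chain_inf by blast
qed

text \<open>Here the maximum forces \<open>p = q\<close> by itself; that the new minimum has the
  same label is the second conclusion of \<open>mixed_smoothing\<close>.\<close>

lemma faithful_0: "faithful (u @ (Cap, i) # (Cup, i) # v) cs_0"
proof -
  have "\<exists>h. ms = map (map h) cs_0" if ms: "chain [] (u @ (Cap, i) # (Cup, i) # v) ms []"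
    for ms :: "bool list list"
  proof -
    obtain mu mr m where m: "ms = mu @ mr" "chain [] u mu m" "chain m ((Cap, i) # (Cup, i) # v) mr []"
      using ms unfolding chain_append by blast
    have "length m = length (a @ [x, y] @ b)" using chain_ok[OF m(2)] chain_ok[OF chain_u] by simp
    then have "i + 2 \<le> length m" using a by simp
    then obtain am pq bm where 1: "m = am @ pq @ bm" "length am = i" "length pq = 2" by (rule split_at)
    then obtain p q where pq: "pq = [p, q]" by (auto simp: length_123)
    have mm: "m = am @ p # q # bm" using 1 pq by simp
    from m(3) obtain mv p' where 2: "p = q" "mr = (am @ bm) # (am @ p' # p' # bm) # mv"
      "chain (am @ p' # p' # bm) v mv []"
      unfolding mm by (auto simp del: chain.simps(2) simp: chain_simps[OF 1(2)])
    have "p = q \<and> p' = p"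
      by (rule mixed_smoothing[OF chain_u chain_v xy, of mu am p q bm p' p' mv])
        (use m(2) 1 2 a pq in auto)
    then show ?thesis
      using factor[of mu am p bm mv] m 1 2 pq by (auto simp: cs_0_def)
  qed
  then show ?thesis unfolding faithful_def using chain_0 by blast
qed

lemma faithful_Neg: "faithful (u @ (Neg, i) # v) cs"
  using faithful by (simp add: faithful_def chain_Neg_iff)

text \<open>The parts \<open>ru\<close> and \<open>rv\<close> below and above the crossing are
  common to the sublinks of all four diagrams. For the smoothings the selection must treat
  \<open>x\<close> and \<open>y\<close> alike, which is expressed by composition with
  \<open>g\<close>.\<close>

lemma restr_quadruple:
  fixes Q
  defines "ru \<equiv> restr Q [] u cu" and "rv \<equiv> restr Q (a @ [y, x] @ b) v cv" and "k \<equiv> length (filter Q a)"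
  shows "restr Q [] (u @ (p, i) # v) cs = ru @ item Q (a @ [x, y] @ b) (p, i) (a @ [y, x] @ b) @ rv"
    and "Q = Q' \<circ> g \<Longrightarrow> restr Q' [] (u @ v) cs_inf = ru @ rv"
    and "Q = Q' \<circ> g \<Longrightarrow> restr Q' [] (u @ (Cap, i) # (Cup, i) # v) cs_0 =
      ru @ (if Q' x then [(Cap, k), (Cup, k)] else []) @ rv"
proof -
  show "restr Q [] (u @ (p, i) # v) cs = ru @ item Q (a @ [x, y] @ b) (p, i) (a @ [y, x] @ b) @ rv"
    using restr_append[OF chain_u, of Q "(p, i) # v" "(a @ [y, x] @ b) # cv"] by (simp add: cs ru_def rv_def)
  assume Q: "Q = Q' \<circ> g"
  have ru': "restr Q' [] u (map (map g) cu) = ru"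
    using restr_map[OF chain_u, of Q' g] by (simp add: ru_def Q)
  have rv': "restr Q' (map g (a @ [x, y] @ b)) v (map (map g) cv) = rv"
    using restr_map[OF chain_v, of Q' g] by (simp add: rv_def Q)
  show "restr Q' [] (u @ v) cs_inf = ru @ rv"
    using restr_append[OF chain_gu, of Q' v "map (map g) cv"] ru' rv' by (simp add: cs_inf_def)
  have it: "item Q' (map g (a @ [x, y] @ b)) (Cap, i) (map g (a @ b)) @
      item Q' (map g (a @ b)) (Cup, i) (map g (a @ [x, y] @ b)) = (if Q' x then [(Cap, k), (Cup, k)] else [])"
    using item_simps(1)[of "map g a" i Q' "map g b" x] item_simps(3)[of "map g a" i Q' x "map g b"] a by (simp add: k_def Q filter_map)
  show "restr Q' [] (u @ (Cap, i) # (Cup, i) # v) cs_0 =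
      ru @ (if Q' x then [(Cap, k), (Cup, k)] else []) @ rv"
    using restr_append[OF chain_gu, of Q' "(Cap, i) # (Cup, i) # v"
      "[map g (a @ b), map g (a @ [x, y] @ b)] @ map (map g) cv"] ru' rv' it[symmetric]
    by (simp add: cs_0_def)
qed

end

lemma mixed_labelling_exists:
  assumes "link_diagram (u @ (Pos, i) # v)" "mixed_crossing (u @ (Pos, i) # v) (length u)"
    "faithful (u @ (Pos, i) # v) cs"
  obtains cu cv a b x y where "mixed_labelling u v i cs cu cv a b x y"
proof -
  have ch: "chain [] (u @ (Pos, i) # v) cs []" using assms(3) by (simp add: faithful_def)
  then obtain cu c d cv where c: "cs = cu @ d # cv" "chain [] u cu c" "lstep c (Pos, i) d" "chain d v cv []"
    unfolding chain_append by auto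
  from c(3) obtain a b M N where ab: "c = a @ M @ b" "d = a @ N @ b" "length a = i" "loc Pos M N"
    by (rule lstepE)
  then obtain x y where xy: "M = [x, y]" "N = [y, x]" by auto
  have "([] # cs) ! length u = c"
    using chain_end[OF c(2)] chain_length[OF c(2)] c(1) by (cases u) (auto simp: nth_append nth_Cons')
  then have label_at: "label_at cs (length u, i) = x" "label_at cs (length u, Suc i) = y"
    using ab xy by (auto simp: label_at_def nth_append)
  have "(length u, i) \<in> points (u @ (Pos, i) # v)" "(length u, Suc i) \<in> points (u @ (Pos, i) # v)"
    using chain_width[OF ch, of "length u"] \<open>([] # cs) ! length u = c\<close> ab xy by (auto simp: points_def)
  from faithful_label_at[OF assms(3) this] have "x \<noteq> y"
    using assms(2) label_at by (auto simp: mixed_crossing_def)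
  then have "mixed_labelling u v i cs cu cv a b x y"
    using assms(3) c ab xy by unfold_locales auto
  then show ?thesis by (rule that)
qed

section \<open>The closed formula under moves, curls and switches\<close>

context skein_functional
begin

lemma H_move:
  assumes "regular_move x y" "link_diagram (u @ x @ v)" "link_diagram (u @ y @ v)"
  shows "H (u @ x @ v) = H (u @ y @ v)"
proof -
  have "apply_move regular_move (u @ x @ v) (u @ y @ v)"
    unfolding apply_move_def using assms by blast
  then have "regular_isotopic (u @ x @ v) (u @ y @ v)"
    unfolding regular_isotopic_def by (rule r_into_equivclp)
  then show ?thesis using invariant assms(2,3) unfolding regular_isotopy_invariant_def by blast
qed

text \<open>Both diagrams carry the same labels, so the two sums run over the same partitions, and
  each sublink changes by a move or not at all.\<close>

lemma X_move:
  assumes "regular_move x y" "link_diagram (u @ x @ v)" "link_diagram (u @ y @ v)"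
  shows "X_formula H (u @ x @ v) = X_formula H (u @ y @ v)"
proof -
  obtain cs :: "(nat \<times> nat) set list list" where f: "faithful (u @ x @ v) cs"
    using faithful_link[OF assms(2)] by blast
  have am: "ambient_move x y" using assms(1) by (simp add: ambient_move_def)
  have ok: "ok 0 (u @ y @ v)" using assms(3) by (simp add: link_diagram_iff)
  obtain cu cx cy cv c d where c: "cs = cu @ cx @ cv" "chain [] u cu c" "chain c x cx d" "chain c y cy d"
    "chain d v cv []" "faithful (u @ y @ v) (cu @ cy @ cv)" "labels (cu @ cy @ cv) = labels cs"
    "set c \<subseteq> labels cs"
    by (rule faithful_move[OF f disjI1[OF am] ok])
  have ch: "chain [] (u @ x @ v) cs []" "chain [] (u @ y @ v) (cu @ cy @ cv) []"
    using f c(6) by (auto simp: faithful_def)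
  have ne: "labels cs \<noteq> {}" using labels_nonempty[OF ch(1)] assms(2) by (auto simp: link_diagram_iff)
  have eq: "H (restr Q [] (u @ x @ v) cs) = H (restr Q [] (u @ y @ v) (cu @ cy @ cv))"
    if "l \<in> labels cs" "Q l" for Q l
  proof -
    have e: "restr Q [] (u @ z @ v) (cu @ cz @ cv) = restr Q [] u cu @ restr Q c z cz @ restr Q d v cv"
      if "chain c z cz d" for z cz
      by (simp add: restr_append[OF c(2)] restr_append[OF that])
    have "link_diagram (restr Q [] (u @ x @ v) cs)" "link_diagram (restr Q [] (u @ y @ v) (cu @ cy @ cv))"
      using restr_link[OF ch(1), of l Q] restr_link[OF ch(2), of l Q] that c(7) by simp_all
    then show ?thesis
      using restr_move[OF assms(1) c(3,4), of Q]
        H_move[of "restr Q c x cx" "restr Q c y cy" "restr Q [] u cu" "restr Q d v cv"]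
      unfolding c(1) e[OF c(3)] e[OF c(4)] by auto
  qed
  have "psum (labels cs) (\<lambda>B. H (restr (\<lambda>l. l \<in> B) [] (u @ x @ v) cs)) =
    psum (labels cs) (\<lambda>B. H (restr (\<lambda>l. l \<in> B) [] (u @ y @ v) (cu @ cy @ cv)))"
  proof (rule psum_cong)
    fix B assume "B \<subseteq> labels cs" "B \<noteq> {}"
    then obtain l where "l \<in> labels cs" "l \<in> B" by blast
    then show "H (restr (\<lambda>l. l \<in> B) [] (u @ x @ v) cs) = H (restr (\<lambda>l. l \<in> B) [] (u @ y @ v) (cu @ cy @ cv))"
      by (rule eq)
  qed
  then show ?thesis
    using X_formula_eq[OF f ne, of H] X_formula_eq[OF c(6), of H] c(7) ne by simp
qed

lemma X_invariant: "regular_isotopy_invariant (X_formula H)"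
proof -
  have step: "X_formula H L = X_formula H L'" if "apply_move regular_move L L'" for L L'
    using that X_move unfolding apply_move_def by blast
  have "X_formula H L = X_formula H L'" if "regular_isotopic L L'" for L L'
    using that unfolding regular_isotopic_def
    by (induction rule: equivclp_induct) (use step in force)+
  then show ?thesis unfolding regular_isotopy_invariant_def by blast
qed

text \<open>Unlinked knots are given up to ambient isotopy, so (2) has to be carried across curls. A
  curl multiplies both sides of it by the same factor.\<close>

lemma X_curl:
  assumes "positive_curl x \<or> negative_curl x" "link_diagram (u @ x @ v)"
  obtains k where "k = la \<or> k = la_inv" "H (u @ x @ v) = k * H (u @ v)"
    "X_formula H (u @ x @ v) = k * X_formula H (u @ v)"
proof -
  define k where "k = (if positive_curl x then la else la_inv)"
  have curl: "H (u' @ x' @ v') = k * H (u' @ v')"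
    if "link_diagram (u' @ x' @ v')" "positive_curl x \<longrightarrow> positive_curl x'"
      "negative_curl x \<longrightarrow> negative_curl x'" for u' x' v'
    using positive[OF that(1)] negative[OF that(1)] that(2,3) assms(1)
    by (cases "positive_curl x") (simp_all add: k_def)
  obtain cs :: "(nat \<times> nat) set list list" where f: "faithful (u @ x @ v) cs"
    using faithful_link[OF assms(2)] by blast
  have am: "ambient_move x []" using assms(1) by (simp add: ambient_move_def)
  have ok: "ok 0 (u @ [] @ v)"
    using ambient_move_wid[OF am, of "wid 0 u"] assms(2) by (auto simp: link_diagram_iff)
  obtain cu cx cy cv c d where c: "cs = cu @ cx @ cv" "chain [] u cu c" "chain c x cx d" "chain c [] cy d"
    "chain d v cv []" "faithful (u @ [] @ v) (cu @ cy @ cv)" "labels (cu @ cy @ cv) = labels cs"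
    "set c \<subseteq> labels cs"
    by (rule faithful_move[OF f disjI1[OF am] ok])
  have ch: "chain [] (u @ x @ v) cs []" using f by (auto simp: faithful_def)
  have ne: "labels cs \<noteq> {}" using labels_nonempty[OF ch(1)] assms(2) by (auto simp: link_diagram_iff)
  obtain l where l: "l \<in> set c" "\<And>Q. if Q l then (positive_curl x \<longrightarrow> positive_curl (restr Q c x cx)) \<and>
      (negative_curl x \<longrightarrow> negative_curl (restr Q c x cx)) else restr Q c x cx = []"
    using restr_curl[OF assms(1) c(3)] by blast
  have cd: "cy = []" "d = c" using c(4) by auto
  have "psum (labels cs) (\<lambda>B. H (restr (\<lambda>l. l \<in> B) [] (u @ x @ v) cs)) =
    k * psum (labels cs) (\<lambda>B. H (restr (\<lambda>l. l \<in> B) [] (u @ [] @ v) (cu @ cy @ cv)))"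
  proof (rule psum_scale[OF finite_labels])
    show "l \<in> labels cs" using l(1) c(8) by blast
    fix B assume B: "B \<subseteq> labels cs" "B \<noteq> {}"
    let ?Q = "\<lambda>l. l \<in> B"
    have e: "restr ?Q [] (u @ x @ v) cs = restr ?Q [] u cu @ restr ?Q c x cx @ restr ?Q d v cv"
      "restr ?Q [] (u @ [] @ v) (cu @ cy @ cv) = restr ?Q [] u cu @ restr ?Q d v cv"
      using restr_append[OF c(2), of ?Q "x @ v" "cx @ cv"] restr_append[OF c(3), of ?Q v cv]
        restr_append[OF c(2), of ?Q v cv] by (simp_all add: c(1) cd)
    obtain l' where "l' \<in> labels cs" "l' \<in> B" using B by blast
    then have ld: "link_diagram (restr ?Q [] (u @ x @ v) cs)" by (rule restr_link[OF ch])
    show "H (restr ?Q [] (u @ x @ v) cs) = (if l \<in> B then k * H (restr ?Q [] (u @ [] @ v) (cu @ cy @ cv))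
      else H (restr ?Q [] (u @ [] @ v) (cu @ cy @ cv)))"
    proof (cases "l \<in> B")
      case True
      then show ?thesis
        using l(2)[of ?Q] curl[of "restr ?Q [] u cu" "restr ?Q c x cx" "restr ?Q d v cv"] ld
        unfolding e by simp
    next
      case False
      then show ?thesis using l(2)[of ?Q] unfolding e by simp
    qed
  qed
  then have "X_formula H (u @ x @ v) = k * X_formula H (u @ v)"
    using X_formula_eq[OF f ne, of H] X_formula_eq[OF c(6), of H] c(7) ne by (simp add: ac_simps)
  moreover have "H (u @ x @ v) = k * H (u @ v)" using curl[OF assms(2)] by blast
  moreover have "k = la \<or> k = la_inv" by (simp add: k_def)
  ultimately show ?thesis using that by blast
qed

lemma X_mixed_skein: "mixed_skein (X_formula H)"
  unfolding mixed_skein_def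
proof (intro allI impI, elim conjE)
  fix t Lp Lm L0 Linf
  assume q: "conway_quadruple t Lp Lm L0 Linf" and mix: "mixed_crossing Lp t"
  then obtain u i v where L: "t = length u" "Lp = u @ (Pos, i) # v" "Lm = u @ (Neg, i) # v"
    "L0 = u @ (Cap, i) # (Cup, i) # v" "Linf = u @ v" "link_diagram (u @ (Pos, i) # v)"
    unfolding conway_quadruple_def by auto
  obtain cs :: "(nat \<times> nat) set list list" where f: "faithful Lp cs"
    using faithful_link[OF L(6)] L(2) by auto
  then obtain cu cv a b x y where "mixed_labelling u v i cs cu cv a b x y"
    using mixed_labelling_exists[OF L(6)] mix L by metis
  then interpret mixed_labelling u v i cs cu cv a b x y .
  let ?R = "\<lambda>S. \<lambda>l. l \<in> S"
  let ?Fp = "\<lambda>S. H (restr (?R S) [] Lp cs)" and ?Fm = "\<lambda>S. H (restr (?R S) [] Lm cs)"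
    and ?F0 = "\<lambda>S. H (restr (?R S) [] L0 cs_0)" and ?F1 = "\<lambda>S. H (restr (?R S) [] Linf cs_inf)"
  note fL = faithful[folded L(2)] faithful_Neg[folded L(3)] faithful_0[folded L(4)] faithful_inf[folded L(5)]
  have ch: "chain [] Lp cs []" using fL(1) by (simp add: faithful_def)
  note it = item_simps(5)[OF a, of _ _ x y b]
  have "psum (labels cs) ?Fp - psum (labels cs) ?Fm =
      lw * (psum (g ` labels cs) ?F0 - psum (g ` labels cs) ?F1)"
  proof (rule psum_merge[OF finite_labels xy_labels xy g_def])
    fix S assume S: "S \<subseteq> labels cs" "S \<noteq> {}" "\<not> (x \<in> S \<and> y \<in> S)"
    then show "?Fp S = ?Fm S" by (auto simp: L restr_quadruple(1) it)
  next
    fix S assume S: "S \<subseteq> labels cs" "S \<noteq> {}" "x \<notin> S" "y \<notin> S"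
    then have "g l = l" if "l \<in> S" for l using that by (auto simp: g_def)
    then have "x \<notin> g ` S" using S by auto
    moreover have "?R S = ?R (g ` S) \<circ> g"
      using S by (auto simp: g_def image_iff fun_eq_iff split: if_splits)
    ultimately show "?F0 (g ` S) = ?Fp S \<and> ?F1 (g ` S) = ?Fp S"
      using S restr_quadruple(1)[of "?R S" Pos] restr_quadruple(2,3)[of "?R S" "?R (g ` S)"]
      by (simp add: L it)
  next
    fix S assume S: "S \<subseteq> labels cs" "x \<in> S" "y \<in> S"
    then have xg: "x \<in> g ` S" by (auto simp: image_iff intro: bexI[of _ x])
    have R: "?R S = ?R (g ` S) \<circ> g"
      using S by (auto simp: g_def image_iff fun_eq_iff split: if_splits)
    let ?ru = "restr (?R S) [] u cu" and ?rv = "restr (?R S) (a @ [y, x] @ b) v cv"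
      and ?k = "length (filter (?R S) a)"
    have e: "restr (?R S) [] Lp cs = ?ru @ (Pos, ?k) # ?rv" "restr (?R S) [] Lm cs = ?ru @ (Neg, ?k) # ?rv"
      using S by (simp_all add: L restr_quadruple(1) it)
    have e': "restr (?R (g ` S)) [] Linf cs_inf = ?ru @ ?rv"
      "restr (?R (g ` S)) [] L0 cs_0 = ?ru @ (Cap, ?k) # (Cup, ?k) # ?rv"
      using restr_quadruple(2,3)[of "?R S" "?R (g ` S)"] R xg by (simp_all add: L)
    have "link_diagram (restr (?R S) [] Lp cs)" by (rule restr_link[OF ch xy_labels(1)]) (rule S(2))
    then show "?Fp S - ?Fm S = lw * (?F0 (g ` S) - ?F1 (g ` S))"
      unfolding e e' by (rule H_skein)
  qed
  then have d: "psum (labels cs) ?Fp = psum (labels cs) ?Fm +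
      lw * (psum (g ` labels cs) ?F0 - psum (g ` labels cs) ?F1)" by (simp add: algebra_simps)
  have ne: "labels cs \<noteq> {}" "g ` labels cs \<noteq> {}" using xy_labels by auto
  obtain n where n: "card (labels cs) = Suc (Suc n)"
    using card_ge by (metis Suc_le_D numeral_2_eq_2 Suc_le_mono)
  then have n': "card (g ` labels cs) = Suc n" using card_image by simp
  \<comment> \<open>The surplus factor z/w on the left, due to the component lost in the smoothings,
    turns \<open>w\<close> into \<open>z\<close>.\<close>
  have lw: "(lz * lw_inv) * lw = lz" by (simp add: monomial_mult monomial_0)
  have X0: "X_formula H L0 = (lz * lw_inv) ^ n * psum (g ` labels cs) ?F0"
    using X_formula_eq[OF fL(3), of H] ne(2) unfolding labels_0 n' by simp
  have X1: "X_formula H Linf = (lz * lw_inv) ^ n * psum (g ` labels cs) ?F1"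
    using X_formula_eq[OF fL(4), of H] ne(2) unfolding labels_inf n' by simp
  show "X_formula H Lp - X_formula H Lm = lz * (X_formula H L0 - X_formula H Linf)"
  proof -
    let ?D = "psum (g ` labels cs) ?F0 - psum (g ` labels cs) ?F1"
    have "X_formula H Lp - X_formula H Lm = (lz * lw_inv) ^ Suc n * (lw * ?D)"
      using X_formula_eq[OF fL(1) ne(1), of H] X_formula_eq[OF fL(2) ne(1), of H] n d
      by (simp only: diff_Suc_1 right_diff_distrib[symmetric] add_diff_cancel_left')
    also have "\<dots> = ((lz * lw_inv) * lw) * ((lz * lw_inv) ^ n * ?D)"
      by (simp only: power_Suc ac_simps)
    also have "\<dots> = lz * (X_formula H L0 - X_formula H Linf)"
      unfolding X0 X1 by (simp only: lw right_diff_distrib)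
    finally show ?thesis .
  qed
qed

end


section \<open>Unlinked knots and uniqueness\<close>

lemma link_diagram_append: "link_diagram A \<Longrightarrow> link_diagram B \<Longrightarrow> link_diagram (A @ B)"
  by (auto simp: link_diagram_iff)

lemma dubrovnik_skein_functional:
  assumes "dubrovnik T"
  shows "skein_functional T"
proof unfold_locales
  show "regular_isotopy_invariant T" using assms by (simp add: dubrovnik_def)
  show "T Lp - T Lm = lw * (T L0 - T Linf)" if "conway_quadruple t Lp Lm L0 Linf" for t Lp Lm L0 Linf
    using assms that unfolding dubrovnik_def by blast
  show "T (u @ x @ v) = la * T (u @ v)" if "link_diagram (u @ x @ v)" "positive_curl x" for u x v
    using assms that unfolding dubrovnik_def by blast
  show "T (u @ x @ v) = la_inv * T (u @ v)" if "link_diagram (u @ x @ v)" "negative_curl x" for u x v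
    using assms that unfolding dubrovnik_def by blast
qed

lemma T_append:
  assumes T: "dubrovnik T" and A: "link_diagram A" and B: "link_diagram B"
  shows "T (A @ B) = delta * T A * T B"
proof -
  interpret T: skein_functional T by (rule dubrovnik_skein_functional[OF T])
  let ?O = "[(Cup, 0), (Cap, 0)] :: slices"
  \<comment> \<open>For fixed \<open>B\<close> this is linear in values of \<open>T\<close> and
    inherits its relations; it vanishes on the unknot because \<open>T ?O = 1\<close>. The factor
    \<open>T (?O @ B)\<close> belongs to a circle beside \<open>B\<close>, hence equals \<delta>
    times \<open>T B\<close>.\<close>
  define H where "H L = T (L @ B) - T L * T (?O @ B)" for L
  have iso: "regular_isotopic (L @ B) (L' @ B)" if "regular_isotopic L L'" for L L'
  proof -
    have move: "apply_move regular_move (y @ B) (z @ B)" if m: "apply_move regular_move y z" for y z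
    proof -
      from m obtain u x x' v where "y = u @ x @ v" "z = u @ x' @ v" "regular_move x x'"
        "link_diagram y" "link_diagram z" unfolding apply_move_def by blast
      then show ?thesis unfolding apply_move_def
        using B link_diagram_append by (metis append_assoc)
    qed
    show ?thesis using that unfolding regular_isotopic_def
    proof (induction rule: equivclp_induct)
      case (step y z)
      then show ?case using move by (meson equivclp_into_equivclp)
    qed simp
  qed
  interpret H: skein_functional H
  proof unfold_locales
    show "regular_isotopy_invariant H"
      using T.invariant iso link_diagram_append[OF _ B]
      unfolding regular_isotopy_invariant_def H_def by metis
    fix t Lp Lm L0 Linf assume q: "conway_quadruple t Lp Lm L0 Linf"
    then have "conway_quadruple t (Lp @ B) (Lm @ B) (L0 @ B) (Linf @ B)"
      using B link_diagram_append unfolding conway_quadruple_def by fastforce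
    note * = T.skein[OF this] T.skein[OF q]
    have "H Lp - H Lm = (T (Lp @ B) - T (Lm @ B)) - (T Lp - T Lm) * T (?O @ B)"
      unfolding H_def by (simp only: left_diff_distrib) simp
    also have "\<dots> = lw * (H L0 - H Linf)"
      unfolding * H_def by (simp add: algebra_simps)
    finally show "H Lp - H Lm = lw * (H L0 - H Linf)" .
  next
    fix u x v assume l: "link_diagram (u @ x @ v)" and x: "positive_curl x"
    then have "link_diagram (u @ x @ (v @ B))" using link_diagram_append[OF l B] by simp
    from T.positive[OF this x] T.positive[OF l x] show "H (u @ x @ v) = la * H (u @ v)"
      unfolding H_def by (simp add: algebra_simps)
  next
    fix u x v assume l: "link_diagram (u @ x @ v)" and x: "negative_curl x"
    then have "link_diagram (u @ x @ (v @ B))" using link_diagram_append[OF l B] by simp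
    from T.negative[OF this x] T.negative[OF l x] show "H (u @ x @ v) = la_inv * H (u @ v)"
      unfolding H_def by (simp add: algebra_simps)
  qed
  have "T ?O = 1" using T by (simp add: dubrovnik_def)
  then have "H ?O = 0" by (simp add: H_def)
  from H.vanishes[OF this A] have "T (A @ B) = T A * T (?O @ B)" by (simp add: H_def)
  moreover have "T (?O @ B) = delta * T B"
    using T.H_circle[of "[]" 0 B] link_diagram_append[of ?O B] B by (simp add: link_diagram_iff)
  ultimately show ?thesis by (simp add: ac_simps)
qed

lemma T_concat:
  assumes "dubrovnik T" "Ks \<noteq> []" "\<And>K. K \<in> set Ks \<Longrightarrow> link_diagram K"
  shows "T (concat Ks) = delta ^ (length Ks - 1) * prod_list (map T Ks) \<and> link_diagram (concat Ks)"
  using assms(2,3)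
proof (induction Ks rule: list_nonempty_induct)
  case (cons K Ks)
  then have IH: "T (concat Ks) = delta ^ (length Ks - 1) * prod_list (map T Ks)" "link_diagram (concat Ks)"
    and K: "link_diagram K" by auto
  have "delta ^ length Ks = delta * delta ^ (length Ks - 1)"
    using cons(1) by (cases Ks) simp_all
  then show ?case using T_append[OF assms(1) K IH(2)] IH link_diagram_append[OF K IH(2)]
    by (simp add: ac_simps)
qed simp

lemma restr_all:
  "chain c L cs e \<Longrightarrow> (\<And>l. l \<in> set c \<union> labels cs \<Longrightarrow> Q l) \<Longrightarrow> restr Q c L cs = L"
proof (induction L arbitrary: c cs)
  case (Cons s L)
  from Cons.prems(1) obtain p i d ds a b M N where s: "s = (p, i)"
    and d: "cs = d # ds" "lstep c s d" "chain d L ds e"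
    and ab: "c = a @ M @ b" "d = a @ N @ b" "length a = i" "loc p M N" by (rule chain_ConsE)
  have Q: "\<And>l. l \<in> set c \<Longrightarrow> Q l" "\<And>l. l \<in> set d \<union> labels ds \<Longrightarrow> Q l"
    using Cons.prems(2) by (auto simp: d labels_append)
  have "list_all Q M \<and> list_all Q N" using Q ab by (auto simp: list_all_iff)
  moreover have "filter Q a = a" using Q(1) ab by (intro filter_True) auto
  ultimately have "item Q c s d = [s]" using item_keep[OF ab(4), of Q a b] ab s by simp
  then show ?case using Cons.IH[OF d(3) Q(2)] by (simp add: d)
qed simp

lemma restr_none:
  "chain c L cs e \<Longrightarrow> (\<And>l. l \<in> set c \<union> labels cs \<Longrightarrow> \<not> Q l) \<Longrightarrow> restr Q c L cs = []"
proof (induction L arbitrary: c cs)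
  case (Cons s L)
  from Cons.prems(1) obtain p i d ds a b M N where s: "s = (p, i)"
    and d: "cs = d # ds" "lstep c s d" "chain d L ds e"
    and ab: "c = a @ M @ b" "d = a @ N @ b" "length a = i" "loc p M N" by (rule chain_ConsE)
  have Q: "\<And>l. l \<in> set c \<Longrightarrow> \<not> Q l" "\<And>l. l \<in> set d \<union> labels ds \<Longrightarrow> \<not> Q l"
    using Cons.prems(2) by (auto simp: d labels_append)
  have "\<not> (list_all Q M \<and> list_all Q N)"
    using Q(1)[of "hd M"] Q(2)[of "hd N"] ab by (cases p) auto
  then have "item Q c s d = []" using item_skip[OF ab(4), of Q a b] ab s by simp
  then show ?case using Cons.IH[OF d(3) Q(2)] by (simp add: d)
qed simp

lemma chain_mid_Nil:
  assumes "chain [] (A @ B) cs []" "wid 0 A = 0"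
  obtains ca cb where "cs = ca @ cb" "chain [] A ca []" "chain [] B cb []"
proof -
  obtain ca cb c where c: "cs = ca @ cb" "chain [] A ca c" "chain c B cb []"
    using assms(1) unfolding chain_append by blast
  have "c = []" using chain_ok[OF c(2)] assms(2) by simp
  with c show ?thesis using that by blast
qed

text \<open>A labelling of a disjoint union consists of two independent ones, and their factors fit
  together because the label sets are disjoint.\<close>

lemma faithful_append:
  assumes "faithful A ca" "faithful B cb" "labels ca \<inter> labels cb = {}"
  shows "faithful (A @ B) (ca @ cb)"
proof -
  have ch: "chain [] A ca []" "chain [] B cb []" using assms by (auto simp: faithful_def)
  have "\<exists>g. ms = map (map g) (ca @ cb)" if ms: "chain [] (A @ B) ms []" for ms :: "bool list list"
  proof -
    have "wid 0 A = 0" using chain_ok[OF ch(1)] by simp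
    then obtain ma mb where m: "ms = ma @ mb" "chain [] A ma []" "chain [] B mb []"
      by (rule chain_mid_Nil[OF ms])
    obtain ga gb where g: "ma = map (map ga) ca" "mb = map (map gb) cb"
      using m assms(1,2) unfolding faithful_def by blast
    define h where "h l = (if l \<in> labels ca then ga l else gb l)" for l
    have "map (map ga) ca = map (map h) ca" by (auto simp: h_def labels_def)
    moreover have "l \<notin> labels ca" if "l \<in> labels cb" for l using assms(3) that by blast
    then have "map (map gb) cb = map (map h) cb" by (auto simp: h_def labels_def)
    ultimately show ?thesis using m(1) g by (intro exI[of _ h]) simp
  qed
  with chain_appendI[OF ch] show ?thesis unfolding faithful_def by blast
qed

lemma faithful_knot:
  assumes "knot_diagram K"
  shows "faithful K (chain_of K (\<lambda>_. j)) \<and> labels (chain_of K (\<lambda>_. j)) = {j}"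
proof -
  have K: "ok 0 K" "wid 0 K = 0" "K \<noteq> []" using assms by (auto simp: knot_diagram_def link_diagram_iff)
  have ch: "chain [] K (chain_of K (\<lambda>_. j)) []" by (rule chain_chain_of[OF K(1,2)]) simp
  obtain C where C: "components K = {C}"
    using assms by (auto simp: knot_diagram_def card_1_singleton_iff)
  have same: "(x, y) \<in> same_component K" if "x \<in> points K" "y \<in> points K" for x y
  proof -
    have "same_component K `` {x} \<in> components K" "same_component K `` {y} \<in> components K"
      using that by (auto simp: components_def intro: quotientI)
    then have "same_component K `` {x} = same_component K `` {y}" using C by simp
    then show ?thesis using eq_equiv_class[OF _ equiv_same_component] that(2) by blast
  qed
  have "\<exists>g. ms = map (map g) (chain_of K (\<lambda>_. j))" if "chain [] K ms []" for ms :: "bool list list"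
    by (rule factor_chain[OF ch that]) (rule same_component_label_at[OF that same])
  moreover have "labels (chain_of K (\<lambda>_. j)) = {j}"
    using labels_nonempty[OF ch K(3)] by (auto simp: labels_def chain_of_def)
  ultimately show ?thesis unfolding faithful_def using ch by blast
qed

text \<open>Each knot is labelled by its position in the list, so sublinks are concatenations over
  sets of indices even if a diagram occurs several times.\<close>

definition const_chain :: "(nat \<Rightarrow> slices) \<Rightarrow> nat list \<Rightarrow> nat list list" where
  "const_chain K js = concat (map (\<lambda>j. chain_of (K j) (\<lambda>_. j)) js)"

lemma const_chain:
  assumes "distinct js" "\<And>j. j \<in> set js \<Longrightarrow> knot_diagram (K j)"
  shows "faithful (concat (map K js)) (const_chain K js) \<and> labels (const_chain K js) = set js \<and>
    restr Q [] (concat (map K js)) (const_chain K js) = concat (map K (filter Q js))"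
  using assms
proof (induction js)
  case Nil
  have "faithful [] ([] :: nat list list)" by (simp add: faithful_def)
  then show ?case by (simp add: const_chain_def labels_def)
next
  case (Cons j js)
  let ?c = "chain_of (K j) (\<lambda>_. j)"
  from Cons have IH: "faithful (concat (map K js)) (const_chain K js)"
    "labels (const_chain K js) = set js"
    "restr Q [] (concat (map K js)) (const_chain K js) = concat (map K (filter Q js))" by auto
  have k: "faithful (K j) ?c" "labels ?c = {j}" using faithful_knot[of "K j" j] Cons.prems(2) by auto
  have e: "const_chain K (j # js) = ?c @ const_chain K js" by (simp add: const_chain_def)
  have ch: "chain [] (K j) ?c []" using k(1) by (simp add: faithful_def)
  have "restr Q [] (K j) ?c = (if Q j then K j else [])"
    using restr_all[OF ch, of Q] restr_none[OF ch, of Q] k(2) by auto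
  then have "restr Q [] (K j @ concat (map K js)) (?c @ const_chain K js) =
      concat (map K (filter Q (j # js)))"
    using restr_append[OF ch, of Q] IH(3) by simp
  moreover have "faithful (K j @ concat (map K js)) (?c @ const_chain K js)"
    by (rule faithful_append[OF k(1) IH(1)]) (use k(2) IH(2) Cons.prems(1) in auto)
  ultimately show ?case unfolding e by (simp add: labels_append k(2) IH(2))
qed

lemma X_concat:
  assumes T: "dubrovnik T" and Ks: "Ks \<noteq> []" "\<And>K. K \<in> set Ks \<Longrightarrow> knot_diagram K"
  shows "X_formula T (concat Ks) = lE_inv ^ (length Ks - 1) * T (concat Ks)"
proof -
  define r where "r = length Ks"
  define K where "K j = Ks ! j" for j
  let ?js = "[0..<r]"
  have "map K ?js = Ks" unfolding K_def r_def by (rule map_nth)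
  then have Keq: "concat Ks = concat (map K ?js)" by simp
  have kn: "knot_diagram (K j)" if "j \<in> set ?js" for j using that Ks by (simp add: K_def r_def)
  note c = const_chain[of ?js K, OF distinct_upt kn]
  have r: "r \<noteq> 0" using Ks by (simp add: r_def)
  have F: "T (concat (map K (filter Q ?js))) = delta ^ (card {j\<in>set ?js. Q j} - 1) * (\<Prod>j | j \<in> set ?js \<and> Q j. T (K j))"
    if "\<exists>j\<in>set ?js. Q j" for Q
  proof -
    let ?f = "filter Q ?js"
    have "map K ?f \<noteq> []" using that by (auto simp: filter_empty_conv)
    moreover have "link_diagram L" if "L \<in> set (map K ?f)" for L
      using that kn by (auto simp: knot_diagram_def)
    ultimately have "T (concat (map K ?f)) = delta ^ (length (map K ?f) - 1) * prod_list (map T (map K ?f))"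
      using T_concat[OF T] by blast
    moreover have "distinct ?f" by simp
    then have "prod_list (map (\<lambda>j. T (K j)) ?f) = (\<Prod>j\<in>set ?f. T (K j))"
      by (rule prod.distinct_set_conv_list[symmetric])
    moreover have "length ?f = card (set ?f)" using \<open>distinct ?f\<close> by (rule distinct_card[symmetric])
    ultimately show ?thesis by (simp add: comp_def set_filter del: set_upt)
  qed
  have ps: "psum (set ?js) (\<lambda>B. T (restr (\<lambda>l. l \<in> B) [] (concat Ks) (const_chain K ?js))) =
      Ehat_inv ^ (card (set ?js) - 1) * delta ^ (card (set ?js) - 1) * (\<Prod>j\<in>set ?js. T (K j))"
  proof (rule psum_split)
    fix S assume S: "S \<subseteq> set ?js" "S \<noteq> {}"
    then have "{j \<in> set ?js. j \<in> S} = S" by blast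
    moreover have "\<exists>j\<in>set ?js. j \<in> S" using S by blast
    ultimately show "T (restr (\<lambda>l. l \<in> S) [] (concat Ks) (const_chain K ?js)) =
        delta ^ (card S - 1) * (\<Prod>j\<in>S. T (K j))"
      using F[of "\<lambda>j. j \<in> S"] c Keq by simp
  qed (use r in auto)
  have Tc: "T (concat Ks) = delta ^ (r - 1) * (\<Prod>j\<in>set ?js. T (K j))"
  proof -
    have "{j. j < r} = {0..<r}" by auto
    then show ?thesis using F[of "\<lambda>_. True"] r Keq by auto
  qed
  have label_at: "labels (const_chain K ?js) = set ?js" and fa: "faithful (concat Ks) (const_chain K ?js)"
    using c Keq by auto
  have ne: "labels (const_chain K ?js) \<noteq> {}" unfolding label_at using r by simp
  \<comment> \<open>This cancellation is the reason for the normalisation of Ehat: z/w times its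
    inverse is the inverse of E.\<close>
  have E: "lz * lw_inv * Ehat_inv = lE_inv" by (simp add: Ehat_inv_def monomial_mult)
  have "X_formula T (concat Ks) = (lz * lw_inv) ^ (r - 1) * (Ehat_inv ^ (r - 1) * delta ^ (r - 1) * (\<Prod>j\<in>set ?js. T (K j)))"
    using X_formula_eq[OF fa ne, of T] ps unfolding label_at by simp
  also have "\<dots> = (lz * lw_inv * Ehat_inv) ^ (r - 1) * (delta ^ (r - 1) * (\<Prod>j\<in>set ?js. T (K j)))"
    by (simp only: power_mult_distrib ac_simps)
  finally show ?thesis unfolding E Tc r_def .
qed

lemma X_unlinked:
  assumes T: "dubrovnik T"
  shows "unlinked_values T (X_formula T)"
  unfolding unlinked_values_def
proof (intro allI impI, elim conjE)
  fix r L assume r: "r \<ge> 1" and "unlinked_knots r L"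
  then obtain Ks where Ks: "length Ks = r" "\<And>K. K \<in> set Ks \<Longrightarrow> knot_diagram K"
    "ambient_isotopic L (concat Ks)" unfolding unlinked_knots_def by blast
  interpret T: skein_functional T by (rule dubrovnik_skein_functional[OF T])
  let ?P = "\<lambda>L. X_formula T L = lE_inv ^ (r - 1) * T L"
  have step: "?P L \<longleftrightarrow> ?P L'" if m: "apply_move ambient_move L L'" for L L'
  proof -
    from m obtain u x y v where l: "link_diagram L" "link_diagram L'" "L = u @ x @ v" "L' = u @ y @ v"
      "ambient_move x y" unfolding apply_move_def by blast
    from l(5) consider "regular_move x y" | "positive_curl x \<or> negative_curl x" "y = []"
      unfolding ambient_move_def by blast
    then show ?thesis
    proof cases
      case 1
      then show ?thesis using T.X_move[OF 1, of u v] T.H_move[OF 1, of u v] l by simp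
    next
      case 2
      have "link_diagram (u @ x @ v)" using l by simp
      then obtain k where k: "k = la \<or> k = la_inv" "T (u @ x @ v) = k * T (u @ v)"
        "X_formula T (u @ x @ v) = k * X_formula T (u @ v)"
        by (rule T.X_curl[OF 2(1)])
      \<comment> \<open>The factor of a curl is a unit, so that (2) can be transferred in both
        directions.\<close>
      obtain k' where k': "k' * k = 1" using k(1) T.variable_inverses(1) by (metis mult.commute)
      have "?P L \<longleftrightarrow> k * X_formula T L' = k * (lE_inv ^ (r - 1) * T L')"
        unfolding l(3,4) 2(2) append_Nil k(2,3) by (simp only: mult.left_commute)
      also have "\<dots> \<longleftrightarrow> ?P L'"
      proof
        assume "k * X_formula T L' = k * (lE_inv ^ (r - 1) * T L')"
        then have "(k' * k) * X_formula T L' = (k' * k) * (lE_inv ^ (r - 1) * T L')"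
          by (simp only: mult.assoc)
        then show "?P L'" by (simp only: k' mult_1)
      qed simp
      finally show ?thesis .
    qed
  qed
  have "?P L \<longleftrightarrow> ?P (concat Ks)"
    using Ks(3) unfolding ambient_isotopic_def
    by (induction rule: equivclp_induct) (use step in blast)+
  moreover have "Ks \<noteq> []" using Ks(1) r by auto
  then have "?P (concat Ks)" using X_concat[OF T _ Ks(2)] Ks(1) by simp
  ultimately show "?P L" by blast
qed

section \<open>Counting components\<close>

lemma card_components_ge:
  assumes "chain [] L cs []"
  shows "card (labels cs) \<le> card (components L)"
proof -
  obtain cs0 :: "(nat \<times> nat) set list list" where f: "faithful L cs0"
    using faithful_exists chain_ok[OF assms] by auto
  obtain g where "cs = map (map g) cs0" using faithful_factor[OF f assms] by blast
  then show ?thesis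
    unfolding card_components[OF f] by (simp add: labels_map card_image_le finite_labels)
qed

lemma card_components_append:
  assumes "ok 0 A" "wid 0 A = 0" "ok 0 B" "wid 0 B = 0"
  shows "card (components (A @ B)) = card (components A) + card (components B)"
proof -
  obtain ca cb :: "(nat \<times> nat) set list list" where f: "faithful A ca" "faithful B cb"
    using faithful_exists assms by blast
  have inj: "inj_on Inl X" "inj_on Inr Y" for X Y :: "(nat \<times> nat) set set" by auto
  define a where "a = map (map (Inl :: _ \<Rightarrow> (nat \<times> nat) set + (nat \<times> nat) set)) ca"
  define b where "b = map (map (Inr :: _ \<Rightarrow> (nat \<times> nat) set + (nat \<times> nat) set)) cb"
  have d: "labels a \<inter> labels b = {}" by (auto simp: labels_map a_def b_def)
  have "faithful (A @ B) (a @ b)"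
    using faithful_append[OF _ _ d] faithful_map[OF f(1) inj(1)] faithful_map[OF f(2) inj(2)]
    by (simp add: a_def b_def)
  from card_components[OF this] have "card (components (A @ B)) = card (labels a \<union> labels b)"
    by (simp add: labels_append)
  also have "\<dots> = card (labels a) + card (labels b)"
    by (rule card_Un_disjoint[OF finite_labels finite_labels d])
  also have "\<dots> = card (components A) + card (components B)"
    unfolding a_def b_def labels_map card_components[OF f(1)] card_components[OF f(2)] by (simp add: card_image)
  finally show ?thesis .
qed

lemma card_components_regular:
  assumes "regular_isotopic L L'"
  shows "card (components L) = card (components L')"
proof -
  have step: "card (components L) = card (components L')" if m: "apply_move regular_move L L'" for L L'
  proof -
    from m obtain u x y v where l: "link_diagram L" "link_diagram L'" "L = u @ x @ v" "L' = u @ y @ v"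
      "regular_move x y" unfolding apply_move_def by blast
    obtain cs :: "(nat \<times> nat) set list list" where f: "faithful (u @ x @ v) cs"
      using faithful_link[OF l(1)] l(3) by auto
    have am: "ambient_move x y" using l(5) by (simp add: ambient_move_def)
    have ok: "ok 0 (u @ y @ v)" using l(2,4) by (simp add: link_diagram_iff)
    show ?thesis
      using f by (rule faithful_move[OF _ disjI1[OF am] ok]) (simp add: card_components l(3,4) f card_components[OF f])
  qed
  show ?thesis using assms unfolding regular_isotopic_def
    by (induction rule: equivclp_induct) (use step in force)+
qed

lemma (in mixed_labelling) mixed: "mixed_crossing (u @ (Pos, i) # v) (length u)"
proof -
  have ch: "chain [] (u @ (Pos, i) # v) cs []" using faithful by (simp add: faithful_def)
  have "([] # cs) ! length u = a @ [x, y] @ b"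
    using chain_end[OF chain_u] chain_length[OF chain_u] cs by (cases u) (auto simp: nth_append nth_Cons')
  then have "label_at cs (length u, i) = x" "label_at cs (length u, Suc i) = y"
    using a by (auto simp: label_at_def nth_append)
  then have "((length u, i), (length u, Suc i)) \<notin> same_component (u @ (Pos, i) # v)"
    using same_component_label_at[OF ch] xy by metis
  then show ?thesis by (auto simp: mixed_crossing_def)
qed

text \<open>A slice belongs to at most one of the two layers; crossings between the layers belong to
  neither.\<close>

lemma restr_length: "chain c L cs e \<Longrightarrow>
  length (restr Q c L cs) + length (restr (\<lambda>l. \<not> Q l) c L cs) \<le> length L"
proof (induction L arbitrary: c cs)
  case (Cons s L)
  from Cons.prems(1) obtain p i d ds a b M N where s: "s = (p, i)"
    and d: "cs = d # ds" "lstep c s d" "chain d L ds e"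
    and ab: "c = a @ M @ b" "d = a @ N @ b" "length a = i" "loc p M N" by (rule chain_ConsE)
  have "\<not> (keep Q c s d \<and> keep (\<lambda>l. \<not> Q l) c s d)"
    unfolding s ab keep_loc[OF ab(4) ab(3)] using ab(4) by (cases p) auto
  then have "length (item Q c s d) + length (item (\<lambda>l. \<not> Q l) c s d) \<le> 1"
    by (auto simp: item_def)
  then show ?case using Cons.IH[OF d(3)] by (simp add: d)
qed simp

section \<open>Uniqueness from the mixed skein relation\<close>

locale mixed_skein_vanishing =
  fixes Z :: "slices \<Rightarrow> laurent"
  assumes inv: "regular_isotopy_invariant Z" and mixed_skein: "mixed_skein Z"
    and unlinked: "\<And>r L. r \<ge> 1 \<Longrightarrow> unlinked_knots r L \<Longrightarrow> Z L = 0"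
begin

lemma Z_switch:
  assumes f: "faithful (A @ (p, i) # L) (ca @ d # cs)"
    and ch: "chain [] A ca c" "lstep c (p, i) d" "chain d L cs []"
    and less: "\<And>L'. link_diagram L' \<Longrightarrow> card (components L') < card (labels (ca @ d # cs)) \<Longrightarrow> Z L' = 0"
    and pq: "p \<in> {Pos, Neg}" "q \<in> {Pos, Neg}" and ne: "c ! i \<noteq> c ! Suc i"
  shows "Z (A @ (p, i) # L) = Z (A @ (q, i) # L)"
proof -
  have fp: "faithful (A @ (Pos, i) # L) (ca @ d # cs)"
    using f pq(1) by (auto simp: faithful_def chain_Neg_iff)
  from ch(2) obtain a b M N where ab: "c = a @ M @ b" "d = a @ N @ b" "length a = i" "loc p M N"
    by (rule lstepE)
  then obtain x y where xy: "M = [x, y]" "N = [y, x]" using pq(1) by auto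
  have "x \<noteq> y" using ne ab xy by (auto simp: nth_append)
  then interpret m: mixed_labelling A L i "ca @ d # cs" ca cs a b x y
    using fp ch ab xy by unfold_locales auto
  have ld: "link_diagram (A @ (Pos, i) # L)"
    unfolding link_diagram_iff
    using chain_ok[of "[]" "A @ (Pos, i) # L" "ca @ d # cs" "[]"] fp by (simp only: faithful_def) simp
  have "Z (A @ (Cap, i) # (Cup, i) # L) = 0"
  proof (rule less)
    show "link_diagram (A @ (Cap, i) # (Cup, i) # L)"
      using chain_ok[OF m.chain_0] by (simp add: link_diagram_iff)
  qed (use card_components[OF m.faithful_0] m.labels_0 m.card_image m.card_ge in simp)
  moreover have "Z (A @ L) = 0"
  proof (rule less)
    have "labels m.cs_inf \<noteq> {}" using m.labels_inf m.xy_labels by auto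
    then have "A @ L \<noteq> []" using m.chain_inf by (auto simp: labels_def)
    then show "link_diagram (A @ L)"
      using chain_ok[OF m.chain_inf] by (simp add: link_diagram_iff)
  qed (use card_components[OF m.faithful_inf] m.labels_inf m.card_image m.card_ge in simp)
  moreover have "conway_quadruple (length A) (A @ (Pos, i) # L) (A @ (Neg, i) # L)
      (A @ (Cap, i) # (Cup, i) # L) (A @ L)"
    using ld by (auto simp: conway_quadruple_def)
  ultimately have "Z (A @ (Pos, i) # L) - Z (A @ (Neg, i) # L) = 0"
    using mixed_skein m.mixed unfolding mixed_skein_def by fastforce
  then show ?thesis using pq by auto
qed

text \<open>Crossings are switched from bottom to top, \<open>A\<close> being the part already
  treated. A switch does not affect the labels, so the same \<open>cs\<close> serves
  throughout.\<close>

lemma Z_stack: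
  assumes "faithful (A @ L) (ca @ cs)" "chain [] A ca c" "chain c L cs []"
    and "\<And>L'. link_diagram L' \<Longrightarrow> card (components L') < card (labels (ca @ cs)) \<Longrightarrow> Z L' = 0"
  shows "\<exists>L'. faithful (A @ L') (ca @ cs) \<and> chain c L' cs [] \<and> stacked Q c L' cs \<and>
    length L' = length L \<and> Z (A @ L') = Z (A @ L)"
  using assms
proof (induction L arbitrary: A ca c cs)
  case Nil
  then show ?case by (intro exI[of _ "[]"]) simp
next
  case (Cons s L)
  obtain p i where s: "s = (p, i)" by force
  from Cons.prems(3) obtain d ds where d: "cs = d # ds" "lstep c (p, i) d" "chain d L ds []"
    by (auto simp: s)
  \<comment> \<open>A crossing between the layers receives the type in which its selected strand is
    the upper one; all other pieces stay.\<close>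
  define q where "q = (if p \<in> {Pos, Neg} \<and> Q (c ! i) \<noteq> Q (c ! Suc i)
    then (if Q (c ! i) then Neg else Pos) else p)"
  have f: "faithful (A @ (p, i) # L) (ca @ d # ds)" using Cons.prems(1) by (simp add: s d)
  have less: "\<And>L'. link_diagram L' \<Longrightarrow> card (components L') < card (labels (ca @ d # ds)) \<Longrightarrow> Z L' = 0"
    using Cons.prems(4) by (simp add: d)
  have Z: "Z (A @ (p, i) # L) = Z (A @ (q, i) # L)"
  proof (cases "q = p")
    case False
    then have "p \<in> {Pos, Neg}" "q \<in> {Pos, Neg}" "Q (c ! i) \<noteq> Q (c ! Suc i)"
      by (auto simp: q_def split: if_splits)
    then show ?thesis
      using Z_switch[OF f Cons.prems(2) d(2,3) less] by metis
  qed simp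
  have fq: "faithful (A @ (q, i) # L) (ca @ d # ds)"
    using f by (auto simp: q_def faithful_def chain_Neg_iff split: if_splits)
  have "lstep c (Neg, i) d \<longleftrightarrow> lstep c (Pos, i) d" by (simp add: lstep_def)
  then have st: "lstep c (q, i) d" using d(2) by (auto simp: q_def)
  have "faithful ((A @ [(q, i)]) @ L) ((ca @ [d]) @ ds)" using fq by simp
  moreover have "chain [] (A @ [(q, i)]) (ca @ [d]) d"
    by (rule chain_appendI[OF Cons.prems(2)]) (use st in simp)
  moreover have "\<And>L'. link_diagram L' \<Longrightarrow> card (components L') < card (labels ((ca @ [d]) @ ds)) \<Longrightarrow> Z L' = 0"
    using less by simp
  ultimately obtain L' where L': "faithful ((A @ [(q, i)]) @ L') ((ca @ [d]) @ ds)" "chain d L' ds []"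
    "stacked Q d L' ds" "length L' = length L" "Z ((A @ [(q, i)]) @ L') = Z ((A @ [(q, i)]) @ L)"
    using Cons.IH[of "A @ [(q, i)]" "ca @ [d]" ds d] d(3) by blast
  have "stacked Q c ((q, i) # L') cs" using L'(3) by (auto simp: d q_def)
  then show ?case
    using L' st Z by (intro exI[of _ "(q, i) # L'"]) (auto simp: d s)
qed

text \<open>\<open>Ks\<close> are the knots already pulled off and \<open>R\<close> is the rest. The
  induction is on the number of slices of \<open>R\<close>: each slice goes to at most one of
  \<open>K\<close> and \<open>B\<close>, and \<open>K\<close> is not empty, so the new rest
  \<open>B\<close> is shorter.\<close>

lemma Z_split:
  assumes less: "\<And>L'. link_diagram L' \<Longrightarrow> card (components L') < n \<Longrightarrow> Z L' = 0"
  shows "link_diagram (concat Ks @ R) \<Longrightarrow> (\<And>K. K \<in> set Ks \<Longrightarrow> knot_diagram K) \<Longrightarrow> ok 0 R \<Longrightarrow> wid 0 R = 0 \<Longrightarrow>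
    card (components (concat Ks @ R)) = n \<Longrightarrow> Z (concat Ks @ R) = 0"
proof (induction "length R" arbitrary: R Ks rule: less_induct)
  case less': less
  let ?A = "concat Ks"
  show ?case
  proof (cases "R = []")
    case True
    then have "unlinked_knots (length Ks) (concat Ks)"
      using less'.prems unfolding unlinked_knots_def ambient_isotopic_def by auto
    moreover have "length Ks \<ge> 1" using less'.prems(1) True by (cases Ks) (auto simp: link_diagram_iff)
    ultimately show ?thesis using unlinked True by simp
  next
    case False
    have wA: "wid 0 ?A = 0" "ok 0 ?A"
    proof -
      have "ok 0 (concat Ks) \<and> wid 0 (concat Ks) = 0"
        using less'.prems(2) by (induction Ks) (auto simp: knot_diagram_def link_diagram_iff)
      then show "wid 0 ?A = 0" "ok 0 ?A" by auto
    qed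
    obtain cs0 :: "(nat \<times> nat) set list list" where f: "faithful (?A @ R) cs0"
      using faithful_link[OF less'.prems(1)] by blast
    then have "chain [] (?A @ R) cs0 []" by (simp add: faithful_def)
    then obtain ca cs where c: "cs0 = ca @ cs" "chain [] ?A ca []" "chain [] R cs []"
      using wA(1) by (rule chain_mid_Nil)
    have n: "card (labels (ca @ cs)) = n" using card_components[OF f] less'.prems(5) c by simp
    obtain l where l: "l \<in> labels cs" using labels_nonempty[OF c(3) False] by blast
    let ?Q = "\<lambda>k. k = l"
    have "\<And>L'. link_diagram L' \<Longrightarrow> card (components L') < card (labels (ca @ cs)) \<Longrightarrow> Z L' = 0"
      using less unfolding n .
    from Z_stack[OF f[unfolded c(1)] c(2,3) this, where Q = ?Q] obtain R' where
      R': "faithful (?A @ R') (ca @ cs)" "chain [] R' cs []" "stacked ?Q [] R' cs" "length R' = length R"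
        "Z (?A @ R') = Z (?A @ R)" by blast
    have "R' \<noteq> []" using R'(4) False by auto
    then have lR': "link_diagram R'" "link_diagram (?A @ R')"
      using chain_ok[OF R'(2)] wA by (auto simp: link_diagram_iff)
    define K where "K = restr ?Q [] R' cs"
    define B where "B = restr (\<lambda>k. \<not> ?Q k) [] R' cs"
    have sep: "req 0 R' (K @ B)" using separate[OF R'(2,3)] by (simp add: K_def B_def)
    have K: "link_diagram K" unfolding K_def by (rule restr_link[OF R'(2) l]) simp
    have B: "ok 0 B" "wid 0 B = 0" using restr_ok[OF R'(2)] by (auto simp: B_def)
    have "card (components R') = card (components K) + card (components B)"
      using card_components_regular[of R' "K @ B"] req_regular[OF sep lR'(1)] card_components_append[of K B] K B
      by (auto simp: link_diagram_iff)
    moreover have fR: "faithful R' cs"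
    proof -
      \<comment> \<open>The labelling of the rest is extended by the constant \<open>False\<close>
        over the knots below it and then factored.\<close>
      have "\<exists>g. ms = map (map g) cs" if ms: "chain [] R' ms []" for ms :: "bool list list"
      proof -
        have "chain [] (?A @ R') (map (map (\<lambda>_. False)) ca @ ms) []"
          using chain_appendI[OF chain_map[OF c(2), of "\<lambda>_. False"]] ms by simp
        then obtain g where "map (map (\<lambda>_. False)) ca @ ms = map (map g) (ca @ cs)"
          using R'(1) unfolding faithful_def by blast
        then show ?thesis by (intro exI[of _ g]) simp
      qed
      then show ?thesis using R'(2) unfolding faithful_def by blast
    qed
    moreover have "card (labels cs) - 1 \<le> card (components B)"
    proof -
      obtain cB where cB: "chain [] B cB []" "(\<Union>x\<in>set cB. set x) = {x \<in> labels cs. x \<noteq> l}"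
        using chain_restr[OF R'(2), of "\<lambda>k. \<not> ?Q k"] by (auto simp: B_def labels_def)
      have "labels cB = labels cs - {l}" using cB(2) by (auto simp: labels_def)
      then have "card (labels cB) = card (labels cs) - 1" using l finite_labels by simp
      then show ?thesis using card_components_ge[OF cB(1)] by simp
    qed
    moreover have "1 \<le> card (components K)"
    proof -
      obtain cK :: "(nat \<times> nat) set list list" where cK: "faithful K cK" using faithful_link[OF K] by blast
      then have "labels cK \<noteq> {}"
        using labels_nonempty[of K cK] K by (auto simp: faithful_def link_diagram_iff)
      then show ?thesis unfolding card_components[OF cK] using finite_labels
        by (simp add: Suc_le_eq card_gt_0_iff)
    qed
    moreover have "card (labels cs) \<ge> 1" using l finite_labels by (auto simp: Suc_le_eq card_gt_0_iff)
    \<comment> \<open>\<open>K\<close> and \<open>B\<close> together have as many components as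
      there are labels in \<open>cs\<close>. Since \<open>B\<close> has at least all but one of
      these and \<open>K\<close> at least one, \<open>K\<close> has exactly one.\<close>
    ultimately have "card (components K) = 1"
      using card_components[OF fR] by linarith
    then have knot: "knot_diagram K" using K by (simp add: knot_diagram_def)
    have "req 0 (?A @ R') (?A @ K @ B)" using req_left[of 0 ?A R' "K @ B"] sep wA by simp
    from req_regular[OF this lR'(2)] have iso: "link_diagram (?A @ K @ B)" "regular_isotopic (?A @ R') (?A @ K @ B)"
      by auto
    have "card (components (?A @ K @ B)) = n"
      using card_components_regular[OF iso(2)] card_components[OF R'(1)] n by simp
    moreover have "length B < length R"
    proof -
      have "length K + length B \<le> length R"
        using restr_length[OF R'(2), of ?Q] R'(4) by (simp add: K_def B_def)
      moreover have "0 < length K" using K by (simp add: link_diagram_iff)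
      ultimately show ?thesis by linarith
    qed
    ultimately have "Z (concat (Ks @ [K]) @ B) = 0"
      using less'.hyps[of B "Ks @ [K]"] iso(1) less'.prems(2) knot B by auto
    moreover have "Z (?A @ R') = Z (?A @ K @ B)"
      using inv iso lR'(2) unfolding regular_isotopy_invariant_def by blast
    ultimately show ?thesis using R'(5) by simp
  qed
qed

lemma Z_zero: "link_diagram L \<Longrightarrow> Z L = 0"
proof (induction "card (components L)" arbitrary: L rule: less_induct)
  case less
  show ?case
    using Z_split[of "card (components L)" "[]" L] less by (auto simp: link_diagram_iff)
qed

end

theorem theorem6:
  fixes T :: "slices \<Rightarrow> laurent"
  assumes "dubrovnik T"
  shows "(\<forall>D. regular_isotopy_invariant D \<and> mixed_skein D \<and> unlinked_values T D \<longrightarrow>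
            (\<forall>L. link_diagram L \<longrightarrow> D L = X_formula T L)) \<and>
         regular_isotopy_invariant (X_formula T) \<and>
         mixed_skein (X_formula T) \<and>
         unlinked_values T (X_formula T)"
proof -
  interpret T: skein_functional T by (rule dubrovnik_skein_functional[OF assms])
  note X = T.X_invariant T.X_mixed_skein X_unlinked[OF assms]
  have "D L = X_formula T L"
    if D: "regular_isotopy_invariant D" "mixed_skein D" "unlinked_values T D" and L: "link_diagram L" for D L
  proof -
    \<comment> \<open>(1) is linear in the invariant and (2) prescribes its values, so the
      difference of two solutions satisfies (1) and vanishes on unlinked knots.\<close>
    interpret mixed_skein_vanishing "\<lambda>L. D L - X_formula T L"
    proof
      show "regular_isotopy_invariant (\<lambda>L. D L - X_formula T L)"
        using D(1) X(1) unfolding regular_isotopy_invariant_def by metis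
      show "mixed_skein (\<lambda>L. D L - X_formula T L)"
        unfolding mixed_skein_def
      proof (intro allI impI)
        fix t Lp Lm L0 Linf assume *: "conway_quadruple t Lp Lm L0 Linf \<and> mixed_crossing Lp t"
        have e: "D Lp - D Lm = lz * (D L0 - D Linf)"
          "X_formula T Lp - X_formula T Lm = lz * (X_formula T L0 - X_formula T Linf)"
          using * D(2) X(2) unfolding mixed_skein_def by blast+
        have "D Lp - X_formula T Lp - (D Lm - X_formula T Lm) =
            (D Lp - D Lm) - (X_formula T Lp - X_formula T Lm)" by simp
        also have "\<dots> = lz * (D L0 - X_formula T L0 - (D Linf - X_formula T Linf))"
          unfolding e by (simp add: algebra_simps)
        finally show "D Lp - X_formula T Lp - (D Lm - X_formula T Lm) =
            lz * (D L0 - X_formula T L0 - (D Linf - X_formula T Linf))" .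
      qed
      show "D L - X_formula T L = 0" if "r \<ge> 1" "unlinked_knots r L" for r L
        using that D(3) X(3) unfolding unlinked_values_def by simp
    qed
    show ?thesis using Z_zero[OF L] by simp
  qed
  with X show ?thesis by blast
qed

end
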